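(* Let $0<p_1,\dots,p_r,q_1,\dots,q_s<1$ and let $X_1,\dots,X_n$ be i.i.d. with a probability density $f\in BVC^*[p_1,\dots,p_r,q_1,\dots,q_s](0,1)$. Let $Q=\sum_{i=1}^n(X_i-\overline X)^2$, $p=\min(p_1,\dots,p_r,q_1,\dots,q_s)$ and $\delta=\min(np,n-1)/2$. Then the density $f_Q$ of $Q$ is square integrable on $(0,q)$ whenever $\delta>1/2$; for all $n$ with $\delta>1/4$, the cdf of $Q$ is given, for $0\le x\le q$, by $$F_Q(x)=2\pi^{-3/2}\sqrt n\int_0^1\sum_{k=1}^\infty \operatorname{Im}\Big(\sqrt{-it_k}\,\big(\psi^*(t_k,-u)\big)^n\Big)\frac{1-\cos(t_kx)}{k}\,du$$ $$\qquad+2\pi^{-3/2}\sqrt n\int_0^\infty\sum_{k=1}^\infty \operatorname{Im}\Big(\big(\psi(t_k,y)\big)^n+\big(\psi(t_k,-y-\sqrt{-it_k})\big)^n\Big)\frac{1-\cos(t_kx)}{k}\,dy ,$$ and for all $n$ with $\delta>1$ the density $f_Q$ is obtained by differentiating under the integral sign in this representation.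
   Context: $BVC[a,b]$ denotes the class of functions $f:[a,b]\to\mathbb R$ that are continuous on $[a,b]$ and (absolutely continuous) with derivative $f'\in\mathcal L^1(a,b)$. For $0<p_1,\dots,p_r,q_1,\dots,q_s<1$, $BVC^*[p_1,\dots,p_r,q_1,\dots,q_s](0,1)$ is the class of real (unbounded) functions $f$ on $(0,1)$ for which there exist $f_0\in BVC[0,1]$ and real numbers $a_1,\dots,a_r,b_1,\dots,b_s$ with $f(x)-\sum_{i=1}^r a_ix^{p_i-1}-\sum_{j=1}^s b_j(1-x)^{q_j-1}=f_0(x)$ on $(0,1)$. $q=\sup Q$ equals $n/4$ for $n$ even and $(n^2-1)/(4n)$ for $n$ odd, and $t_k=k\pi/q$. Square roots are principal branches. $\psi(t,z)=\mathbb E\exp(-(z+\sqrt{-it}\,X)^2)$ and $\psi^*(t,u)=\psi(t,u\sqrt{-it})=\mathbb E\exp(it(X+u)^2)$, $X$ having density $f$. *)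

theory Defs
  imports "HOL-Probability.Probability"
begin

text \<open>BVC[a,b]: continuous on [a,b] and absolutely continuous with derivative in L1(a,b),
  rendered as: f is the indefinite Lebesgue integral of an L1 function g on [a,b].\<close>
definition BVC :: "real \<Rightarrow> real \<Rightarrow> (real \<Rightarrow> real) \<Rightarrow> bool" where
  "BVC a b f \<longleftrightarrow> continuous_on {a..b} f \<and>
     (\<exists>g. set_integrable lborel {a..b} g \<and>
          (\<forall>x\<in>{a..b}. f x = f a + (LBINT y:{a..x}. g y)))"

definition BVC_star :: "real list \<Rightarrow> real list \<Rightarrow> (real \<Rightarrow> real) \<Rightarrow> bool" where
  "BVC_star ps qs f \<longleftrightarrow>
     (\<exists>f0 a b. BVC 0 1 f0 \<and> length a = length ps \<and> length b = length qs \<and>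
        (\<forall>x\<in>{0<..<1}.
           f x - (\<Sum>i<length ps. a ! i * x powr (ps ! i - 1))
               - (\<Sum>j<length qs. b ! j * (1 - x) powr (qs ! j - 1)) = f0 x))"

text \<open>q = sup Q (maximal value of Q)\<close>
definition qmax :: "nat \<Rightarrow> real" where
  "qmax n = (if even n then real n / 4 else (real n ^ 2 - 1) / (4 * real n))"

definition tk :: "nat \<Rightarrow> nat \<Rightarrow> real" where
  "tk n k = real k * pi / qmax n"

definition psi :: "(real \<Rightarrow> real) \<Rightarrow> real \<Rightarrow> complex \<Rightarrow> complex" where
  "psi f t z = (LBINT x:{0<..<1}. complex_of_real (f x) *
                  exp (- ((z + csqrt (- \<i> * complex_of_real t) * complex_of_real x) ^ 2)))"

definition psi_star :: "(real \<Rightarrow> real) \<Rightarrow> real \<Rightarrow> real \<Rightarrow> complex" where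
  "psi_star f t u = psi f t (complex_of_real u * csqrt (- \<i> * complex_of_real t))"

definition term1 :: "(real \<Rightarrow> real) \<Rightarrow> nat \<Rightarrow> nat \<Rightarrow> real \<Rightarrow> real" where
  "term1 f n k u = Im (csqrt (- \<i> * complex_of_real (tk n k)) * (psi_star f (tk n k) (- u)) ^ n)"

definition term2 :: "(real \<Rightarrow> real) \<Rightarrow> nat \<Rightarrow> nat \<Rightarrow> real \<Rightarrow> real" where
  "term2 f n k y = Im ((psi f (tk n k) (complex_of_real y)) ^ n
      + (psi f (tk n k) (- complex_of_real y - csqrt (- \<i> * complex_of_real (tk n k)))) ^ n)"

definition repr :: "(real \<Rightarrow> real) \<Rightarrow> nat \<Rightarrow> (nat \<Rightarrow> real \<Rightarrow> real) \<Rightarrow> real \<Rightarrow> real" where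
  "repr f n w x = 2 * pi powr (-3/2) * sqrt (real n) *
     ((LBINT u:{0<..<1}. (\<Sum>k. term1 f n (Suc k) u * w (Suc k) x))
    + (LBINT y:{0<..}. (\<Sum>k. term2 f n (Suc k) y * w (Suc k) x)))"

definition cdf_repr :: "(real \<Rightarrow> real) \<Rightarrow> nat \<Rightarrow> real \<Rightarrow> real" where
  "cdf_repr f n x = repr f n (\<lambda>k x. (1 - cos (tk n k * x)) / real k) x"

text \<open>Termwise derivative in x of (1 - cos(t_k x))/k.\<close>
definition dens_repr :: "(real \<Rightarrow> real) \<Rightarrow> nat \<Rightarrow> real \<Rightarrow> real" where
  "dens_repr f n x = repr f n (\<lambda>k x. tk n k * sin (tk n k * x) / real k) x"

end

theory Submission
  imports Defs "HOL-Complex_Analysis.Cauchy_Integral_Theorem"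
begin

text \<open>
  Write \<open>s = sqrt (- i t)\<close>. Since \<open>\<Sum>(z + s X\<^sub>i)\<^sup>2 = n (z + s m)\<^sup>2 - i t Q\<close> for the sample mean \<open>m\<close>,
  independence gives \<open>\<psi>(t, z)^n = E (exp (i t Q) exp (- n (z + s m)\<^sup>2))\<close>. Integrating over \<open>z\<close> along the
  broken line \<open>- \<infinity> - s, - s, 0, \<infinity>\<close> removes the Gaussian factor by Cauchy's theorem, so \<open>E exp (i t Q)\<close>
  is an integral of \<open>\<psi>^n\<close>. As \<open>Q\<close> lives on \<open>(0, q)\<close>, its distribution function is a series in
  \<open>(1 - cos (t\<^sub>k x)) / k\<close> whose coefficients are the imaginary parts of these integrals; Abel summation
  identifies the sum once the coefficients are absolutely summable.

  Everything else is a matter of decay in \<open>t\<close>. Near an endpoint the density behaves like \<open>x^(p-1)\<close>; integrating by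
  parts against the primitive of the oscillating Gaussian bounds \<open>\<psi>\<close> by \<open>t^(-p/2)\<close> uniformly, and by the
  additional factor \<open>(sqrt t u)^(-\<rho>)\<close>, \<open>\<rho> \<le> min p (1-p)\<close>, when the stationary point has distance \<open>u\<close> from the
  endpoint. Taking \<open>n\<close>-th powers and integrating in \<open>u\<close> yields exponents beyond \<open>0\<close>, \<open>1/2\<close> and \<open>1\<close> exactly
  when \<open>\<delta>\<close> exceeds \<open>1/4\<close>, \<open>1/2\<close> and \<open>1\<close>. This permits exchanging sum and integral, produces
  a square integrable density by completeness of \<open>L\<^sup>2\<close>, and justifies termwise differentiation, respectively.
\<close>

section \<open>Oscillatory Gaussian integrals\<close>

text \<open>Integrating over real \<open>z\<close> would be useless for estimates:
  \<open>Re ((y + s x)^2) = y^2 + 2 x y Re s\<close>, so for negative \<open>y\<close> the Gaussian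
  factor can grow to \<open>exp (t x^2 / 2)\<close>. The broken line is bent such that, for all
  \<open>x\<close> in the unit interval, both rays keep the factor \<open>exp (- y^2)\<close>, while
  on the segment \<open>z = - u s\<close> the modulus is one and the stationary point is
  \<open>x = u\<close>.

  The price is the length \<open>sqrt t\<close> of that segment. The bound \<open>t^(-p/2)\<close>
  alone leaves \<open>t^(1/2 - n p/2)\<close>; the factor with \<rho> gains
  \<open>t^(-n \<rho>/2)\<close>, provided \<open>n \<rho> < 1\<close> keeps
  \<open>u^(-n \<rho>)\<close> integrable. The exponent \<open>n p/2 - (1 - n \<rho>)/2\<close> is
  therefore capped by \<open>\<rho> \<le> p\<close>, \<open>\<rho> \<le> 1 - p\<close> and
  \<open>n \<rho> < 1\<close>, that is by \<open>n p - 1/2\<close>, \<open>(n - 1)/2\<close> and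
  \<open>n p/2\<close>. For exponents from \<open>1/2\<close> upwards the first cap follows from the
  third, so \<delta> decides; for mere positivity the first cap binds, and \<open>n p > 1/2\<close>
  is where the threshold \<open>1/4\<close> comes from.\<close>

lemma gauss_osc_right:
  fixes s z :: complex and a b c t K :: real
  assumes ab: "a \<le> b" and ca: "c < a" and t: "0 < t" and s: "norm s = sqrt t"
    and low: "\<And>x. a \<le> x \<Longrightarrow> x \<le> b \<Longrightarrow> sqrt t * \<bar>x - c\<bar> \<le> norm (z + s * of_real x)"
    and K: "\<And>x. a \<le> x \<Longrightarrow> x \<le> b \<Longrightarrow> norm (exp (- ((z + s * of_real x)^2))) \<le> K"
  shows "norm (integral {a..b} (\<lambda>x. exp (- ((z + s * of_real x)^2)))) \<le> K / (t * (a - c))"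
proof -
  define G where "G = (\<lambda>x::real. exp (- ((z + s * of_real x)^2)))"
  \<comment> \<open>With \<open>w = z + s x\<close>, the derivative of
    \<open>- exp (- w^2) / (2 w)\<close> in \<open>w\<close> is \<open>exp (- w^2)\<close> plus the
    smaller term \<open>exp (- w^2) / (2 w^2)\<close>. \<open>P\<close> is this function divided by
    \<open>s\<close>, and \<open>R\<close> is the remainder. Both are controlled through
    \<open>low\<close>, where \<open>c\<close> acts as the stationary point.\<close>
  define P where "P = (\<lambda>x::real. - G x / (2 * s * (z + s * of_real x)))"
  define R where "R = (\<lambda>x::real. G x / (2 * (z + s * of_real x)^2))"
  have s0: "s \<noteq> 0" using s t by auto
  have K0: "0 \<le> K" using K[of a] ab norm_ge_zero order_trans by blast
  have pos: "0 < sqrt t * (x - c)" if "a \<le> x" for x using that ca t by simp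
  have nz: "z + s * of_real x \<noteq> 0" if "a \<le> x" "x \<le> b" for x
    using low[OF that] pos[OF that(1)] ca that by auto
  have sq: "t * (x - c)^2 \<le> norm ((z + s * of_real x)^2)" if "a \<le> x" "x \<le> b" for x
  proof -
    have "(sqrt t * \<bar>x - c\<bar>)^2 \<le> (norm (z + s * of_real x))^2"
      using low[OF that] by (intro power_mono) (use t in auto)
    then show ?thesis using t by (simp add: power_mult_distrib norm_power)
  qed
  have Pd: "(P has_vector_derivative (G x + R x)) (at x within {a..b})" if "x \<in> {a..b}" for x
  proof -
    have nzx: "z + s * of_real x \<noteq> 0" using nz that by auto
    have "((\<lambda>w. - exp (- (w^2)) / (2 * s * w)) has_field_derivative
        exp (- (w^2)) / s + exp (- (w^2)) / (2 * s * w^2)) (at w)" if "w \<noteq> 0" for w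
      using s0 that
      by (auto intro!: derivative_eq_intros simp: divide_simps power2_eq_square) (simp add: algebra_simps)
    then have "((\<lambda>w. - exp (- (w^2)) / (2 * s * w)) \<circ> (\<lambda>w. z + s * w) has_field_derivative
        (exp (- ((z + s * x)^2)) / s + exp (- ((z + s * x)^2)) / (2 * s * (z + s * x)^2)) * s) (at (of_real x))"
      using nzx by (intro DERIV_chain) (auto intro!: derivative_eq_intros)
    moreover have "(exp (- ((z + s * x)^2)) / s + exp (- ((z + s * x)^2)) / (2 * s * (z + s * x)^2)) * s = G x + R x"
      unfolding G_def R_def using s0 by (simp add: field_simps)
    ultimately have "((\<lambda>w. - exp (- ((z + s * w)^2)) / (2 * s * (z + s * w))) has_field_derivative (G x + R x)) (at (of_real x))"
      by (simp add: o_def)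
    then have "((\<lambda>x. - exp (- ((z + s * of_real x)^2)) / (2 * s * (z + s * of_real x))) has_vector_derivative (G x + R x)) (at x)"
      by (rule has_vector_derivative_real_field)
    then show ?thesis unfolding P_def G_def by (rule has_vector_derivative_at_within)
  qed
  have int1: "((\<lambda>x. G x + R x) has_integral (P b - P a)) {a..b}"
    by (rule fundamental_theorem_of_calculus[OF ab Pd])
  have contG: "continuous_on {a..b} G" unfolding G_def by (intro continuous_intros)
  have contR: "continuous_on {a..b} R" unfolding R_def using nz
    by (intro continuous_intros contG) auto
  have intR: "R integrable_on {a..b}" by (rule integrable_continuous_real[OF contR])
  have intG: "G integrable_on {a..b}" by (rule integrable_continuous_real[OF contG])
  have eq: "integral {a..b} G = P b - P a - integral {a..b} R"
    using int1 intR intG by (metis add_diff_cancel_right' integral_add integral_unique)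
  define k where "k = (\<lambda>x. K / (2 * t) * (1 / (x - c)^2))"
  have kint: "(k has_integral (K / (2*t) * (- 1 / (b - c)) - K / (2*t) * (- 1 / (a - c)))) {a..b}"
  proof (rule fundamental_theorem_of_calculus[OF ab])
    fix x assume "x \<in> {a..b}"
    then have "x - c \<noteq> 0" using ca by auto
    then show "((\<lambda>x. K / (2*t) * (- 1 / (x - c))) has_vector_derivative k x) (at x within {a..b})"
      unfolding k_def has_real_derivative_iff_has_vector_derivative[symmetric]
      using t by (auto intro!: derivative_eq_intros simp: power2_eq_square divide_simps)
  qed
  have "norm (integral {a..b} R) \<le> integral {a..b} k"
  proof (rule integral_norm_bound_integral[OF intR])
    show "k integrable_on {a..b}" using kint by blast
    fix x assume x: "x \<in> {a..b}"
    have "norm (R x) = norm (G x) / (2 * norm ((z + s * of_real x)^2))"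
      unfolding R_def by (simp add: norm_divide norm_mult)
    also have "\<dots> \<le> K / (2 * (t * (x - c)^2))"
      using K[of x] sq[of x] x K0 t ca unfolding G_def
      by (intro frac_le mult_left_mono) auto
    finally show "norm (R x) \<le> k x" unfolding k_def by (simp add: field_simps)
  qed
  also have "integral {a..b} k = K / (2*t) * (1 / (a - c) - 1 / (b - c))"
    using integral_unique[OF kint] by (simp add: algebra_simps)
  finally have R: "norm (integral {a..b} R) \<le> K / (2*t) * (1 / (a - c) - 1 / (b - c))" .
  have Pb: "norm (P x) \<le> K / (2*t) * (1 / (x - c))" if "a \<le> x" "x \<le> b" for x
  proof -
    have "norm (P x) = norm (G x) / (2 * sqrt t * norm (z + s * of_real x))"
      unfolding P_def using s by (simp add: norm_divide norm_mult)
    also have "\<dots> \<le> K / (2 * sqrt t * (sqrt t * \<bar>x - c\<bar>))"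
      using K[OF that] low[OF that] K0 t ca that unfolding G_def
      by (intro frac_le mult_left_mono) auto
    also have "\<dots> = K / (2*t) * (1 / (x - c))" using t that ca
      by (simp add: mult.assoc[symmetric] divide_simps)
    finally show ?thesis .
  qed
  have "norm (integral {a..b} G) \<le> norm (P b) + norm (P a) + norm (integral {a..b} R)"
    unfolding eq by (meson norm_triangle_ineq4 norm_triangle_le_diff order_refl order_trans add_mono)
  also have "\<dots> \<le> K / (2*t) * (1 / (b - c)) + K / (2*t) * (1 / (a - c)) + K / (2*t) * (1 / (a - c) - 1 / (b - c))"
    using Pb[of a] Pb[of b] R ab by (intro add_mono) auto
  \<comment> \<open>The boundary term at \<open>b\<close> cancels against the upper limit of the
    remainder integral, so the bound is independent of \<open>b\<close>.\<close>
  also have "\<dots> = K / (t * (a - c))"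
  proof -
    have "k * x + k * y + k * (y - x) = 2 * k * y" for k x y :: real by (simp add: algebra_simps)
    from this[of "K / (2*t)" "1 / (b - c)" "1 / (a - c)"] show ?thesis by simp
  qed
  finally show ?thesis unfolding G_def .
qed

text \<open>Reflecting \<open>x\<close> to \<open>- x\<close> turns \<open>s\<close> into
  \<open>- s\<close> and \<open>c\<close> into \<open>- c\<close>, and both norm hypotheses
  survive.\<close>

lemma gauss_osc_left:
  fixes s z :: complex and a b c t K :: real
  assumes ab: "a \<le> b" and ca: "b < c" and t: "0 < t" and s: "norm s = sqrt t"
    and low: "\<And>x. a \<le> x \<Longrightarrow> x \<le> b \<Longrightarrow> sqrt t * \<bar>x - c\<bar> \<le> norm (z + s * of_real x)"
    and K: "\<And>x. a \<le> x \<Longrightarrow> x \<le> b \<Longrightarrow> norm (exp (- ((z + s * of_real x)^2))) \<le> K"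
  shows "norm (integral {a..b} (\<lambda>x. exp (- ((z + s * of_real x)^2)))) \<le> K / (t * (c - b))"
proof -
  have "integral {-b..-a} (\<lambda>x. exp (- ((z + (-s) * of_real x)^2)))
      = integral {a..b} (\<lambda>x. exp (- ((z + s * of_real x)^2)))"
    using Henstock_Kurzweil_Integration.integral_reflect_real[of b a "\<lambda>x. exp (- ((z + s * of_real x)^2))"] by simp
  moreover have "norm (integral {-b..-a} (\<lambda>x. exp (- ((z + (-s) * of_real x)^2)))) \<le> K / (t * (-b - (-c)))"
  proof (rule gauss_osc_right)
    fix x assume x: "-b \<le> x" "x \<le> -a"
    show "sqrt t * \<bar>x - - c\<bar> \<le> norm (z + - s * of_real x)" using low[of "-x"] x by (simp add: abs_minus_commute add.commute)
    show "norm (exp (- (z + - s * complex_of_real x)\<^sup>2)) \<le> K" using K[of "-x"] x by simp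
  qed (use assms in auto)
  ultimately show ?thesis by simp
qed

text \<open>A window of radius \<open>1 / sqrt t\<close> about \<open>c\<close> is estimated by its
  length, the two sides by oscillation. With this radius all three pieces are of order
  \<open>K / sqrt t\<close>, and 4 is 1 + 2 + 1.\<close>

lemma gauss_osc_uniform:
  fixes s z :: complex and a b c t K :: real
  assumes ab: "a \<le> b" and t: "0 < t" and s: "norm s = sqrt t"
    and low: "\<And>x. a \<le> x \<Longrightarrow> x \<le> b \<Longrightarrow> sqrt t * \<bar>x - c\<bar> \<le> norm (z + s * of_real x)"
    and K: "\<And>x. a \<le> x \<Longrightarrow> x \<le> b \<Longrightarrow> norm (exp (- ((z + s * of_real x)^2))) \<le> K"
  shows "norm (integral {a..b} (\<lambda>x. exp (- ((z + s * of_real x)^2)))) \<le> 4 * K / sqrt t"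
proof -
  define G where "G = (\<lambda>x::real. exp (- ((z + s * of_real x)^2)))"
  define \<tau> where "\<tau> = 1 / sqrt t"
  have \<tau>: "0 < \<tau>" "1 / (t * \<tau>) = 1 / sqrt t" unfolding \<tau>_def using t by (auto simp: real_div_sqrt)
  have K0: "0 \<le> K" using K[of a] ab norm_ge_zero order_trans by blast
  have contG: "continuous_on A G" for A unfolding G_def by (intro continuous_intros)
  have intG: "G integrable_on {x..y}" for x y by (rule integrable_continuous_real[OF contG])
  \<comment> \<open>The clamping keeps the cut points ordered inside the interval even if
    \<open>c\<close> lies outside it; a side piece is nondegenerate only if it stays at distance at
    least \<tau> from \<open>c\<close>.\<close>
  define l where "l = max a (min b (c - \<tau>))"
  define r where "r = min b (max l (c + \<tau>))"
  have lr: "a \<le> l" "l \<le> r" "r \<le> b" "l \<le> b" using ab \<tau> unfolding l_def r_def by auto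
  have split: "integral {a..b} G = integral {a..l} G + integral {l..r} G + integral {r..b} G"
    using Henstock_Kurzweil_Integration.integral_combine[OF lr(1,4) intG[of a b]]
      Henstock_Kurzweil_Integration.integral_combine[OF lr(2,3) intG[of l b]] by (simp add: add.assoc)
  have 1: "norm (integral {a..l} G) \<le> K / sqrt t"
  proof (cases "a < l")
    case True
    then have lc: "l \<le> c - \<tau>" unfolding l_def by auto
    have "norm (integral {a..l} G) \<le> K / (t * (c - l))" unfolding G_def
      using lc \<tau> lr by (intro gauss_osc_left assms) auto
    also have "\<dots> \<le> K / (t * \<tau>)" using lc \<tau> t K0 by (intro divide_left_mono mult_left_mono) auto
    also have "\<dots> = K / sqrt t" using \<tau>(2) by (metis times_divide_eq_right mult.right_neutral)
    finally show ?thesis .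
  qed (use lr K0 t in auto)
  have 2: "norm (integral {r..b} G) \<le> K / sqrt t"
  proof (cases "r < b")
    case True
    then have lc: "r \<ge> c + \<tau>" unfolding r_def by auto
    have "norm (integral {r..b} G) \<le> K / (t * (r - c))" unfolding G_def
      using lc \<tau> lr by (intro gauss_osc_right assms) auto
    also have "\<dots> \<le> K / (t * \<tau>)" using lc \<tau> t K0 by (intro divide_left_mono mult_left_mono) auto
    also have "\<dots> = K / sqrt t" using \<tau>(2) by (metis times_divide_eq_right mult.right_neutral)
    finally show ?thesis .
  qed (use lr K0 t in auto)
  have "norm (integral {l..r} G) \<le> K * (r - l)"
    by (rule integral_bound[OF lr(2) contG]) (use K lr in \<open>auto simp: G_def\<close>)
  also have "\<dots> \<le> K * (2 * \<tau>)"
  proof (rule mult_left_mono[OF _ K0])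
    show "r - l \<le> 2 * \<tau>" using \<tau> ab unfolding l_def r_def by (auto simp: min_def max_def split: if_splits)
  qed
  finally have 3: "norm (integral {l..r} G) \<le> 2 * K / sqrt t" unfolding \<tau>_def by (simp add: mult.commute)
  have "norm (integral {a..b} G) \<le> K / sqrt t + 2 * K / sqrt t + K / sqrt t"
    unfolding split by (intro norm_triangle_le add_mono 1 2 3)
  then show ?thesis unfolding G_def by (simp add: field_simps)
qed

section \<open>Pairing with densities in BVC*\<close>

lemma set_integral_eq_has_integral_nonneg:
  fixes f :: "real \<Rightarrow> real"
  assumes A: "A \<in> sets borel" and meas: "set_borel_measurable borel A f"
    and nn: "\<And>x. x \<in> A \<Longrightarrow> 0 \<le> f x" and I: "(f has_integral I) A"
  shows "set_integrable lborel A f" "(LBINT x:A. f x) = I"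
proof -
  have I0: "0 \<le> I" using has_integral_nonneg[OF I] nn by auto
  have "(\<integral>\<^sup>+x. ennreal (indicator A x * f x) \<partial>lborel) = ennreal I"
    using nn_integral_has_integral_lebesgue[OF nn I] by simp
  moreover have "(\<lambda>x. indicator A x * f x) \<in> borel_measurable lborel"
    using meas by (simp add: set_borel_measurable_def)
  ultimately have "has_bochner_integral lborel (\<lambda>x. indicator A x * f x) I"
    using nn I0 by (intro has_bochner_integral_nn_integral) (auto simp: indicator_def)
  then show "set_integrable lborel A f" "(LBINT x:A. f x) = I"
    by (auto simp: set_integrable_def set_lebesgue_integral_def has_bochner_integral_iff)
qed

lemma powr_integral_0:
  fixes p A :: real assumes "0 < p" "0 \<le> A"
  shows "set_integrable lborel {0..A} (\<lambda>x. x powr (p - 1))"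
    "(LBINT x:{0..A}. x powr (p - 1)) = A powr p / p"
  using set_integral_eq_has_integral_nonneg[of "{0..A}" "\<lambda>x. x powr (p - 1)" "A powr p / p"]
    has_integral_powr_from_0[of "p - 1" A] assms by (auto simp: set_borel_measurable_def)

lemma powr_integral_tail:
  fixes p d :: real assumes "p < 1" "0 < d"
  shows "set_integrable lborel {d..} (\<lambda>x. x powr (p - 2))"
    "(LBINT x:{d..}. x powr (p - 2)) = d powr (p - 1) / (1 - p)"
proof -
  have "((\<lambda>x. x powr (p - 2)) has_integral (d powr (p - 1) / (1 - p))) {d..}"
    using has_integral_powr_to_inf[of "p - 2" d] assms
    by (simp add: minus_divide_left[symmetric] minus_divide_right)
  from set_integral_eq_has_integral_nonneg[OF _ _ _ this]
  show "set_integrable lborel {d..} (\<lambda>x. x powr (p - 2))"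
    "(LBINT x:{d..}. x powr (p - 2)) = d powr (p - 1) / (1 - p)"
    by (auto simp: set_borel_measurable_def)
qed

text \<open>Apart from the single point \<open>s = A\<close>, this is
  \<open>s powr (p - 2) * min s A\<close> for positive \<open>s\<close>: the profile obtained when a
  primitive grows at most linearly and is capped at \<open>A\<close>.\<close>

definition cut_weight :: "real \<Rightarrow> real \<Rightarrow> real \<Rightarrow> real" where
  "cut_weight p A s = indicator {0..A} s * s powr (p - 1) + A * (indicator {A..} s * s powr (p - 2))"

lemma cut_weight_integral:
  assumes "0 < p" "p < 1" "0 < A"
  shows "integrable lborel (cut_weight p A)" "(LBINT s. cut_weight p A s) = (1/p + 1/(1-p)) * A powr p"
proof -
  note a = powr_integral_0[of p A] powr_integral_tail[of p A]
  have 1: "integrable lborel (\<lambda>s. indicator {0..A} s * s powr (p - 1))"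
    "integrable lborel (\<lambda>s. A * (indicator {A..} s * s powr (p - 2)))"
    using a assms by (auto simp: set_integrable_def)
  then show "integrable lborel (cut_weight p A)" unfolding cut_weight_def by auto
  have "(LBINT s. cut_weight p A s) = A powr p / p + A * (A powr (p - 1) / (1 - p))"
    unfolding cut_weight_def using a assms 1 by (simp add: set_lebesgue_integral_def)
  also have "A * (A powr (p - 1) / (1 - p)) = A powr p / (1 - p)"
    using assms by (simp add: powr_mult_base)
  finally show "(LBINT s. cut_weight p A s) = (1/p + 1/(1-p)) * A powr p" by (simp add: algebra_simps)
qed

lemma le_cut_weight:
  assumes "0 < s" "e \<le> s" "e \<le> A" "0 < A"
  shows "s powr (p - 2) * e \<le> cut_weight p A s"
proof (cases "s \<le> A")
  case True
  have "s powr (p - 2) * e \<le> s powr (p - 2) * s" using assms by (intro mult_left_mono) auto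
  also have "\<dots> = s powr (p - 1)" using powr_mult_base[of s "p - 2"] assms by (simp add: mult.commute)
  also have "\<dots> \<le> cut_weight p A s" unfolding cut_weight_def using True assms by (auto simp: indicator_def)
  finally show ?thesis .
next
  case False
  have "s powr (p - 2) * e \<le> s powr (p - 2) * A" using assms by (intro mult_left_mono) auto
  also have "\<dots> \<le> cut_weight p A s" unfolding cut_weight_def using False assms by (auto simp: indicator_def)
  finally show ?thesis .
qed

lemma cut_weight_nonneg: "0 \<le> A \<Longrightarrow> 0 \<le> cut_weight p A s"
  unfolding cut_weight_def by (auto simp: indicator_def)

text \<open>A bound \<open>B\<close> for the integral of \<open>s powr (p - 2) * E s\<close> over
  the unit interval, the quantity left after integrating a power \<open>x powr (p - 1)\<close> by
  parts. It is phrased through a majorant so that nothing about measurability of \<open>E\<close>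
  has to be shown and the majorant can be glued from several regimes.\<close>

definition weight_le :: "real \<Rightarrow> (real \<Rightarrow> real) \<Rightarrow> real \<Rightarrow> bool" where
  "weight_le p E B \<longleftrightarrow> (\<exists>w. integrable lborel w \<and> (LBINT s. w s) \<le> B \<and> (\<forall>s. 0 \<le> w s) \<and>
     (\<forall>s. 0 < s \<longrightarrow> s < 1 \<longrightarrow> s powr (p - 2) * E s \<le> w s))"

lemma weight_le_mono: "weight_le p E B \<Longrightarrow> B \<le> B' \<Longrightarrow> weight_le p E B'"
  unfolding weight_le_def by (meson order_trans)

text \<open>The three controls match the three ingredients of a BVC* density: integrals over
  arbitrary subintervals for the absolutely continuous part, weighted primitives from the left and
  from the right end for the powers of \<open>x\<close> and of \<open>1 - x\<close>.\<close>

definition pairing_le :: "real \<Rightarrow> (real \<Rightarrow> complex) \<Rightarrow> real \<Rightarrow> bool" where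
  "pairing_le p G B \<longleftrightarrow> continuous_on {0..1} G \<and>
     (\<forall>a b. 0 \<le> a \<longrightarrow> a \<le> b \<longrightarrow> b \<le> 1 \<longrightarrow> norm (integral {a..b} G) \<le> B) \<and>
     weight_le p (\<lambda>s. norm (integral {0..s} G)) B \<and> weight_le p (\<lambda>s. norm (integral {1-s..1} G)) B"

text \<open>Integration by parts against the primitive \<open>E\<close> of \<open>G\<close> gives
  \<open>E 1\<close> plus \<open>1 - p'\<close> times the integral of
  \<open>x powr (p' - 2) * E x\<close>; each of the two is at most \<open>B\<close>. Replacing
  \<open>p'\<close> by the smaller \<open>p\<close> only enlarges the weight on the unit
  interval.\<close>

lemma powr_pairing_bound:
  fixes G :: "real \<Rightarrow> complex"
  assumes p: "0 < p" "p \<le> p'" "p' < 1"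
    and G: "continuous_on {0..1} G"
    and W: "weight_le p (\<lambda>s. norm (integral {0..s} G)) B"
    and E1: "norm (integral {0..1} G) \<le> B"
  shows "set_integrable lborel {0<..<1} (\<lambda>x. of_real (x powr (p' - 1)) * G x)"
    "norm (LBINT x:{0<..<1}. of_real (x powr (p' - 1)) * G x) \<le> 2 * B"
proof -
  from W obtain w where w: "integrable lborel w" "(LBINT s. w s) \<le> B" "\<And>s. 0 \<le> w s"
    and wE: "\<And>s. 0 < s \<Longrightarrow> s < 1 \<Longrightarrow> s powr (p - 2) * norm (integral {0..s} G) \<le> w s"
    unfolding weight_le_def by blast
  define E where "E = (\<lambda>s. integral {0..s} G)"
  have B0: "0 \<le> B" using E1 norm_ge_zero order_trans by blast
  have "compact (G ` {0..1})" by (rule compact_continuous_image[OF G]) auto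
  then obtain K where K: "\<And>x. x \<in> {0..1} \<Longrightarrow> norm (G x) \<le> K" "0 < K"
    using compact_imp_bounded bounded_pos by (metis imageI)
  have Ederiv: "(E has_vector_derivative G x) (at x)" if "0 < x" "x < 1" for x
  proof -
    have "(E has_vector_derivative G x) (at x within {0..1})"
      unfolding E_def using integral_has_vector_derivative[OF G, of x] that by auto
    then show ?thesis using that by (simp add: at_within_Icc_at)
  qed
  have Econt: "continuous_on {0..1} E"
    unfolding E_def by (rule indefinite_integral_continuous_1[OF integrable_continuous_real[OF G]])
  have Ebound: "norm (E x) \<le> K * x" if "0 \<le> x" "x \<le> 1" for x
    unfolding E_def using integral_bound[of 0 x G K] that K(1) continuous_on_subset[OF G, of "{0..x}"] by auto
  have sub: "{0<..<1::real} \<subseteq> {0..1}" by auto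
  have Gm: "set_borel_measurable borel {0<..<1} G"
    using borel_measurable_continuous_on_indicator[of "{0<..<1}" G] continuous_on_subset[OF G sub]
    by (auto simp: set_borel_measurable_def)
  have Em: "set_borel_measurable borel {0<..<1} E"
    using borel_measurable_continuous_on_indicator[of "{0<..<1}" E] continuous_on_subset[OF Econt sub]
    by (auto simp: set_borel_measurable_def)
  have mm: "set_borel_measurable lborel {0<..<1} (\<lambda>x. of_real (h x) * f x)"
    if "set_borel_measurable borel {0<..<1} f" "h \<in> borel_measurable borel" for f :: "real \<Rightarrow> complex" and h :: "real \<Rightarrow> real"
  proof -
    have "(\<lambda>x. of_real (h x) * (indicator {0<..<1} x *\<^sub>R f x)) \<in> borel_measurable borel"
      using that unfolding set_borel_measurable_def by measurable
    then show ?thesis by (simp add: set_borel_measurable_def)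
  qed
  show int1: "set_integrable lborel {0<..<1} (\<lambda>x. of_real (x powr (p' - 1)) * G x)"
  proof (rule set_integrable_bound)
    have "set_integrable lborel {0<..<1} (\<lambda>x. x powr (p' - 1))"
      by (rule set_integrable_subset[OF powr_integral_0(1)[of p' 1]]) (use p in auto)
    then show "set_integrable lborel {0<..<1} (\<lambda>x. K * x powr (p' - 1))" by simp
    show "set_borel_measurable lborel {0<..<1} (\<lambda>x. of_real (x powr (p' - 1)) * G x)"
      by (rule mm[OF Gm]) measurable
    show "AE x in lborel. x \<in> {0<..<1} \<longrightarrow> norm (of_real (x powr (p' - 1)) * G x) \<le> norm (K * x powr (p' - 1))"
      using K by (auto simp: norm_mult mult.commute[of K] intro!: AE_I2 mult_left_mono)
  qed
  have dom: "norm (of_real (x powr (p' - 2)) * E x) \<le> w x" if "x \<in> {0<..<1}" for x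
  proof -
    have "x powr (p' - 2) \<le> x powr (p - 2)" using that p by (intro powr_mono') auto
    then have "norm (of_real (x powr (p' - 2)) * E x) \<le> x powr (p - 2) * norm (E x)"
      by (simp add: norm_mult mult_right_mono)
    also have "\<dots> \<le> w x" using wE[of x] that unfolding E_def by auto
    finally show ?thesis .
  qed
  have wint: "set_integrable lborel {0<..<1} w"
    unfolding set_integrable_def using w(1) by (intro integrable_mult_indicator) auto
  have int2: "set_integrable lborel {0<..<1} (\<lambda>x. of_real (x powr (p' - 2)) * E x)"
  proof (rule set_integrable_bound[OF wint])
    show "set_borel_measurable lborel {0<..<1} (\<lambda>x. of_real (x powr (p' - 2)) * E x)"
      by (rule mm[OF Em]) measurable
    show "AE x in lborel. x \<in> {0<..<1} \<longrightarrow> norm (of_real (x powr (p' - 2)) * E x) \<le> norm (w x)"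
      using dom w(3) by (intro AE_I2) auto
  qed
  have int2': "set_integrable lborel {0<..<1} (\<lambda>x. of_real (p' - 1) * (of_real (x powr (p' - 2)) * E x))"
    using int2 by (rule set_integrable_mult_right)
  define H where "H = (\<lambda>x. of_real (x powr (p' - 1)) * E x)"
  define h where "h = (\<lambda>x. of_real (p' - 1) * (of_real (x powr (p' - 2)) * E x) + of_real (x powr (p' - 1)) * G x)"
  have ein: "einterval 0 1 = {0<..<1}" by (auto simp: einterval_def)
  have hint: "set_integrable lborel (einterval 0 1) h"
    unfolding ein h_def by (rule set_integral_add(1)[OF int2' int1])
  \<comment> \<open>The subtracted \<open>0\<close> is the limit of \<open>H\<close> at the left
    end: \<open>E\<close> is at most linear there, so \<open>H\<close> is bounded by a multiple of
    \<open>x powr p'\<close>. The version with one-sided limits is used because \<open>h\<close> may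
    be unbounded near 0.\<close>
  have "(LBINT x=0..1. h x) = E 1 - 0"
  proof (rule interval_integral_FTC_integrable[OF _ _ _ hint, where F = H])
    fix x :: real assume "0 < ereal x" "ereal x < 1"
    then have x: "0 < x" "x < 1" by auto
    have "((\<lambda>x. x powr (p' - 1)) has_real_derivative (p' - 1) * x powr (p' - 2)) (at x)"
      using x by (auto intro!: derivative_eq_intros)
    then have "((\<lambda>x. complex_of_real (x powr (p' - 1))) has_vector_derivative of_real ((p' - 1) * x powr (p' - 2))) (at x)"
      by (intro has_vector_derivative_of_real) (simp add: has_real_derivative_iff_has_vector_derivative)
    from has_vector_derivative_mult[OF this Ederiv[OF x]]
    show "(H has_vector_derivative h x) (at x)" unfolding H_def h_def by (simp add: add.commute mult.assoc)
    have "isCont E x" using Ederiv[OF x] has_vector_derivative_continuous by blast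
    moreover have "isCont G x"
      using continuous_on_interior[OF G] x by (simp add: interior_atLeastAtMost_real)
    ultimately show "isCont h x" unfolding h_def using x by (intro continuous_intros) auto
  next
    have "(H \<longlongrightarrow> 0) (at_right 0)"
    proof (rule Lim_null_comparison)
      show "\<forall>\<^sub>F x in at_right 0. norm (H x) \<le> K * x powr p'"
        unfolding eventually_at_right_field
      proof (intro exI[of _ 1] conjI allI impI)
        fix x :: real assume x: "0 < x" "x < 1"
        have "norm (H x) \<le> x powr (p' - 1) * (K * x)" unfolding H_def using x Ebound[of x]
          by (auto simp: norm_mult intro!: mult_left_mono)
        also have "\<dots> = K * x powr p'" using powr_mult_base[of x "p' - 1"] x by (simp add: mult_ac)
        finally show "norm (H x) \<le> K * x powr p'" .
      qed auto
      have "((\<lambda>x. K * x powr p') \<longlongrightarrow> K * 0 powr p') (at_right 0)"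
        using p by (intro tendsto_intros) (auto simp: eventually_at_right_field intro!: exI[of _ 1])
      then show "((\<lambda>x. K * x powr p') \<longlongrightarrow> 0) (at_right 0)" using p by simp
    qed
    then show "((H \<circ> real_of_ereal) \<longlongrightarrow> 0) (at_right 0)"
      using ereal_tendsto_simps1(2)[of H 0] by (simp add: zero_ereal_def)
    have "(E \<longlongrightarrow> E 1) (at 1 within {0..1})"
      using Econt by (auto simp: continuous_on_def)
    then have "(E \<longlongrightarrow> E 1) (at_left 1)" by (simp add: at_within_Icc_at_left)
    then have "(H \<longlongrightarrow> of_real (1 powr (p' - 1)) * E 1) (at_left 1)"
      unfolding H_def by (intro tendsto_intros) auto
    then show "((H \<circ> real_of_ereal) \<longlongrightarrow> E 1) (at_left 1)"
      using ereal_tendsto_simps1(1)[of H "E 1" 1] by (simp add: one_ereal_def)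
  qed auto
  also have "(LBINT x=0..1. h x) = (LBINT x:{0<..<1}. h x)"
    by (simp add: interval_lebesgue_integral_def ein)
  also have "\<dots> = (LBINT x:{0<..<1}. of_real (p' - 1) * (of_real (x powr (p' - 2)) * E x))
      + (LBINT x:{0<..<1}. of_real (x powr (p' - 1)) * G x)"
    unfolding h_def by (rule set_integral_add(2)[OF int2' int1])
  also have "(LBINT x:{0<..<1}. of_real (p' - 1) * (of_real (x powr (p' - 2)) * E x))
      = of_real (p' - 1) * (LBINT x:{0<..<1}. of_real (x powr (p' - 2)) * E x)"
    by (rule set_integral_mult_right)
  finally have sum: "of_real (p' - 1) * (LBINT x:{0<..<1}. of_real (x powr (p' - 2)) * E x)
      + (LBINT x:{0<..<1}. of_real (x powr (p' - 1)) * G x) = E 1" by simp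
  have eq: "(LBINT x:{0<..<1}. of_real (x powr (p' - 1)) * G x)
      = E 1 + of_real (1 - p') * (LBINT x:{0<..<1}. of_real (x powr (p' - 2)) * E x)"
  proof -
    have "of_real (p' - 1) * c + d = e \<Longrightarrow> d = e + of_real (1 - p') * c" for c d e :: complex
      by (auto simp: algebra_simps)
    then show ?thesis using sum .
  qed
  have "norm (LBINT x:{0<..<1}. of_real (x powr (p' - 2)) * E x) \<le> (LBINT s. w s)"
    unfolding set_lebesgue_integral_def
    by (rule Bochner_Integration.integral_norm_bound_integral[OF int2[unfolded set_integrable_def] w(1)])
      (use dom w(3) in \<open>auto simp: indicator_def\<close>)
  then have n2: "norm (LBINT x:{0<..<1}. of_real (x powr (p' - 2)) * E x) \<le> B" using w(2) by simp
  have "norm (of_real (1 - p') * (LBINT x:{0<..<1}. of_real (x powr (p' - 2)) * E x)) \<le> 1 * B"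
    unfolding norm_mult using p by (intro mult_mono n2) (auto simp del: of_real_diff)
  then show "norm (LBINT x:{0<..<1}. of_real (x powr (p' - 1)) * G x) \<le> 2 * B"
    unfolding eq using E1 unfolding E_def by (intro norm_triangle_le) auto
qed


lemma lborel_set_integral_reflect_unit:
  fixes F :: "real \<Rightarrow> 'a::{banach, second_countable_topology}"
  shows "(LBINT x:S. F x) = (LBINT x:{x. 1 - x \<in> S}. F (1 - x))"
    "set_integrable lborel S F \<Longrightarrow> set_integrable lborel {x. 1 - x \<in> S} (\<lambda>x. F (1 - x))"
proof -
  have ind: "indicator S (1 - x) = (indicator {x. 1 - x \<in> S} x :: real)" for x
    by (auto simp: indicator_def)
  show "(LBINT x:S. F x) = (LBINT x:{x. 1 - x \<in> S}. F (1 - x))"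
    unfolding set_lebesgue_integral_def
    by (subst lborel_integral_real_affine[where c="-1" and t=1]) (auto simp: ind)
  show "set_integrable lborel {x. 1 - x \<in> S} (\<lambda>x. F (1 - x))" if "set_integrable lborel S F"
    using lborel_integrable_real_affine[of "\<lambda>x. indicator S x *\<^sub>R F x" "-1" 1] that
    by (simp add: set_integrable_def ind)
qed

lemma powr_pairing_bound_reflected:
  fixes G :: "real \<Rightarrow> complex"
  assumes p: "0 < p" "p \<le> p'" "p' < 1"
    and G: "continuous_on {0..1} G"
    and W: "weight_le p (\<lambda>s. norm (integral {1-s..1} G)) B"
    and E1: "norm (integral {0..1} G) \<le> B"
  shows "set_integrable lborel {0<..<1} (\<lambda>x. of_real ((1 - x) powr (p' - 1)) * G x)"
    "norm (LBINT x:{0<..<1}. of_real ((1 - x) powr (p' - 1)) * G x) \<le> 2 * B"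
proof -
  have G': "continuous_on {0..1} (\<lambda>x. G (1 - x))"
    by (rule continuous_on_compose2[OF G]) (auto intro!: continuous_intros)
  have eqI: "integral {0..s} (\<lambda>x. G (1 - x)) = integral {1-s..1} G" if "0 \<le> s" "s \<le> 1" for s
  proof -
    have c: "set_integrable lborel {1-s..1} G"
      by (rule borel_integrable_atLeastAtMost'[OF continuous_on_subset[OF G]]) (use that in auto)
    have c': "set_integrable lborel {0..s} (\<lambda>x. G (1 - x))"
      by (rule borel_integrable_atLeastAtMost'[OF continuous_on_subset[OF G']]) (use that in auto)
    have e: "{x. 1 - x \<in> {1-s..1}} = {0..s}" by auto
    show ?thesis
      using lborel_set_integral_reflect_unit(1)[of "{1-s..1}" G]
      unfolding e set_borel_integral_eq_integral(2)[OF c] set_borel_integral_eq_integral(2)[OF c'] by simp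
  qed
  have e: "{x. 1 - x \<in> {0<..<1::real}} = {0<..<1}" by auto
  have W': "weight_le p (\<lambda>s. norm (integral {0..s} (\<lambda>x. G (1 - x)))) B"
    using W unfolding weight_le_def by (simp add: eqI)
  have *: "set_integrable lborel {0<..<1} (\<lambda>x. of_real (x powr (p' - 1)) * G (1 - x))"
    "norm (LBINT x:{0<..<1}. of_real (x powr (p' - 1)) * G (1 - x)) \<le> 2 * B"
    using powr_pairing_bound[OF p G' W'] E1 eqI[of 1] by simp_all
  show "set_integrable lborel {0<..<1} (\<lambda>x. of_real ((1 - x) powr (p' - 1)) * G x)"
    using lborel_set_integral_reflect_unit(2)[OF *(1)] unfolding e by simp
  show "norm (LBINT x:{0<..<1}. of_real ((1 - x) powr (p' - 1)) * G x) \<le> 2 * B"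
    using *(2) lborel_set_integral_reflect_unit(1)[of "{0<..<1}" "\<lambda>x. of_real (x powr (p' - 1)) * G (1 - x)"]
    unfolding e by simp
qed

text \<open>A product majorant with integrable factors supplies the premise of Fubini's theorem,
  both for the pairing with an absolutely continuous function and for exchanging expectation and
  contour integral.\<close>

lemma (in pair_sigma_finite) integrable_pair_bound:
  fixes F :: "'a \<times> 'b \<Rightarrow> 'c::{banach, second_countable_topology}" and a :: "'a \<Rightarrow> real" and b :: "'b \<Rightarrow> real"
  assumes F: "F \<in> borel_measurable (M1 \<Otimes>\<^sub>M M2)" and a: "integrable M1 a" and b: "integrable M2 b"
    and bound: "\<And>x y. x \<in> space M1 \<Longrightarrow> y \<in> space M2 \<Longrightarrow> norm (F (x, y)) \<le> a x * b y"
  shows "integrable (M1 \<Otimes>\<^sub>M M2) F"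
proof (rule Bochner_Integration.integrable_bound[OF _ F])
  have [measurable]: "a \<in> borel_measurable M1" "b \<in> borel_measurable M2" using a b by auto
  show "integrable (M1 \<Otimes>\<^sub>M M2) (\<lambda>(x, y). a x * b y)"
    by (rule Fubini_integrable) (use a b in \<open>auto simp: abs_mult\<close>)
  show "AE z in M1 \<Otimes>\<^sub>M M2. norm (F z) \<le> norm (case z of (x, y) \<Rightarrow> a x * b y)"
    using bound by (intro AE_I2) (force simp: space_pair_measure)
qed

text \<open>Fubini takes the place of integration by parts: inserting
  \<open>f0 x = f0 0 + \<integral> g\<close> and integrating over \<open>x\<close> first leaves
  \<open>f0 0\<close> times the full integral of \<open>G\<close>, plus \<open>g y\<close> paired
  with the integral of \<open>G\<close> from \<open>y\<close> to 1. Hence \<open>C\<close> is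
  \<open>\<bar>f0 0\<bar>\<close> plus the L1 norm of \<open>g\<close>, independent of
  \<open>G\<close>.\<close>

lemma BVC_pairing_bound:
  assumes "BVC 0 1 f0"
  obtains C where "0 \<le> C"
    "\<And>(G :: real \<Rightarrow> complex) B. continuous_on {0..1} G \<Longrightarrow>
       (\<And>a b. 0 \<le> a \<Longrightarrow> a \<le> b \<Longrightarrow> b \<le> 1 \<Longrightarrow> norm (integral {a..b} G) \<le> B) \<Longrightarrow>
       norm (LBINT x:{0<..<1}. of_real (f0 x) * G x) \<le> C * B"
    "\<And>(G :: real \<Rightarrow> complex). continuous_on {0..1} G \<Longrightarrow> set_integrable lborel {0<..<1} (\<lambda>x. of_real (f0 x) * G x)"
proof -
  from assms obtain g where cont: "continuous_on {0..1} f0"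
    and g: "set_integrable lborel {0..1} g" and f0: "\<And>x. x \<in> {0..1} \<Longrightarrow> f0 x = f0 0 + (LBINT y:{0..x}. g y)"
    unfolding BVC_def by blast
  define g' where "g' = (\<lambda>y. indicator {0..1} y * g y)"
  have g'i: "integrable lborel g'" using g by (simp add: set_integrable_def g'_def)
  have [measurable]: "g' \<in> borel_measurable borel" using g'i by auto
  define C where "C = \<bar>f0 0\<bar> + (LBINT y. \<bar>g' y\<bar>)"
  have intb: "set_integrable lborel {0<..<1} (\<lambda>x. of_real (f0 x) * G x)"
    if "continuous_on {0..1} G" for G :: "real \<Rightarrow> complex"
  proof (rule set_integrable_subset)
    show "set_integrable lborel {0..1} (\<lambda>x. of_real (f0 x) * G x)"
      by (rule borel_integrable_atLeastAtMost') (intro continuous_intros that cont)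
  qed auto
  have "norm (LBINT x:{0<..<1}. of_real (f0 x) * G x) \<le> C * B"
    if G: "continuous_on {0..1} G" and B: "\<And>a b. 0 \<le> a \<Longrightarrow> a \<le> b \<Longrightarrow> b \<le> 1 \<Longrightarrow> norm (integral {a..b} G) \<le> B"
    for G :: "real \<Rightarrow> complex" and B
  proof -
    define G' where "G' = (\<lambda>x. indicator {0..1} x *\<^sub>R G x)"
    have Gs: "set_integrable lborel {0..1} G" by (rule borel_integrable_atLeastAtMost'[OF G])
    then have G'i: "integrable lborel G'" by (simp add: set_integrable_def G'_def)
    have [measurable]: "G' \<in> borel_measurable borel" using G'i by auto
    \<comment> \<open>The kernel lives on \<open>y \<le> x\<close>; its \<open>y\<close>-integral
      rebuilds \<open>f0 x - f0 0\<close>, its \<open>x\<close>-integral produces the tail integral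
      of \<open>G\<close>.\<close>
    define H where "H = (\<lambda>x y. of_real (indicator {..x} y * g' y) * G' x)"
    have Hm: "case_prod H \<in> borel_measurable (lborel \<Otimes>\<^sub>M lborel)"
    proof -
      have "(\<lambda>z::real \<times> real. (if snd z \<le> fst z then 1 else 0) * of_real (g' (snd z)) * G' (fst z)) \<in> borel_measurable (lborel \<Otimes>\<^sub>M lborel)"
        by measurable
      also have "(\<lambda>z::real \<times> real. (if snd z \<le> fst z then 1 else 0) * of_real (g' (snd z)) * G' (fst z)) = case_prod H"
        by (auto simp: H_def indicator_def fun_eq_iff)
      finally show ?thesis .
    qed
    have Hi: "integrable (lborel \<Otimes>\<^sub>M lborel) (case_prod H)"
      by (rule lborel_pair.integrable_pair_bound[OF Hm integrable_norm[OF G'i] integrable_norm[OF g'i]])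
        (auto simp: H_def norm_mult indicator_def)
    have Gab: "(LBINT x:{a..1}. G x) = integral {a..1} G" if "0 \<le> a" for a
      by (rule set_borel_integral_eq_integral(2)[OF set_integrable_subset[OF Gs]]) (use that in auto)
    have inner: "(LBINT x. H x y) = of_real (g' y) * integral {y..1} G" for y
    proof (cases "0 \<le> y")
      case True
      have "(LBINT x. H x y) = (LBINT x. of_real (g' y) * (indicator {y..1} x *\<^sub>R G x))"
        by (rule Bochner_Integration.integral_cong) (use True in \<open>auto simp: H_def G'_def indicator_def\<close>)
      also have "\<dots> = of_real (g' y) * (LBINT x:{y..1}. G x)"
        unfolding set_lebesgue_integral_def by (rule integral_mult_right_zero)
      finally show ?thesis using Gab[OF True] by simp
    qed (auto simp: H_def g'_def)
    have outer: "(LBINT y. H x y) = of_real (f0 x - f0 0) * G' x" for x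
    proof (cases "x \<in> {0..1}")
      case True
      have "(LBINT y. H x y) = (LBINT y. complex_of_real (indicator {0..x} y * g y)) * G' x"
        unfolding H_def Bochner_Integration.integral_mult_left_zero
        by (intro arg_cong2[where f="(*)"] Bochner_Integration.integral_cong refl)
          (use True in \<open>auto simp: g'_def indicator_def\<close>)
      also have "(LBINT y. complex_of_real (indicator {0..x} y * g y)) = of_real (f0 x - f0 0)"
        unfolding integral_complex_of_real using f0[OF True] by (simp add: set_lebesgue_integral_def)
      finally show ?thesis .
    qed (simp add: H_def G'_def)
    have "(LBINT x:{0<..<1}. of_real (f0 x) * G x) = (LBINT x:{0..1}. of_real (f0 x) * G x)"
      unfolding set_lebesgue_integral_def
      by (rule integral_discrete_difference[of "{0,1}"]) (auto simp: indicator_def)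
    also have "\<dots> = (LBINT x. of_real (f0 0) * G' x + of_real (f0 x - f0 0) * G' x)"
      unfolding set_lebesgue_integral_def
      by (rule Bochner_Integration.integral_cong) (auto simp: G'_def indicator_def algebra_simps)
    also have "\<dots> = (LBINT x. of_real (f0 0) * G' x) + (LBINT x. of_real (f0 x - f0 0) * G' x)"
    proof (rule Bochner_Integration.integral_add)
      show "integrable lborel (\<lambda>x. of_real (f0 x - f0 0) * G' x)"
        using lborel_pair.integrable_fst'[OF Hi] by (simp add: outer del: of_real_diff)
    qed (use G'i in auto)
    also have "(LBINT x. of_real (f0 x - f0 0) * G' x) = (LBINT x. LBINT y. H x y)" by (simp only: outer)
    also have "\<dots> = (LBINT y. LBINT x. H x y)" by (rule lborel_pair.Fubini_integral[OF Hi, symmetric])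
    also have "\<dots> = (LBINT y. of_real (g' y) * integral {y..1} G)" by (simp only: inner)
    also have "(LBINT x. of_real (f0 0) * G' x) = of_real (f0 0) * integral {0..1} G"
      using Gab[of 0] unfolding set_lebesgue_integral_def G'_def integral_mult_right_zero by simp
    finally have eq: "(LBINT x:{0<..<1}. of_real (f0 x) * G x)
        = of_real (f0 0) * integral {0..1} G + (LBINT y. of_real (g' y) * integral {y..1} G)" .
    have "norm (LBINT y. of_real (g' y) * integral {y..1} G) \<le> (LBINT y. B * \<bar>g' y\<bar>)"
    proof (rule Bochner_Integration.integral_norm_bound_integral)
      show "integrable lborel (\<lambda>y. of_real (g' y) * integral {y..1} G)"
        using lborel_pair.integrable_snd[OF Hi] by (simp add: inner)
      show "norm (of_real (g' y) * integral {y..1} G) \<le> B * \<bar>g' y\<bar>" for y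
      proof (cases "y \<in> {0..1}")
        case True
        then show ?thesis using B[of y 1] by (auto simp: norm_mult mult.commute[of B] intro!: mult_left_mono)
      qed (auto simp: g'_def)
    qed (use g'i in auto)
    then have "norm (LBINT x:{0<..<1}. of_real (f0 x) * G x) \<le> \<bar>f0 0\<bar> * B + B * (LBINT y. \<bar>g' y\<bar>)"
      unfolding eq using B[of 0 1] by (intro norm_triangle_le add_mono) (auto simp: norm_mult intro!: mult_left_mono)
    then show ?thesis unfolding C_def by (simp add: algebra_simps)
  qed
  moreover have "0 \<le> C" unfolding C_def by (simp add: integral_nonneg_AE)
  ultimately show thesis using that intb by blast
qed

text \<open>The constant depends on the density only, so the lemma may be applied to kernels
  \<open>G\<close> that vary with \<open>t\<close>, \<open>u\<close> and \<open>y\<close>. It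
  collects the bound for the absolutely continuous part and twice the moduli of the coefficients of
  the powers.\<close>

lemma BVC_star_pairing_bound:
  assumes f: "BVC_star ps qs f" and ps: "\<And>r. r \<in> set ps \<union> set qs \<Longrightarrow> p \<le> r \<and> r < 1" and p: "0 < p"
  obtains C where "0 \<le> C"
    "\<And>G B. pairing_le p G B \<Longrightarrow> norm (LBINT x:{0<..<1}. of_real (f x) * G x) \<le> C * B"
proof -
  from f obtain f0 a b where f0: "BVC 0 1 f0" and fx: "\<And>x. x \<in> {0<..<1} \<Longrightarrow>
      f x = f0 x + (\<Sum>i<length ps. a ! i * x powr (ps ! i - 1))
               + (\<Sum>j<length qs. b ! j * (1 - x) powr (qs ! j - 1))"
    unfolding BVC_star_def by (auto simp: algebra_simps)
  obtain C0 where C0: "0 \<le> C0"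
    "\<And>(G :: real \<Rightarrow> complex) B. continuous_on {0..1} G \<Longrightarrow>
       (\<And>a b. 0 \<le> a \<Longrightarrow> a \<le> b \<Longrightarrow> b \<le> 1 \<Longrightarrow> norm (integral {a..b} G) \<le> B) \<Longrightarrow>
       norm (LBINT x:{0<..<1}. of_real (f0 x) * G x) \<le> C0 * B"
    "\<And>(G :: real \<Rightarrow> complex). continuous_on {0..1} G \<Longrightarrow> set_integrable lborel {0<..<1} (\<lambda>x. of_real (f0 x) * G x)"
    by (rule BVC_pairing_bound[OF f0]) blast
  define C where "C = C0 + (\<Sum>i<length ps. \<bar>a ! i\<bar> * 2) + (\<Sum>j<length qs. \<bar>b ! j\<bar> * 2)"
  show thesis
  proof (rule that)
    show "0 \<le> C" unfolding C_def using C0(1) by (auto intro!: add_nonneg_nonneg sum_nonneg)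
    fix G :: "real \<Rightarrow> complex" and B
    assume "pairing_le p G B"
    then have G: "continuous_on {0..1} G"
      and B: "\<And>a b. 0 \<le> a \<Longrightarrow> a \<le> b \<Longrightarrow> b \<le> 1 \<Longrightarrow> norm (integral {a..b} G) \<le> B"
      and w0: "weight_le p (\<lambda>s. norm (integral {0..s} G)) B" and w1: "weight_le p (\<lambda>s. norm (integral {1-s..1} G)) B"
      by (auto simp: pairing_le_def)
    have P: "set_integrable lborel {0<..<1} (\<lambda>x. of_real (x powr (ps ! i - 1)) * G x)"
      "norm (LBINT x:{0<..<1}. of_real (x powr (ps ! i - 1)) * G x) \<le> 2 * B" if "i < length ps" for i
      using powr_pairing_bound[of p "ps ! i", OF p _ _ G w0 B] ps[of "ps ! i"] that by auto
    have Q: "set_integrable lborel {0<..<1} (\<lambda>x. of_real ((1 - x) powr (qs ! i - 1)) * G x)"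
      "norm (LBINT x:{0<..<1}. of_real ((1 - x) powr (qs ! i - 1)) * G x) \<le> 2 * B" if "i < length qs" for i
      using powr_pairing_bound_reflected[of p "qs ! i", OF p _ _ G w1 B] ps[of "qs ! i"] that by auto
    define P' where "P' = (\<lambda>i x. of_real (a ! i) * (indicator {0<..<1} x *\<^sub>R (of_real (x powr (ps ! i - 1)) * G x)))"
    define Q' where "Q' = (\<lambda>i x. of_real (b ! i) * (indicator {0<..<1} x *\<^sub>R (of_real ((1 - x) powr (qs ! i - 1)) * G x)))"
    define Z where "Z = (\<lambda>x. indicator {0<..<1} x *\<^sub>R (of_real (f0 x) * G x))"
    have Zi: "integrable lborel Z" using C0(3)[OF G] by (simp add: Z_def set_integrable_def)
    have Pi: "integrable lborel (P' i)" if "i < length ps" for i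
      using P(1)[OF that] unfolding P'_def set_integrable_def by (rule integrable_mult_right)
    have Qi: "integrable lborel (Q' i)" if "i < length qs" for i
      using Q(1)[OF that] unfolding Q'_def set_integrable_def by (rule integrable_mult_right)
    have "(LBINT x:{0<..<1}. of_real (f x) * G x)
      = (LBINT x. Z x + (\<Sum>i<length ps. P' i x) + (\<Sum>i<length qs. Q' i x))"
      unfolding set_lebesgue_integral_def
    proof (rule Bochner_Integration.integral_cong[OF refl])
      fix x :: real
      show "indicat_real {0<..<1} x *\<^sub>R (complex_of_real (f x) * G x)
        = Z x + (\<Sum>i<length ps. P' i x) + (\<Sum>i<length qs. Q' i x)"
        by (cases "x \<in> {0<..<1}")
          (simp_all add: Z_def P'_def Q'_def fx ring_distribs sum_distrib_right mult.assoc)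
    qed
    also have "\<dots> = (LBINT x. Z x) + (\<Sum>i<length ps. LBINT x. P' i x) + (\<Sum>i<length qs. LBINT x. Q' i x)"
      using Zi Pi Qi
      by (subst Bochner_Integration.integral_add Bochner_Integration.integral_sum;
          (intro Bochner_Integration.integrable_add Bochner_Integration.integrable_sum; simp)?)+ simp_all
    finally have eq: "(LBINT x:{0<..<1}. of_real (f x) * G x)
      = (LBINT x. Z x) + (\<Sum>i<length ps. LBINT x. P' i x) + (\<Sum>i<length qs. LBINT x. Q' i x)" .
    have "norm (LBINT x. Z x) \<le> C0 * B" using C0(2)[OF G B] by (simp add: Z_def set_lebesgue_integral_def)
    moreover have "norm (LBINT x. P' i x) \<le> (\<bar>a ! i\<bar> * 2) * B" if "i < length ps" for i
      using mult_left_mono[OF P(2)[OF that], of "\<bar>a ! i\<bar>"]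
      unfolding P'_def set_lebesgue_integral_def integral_mult_right_zero by (simp add: norm_mult del: integral_mult_right_zero)
    moreover have "norm (LBINT x. Q' i x) \<le> (\<bar>b ! i\<bar> * 2) * B" if "i < length qs" for i
      using mult_left_mono[OF Q(2)[OF that], of "\<bar>b ! i\<bar>"]
      unfolding Q'_def set_lebesgue_integral_def integral_mult_right_zero by (simp add: norm_mult del: integral_mult_right_zero)
    ultimately have "norm (LBINT x:{0<..<1}. of_real (f x) * G x)
      \<le> C0 * B + (\<Sum>i<length ps. (\<bar>a ! i\<bar> * 2) * B) + (\<Sum>i<length qs. (\<bar>b ! i\<bar> * 2) * B)"
      unfolding eq by (intro norm_triangle_le add_mono sum_norm_le) auto
    then show "norm (LBINT x:{0<..<1}. of_real (f x) * G x) \<le> C * B"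
      by (simp add: C_def sum_distrib_right ring_distribs)
  qed
qed

section \<open>Decay of psi\<close>

abbreviation sq :: "real \<Rightarrow> complex" where
  "sq t \<equiv> csqrt (- \<i> * complex_of_real t)"

lemma sq_facts:
  assumes "0 \<le> t"
  shows "sq t ^ 2 = - \<i> * of_real t" "norm (sq t) = sqrt t" "0 \<le> Re (sq t)"
proof -
  show 1: "sq t ^ 2 = - \<i> * of_real t" by (rule power2_csqrt)
  have "norm (sq t) ^ 2 = t" unfolding norm_power[symmetric] 1 using assms by (simp add: norm_mult)
  then show "norm (sq t) = sqrt t" by (metis norm_ge_zero real_sqrt_unique)
  show "0 \<le> Re (sq t)" using csqrt_principal[of "- \<i> * complex_of_real t"] by linarith
qed

abbreviation gauss :: "real \<Rightarrow> complex \<Rightarrow> real \<Rightarrow> complex" where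
  "gauss t z x \<equiv> exp (- ((z + sq t * of_real x)^2))"

text \<open>Since \<open>sq t ^ 2\<close> is imaginary and \<open>Re (sq t)\<close> is nonnegative,
  the cross term \<open>2 x y Re (sq t)\<close> can only help: it enlarges both the modulus and the
  real part of the square.\<close>

lemma gauss_right_facts:
  assumes t: "0 \<le> t" and y: "0 \<le> y" and x: "0 \<le> x"
  shows "sqrt t * x \<le> norm (of_real y + sq t * of_real x)"
    "norm (gauss t (of_real y) x) \<le> exp (- (y^2))"
proof -
  have "norm (of_real y + sq t * of_real x) ^ 2
      = y^2 + 2 * x * y * Re (sq t) + norm (sq t)^2 * x^2"
  proof -
    have "norm (of_real y + w * of_real x) ^ 2 = y^2 + 2 * x * y * Re w + norm w^2 * x^2" for w
      unfolding cmod_power2 by (simp add: power2_eq_square algebra_simps)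
    then show ?thesis .
  qed
  also have "\<dots> \<ge> (sqrt t * x)^2"
    using sq_facts[OF t] y x by (simp add: power_mult_distrib)
  finally show "sqrt t * x \<le> norm (of_real y + sq t * of_real x)"
    by (rule power2_le_imp_le) simp
  have "(of_real y + sq t * of_real x)^2 = of_real (y^2) + of_real (2 * x * y) * sq t + sq t ^ 2 * of_real (x^2)"
    by (simp add: power2_eq_square algebra_simps)
  then have "Re ((of_real y + sq t * of_real x)^2) = y^2 + 2 * x * y * Re (sq t)"
    unfolding sq_facts(1)[OF t] by (simp del: csqrt.simps)
  also have "\<dots> \<ge> y^2" using sq_facts(3)[OF t] y x by simp
  finally show "norm (gauss t (of_real y) x) \<le> exp (- (y^2))"
    by (simp add: norm_exp_eq_Re)
qed

text \<open>Up to sign, the argument is that of the right ray with \<open>x\<close> replaced by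
  \<open>1 - x\<close>; this is why the contour turns at \<open>- sq t\<close>.\<close>

lemma gauss_left_facts:
  assumes t: "0 \<le> t" and y: "0 \<le> y" and x: "x \<le> 1"
  shows "sqrt t * (1 - x) \<le> norm (- of_real y - sq t + sq t * of_real x)"
    "norm (gauss t (- of_real y - sq t) x) \<le> exp (- (y^2))"
proof -
  have e: "- of_real y - sq t + sq t * of_real x = - (of_real y + sq t * of_real (1 - x))"
    by (simp add: algebra_simps)
  show "sqrt t * (1 - x) \<le> norm (- of_real y - sq t + sq t * of_real x)"
    "norm (gauss t (- of_real y - sq t) x) \<le> exp (- (y^2))"
    unfolding e norm_minus_cancel power2_minus using gauss_right_facts[OF t y, of "1 - x"] x by auto
qed

lemma gauss_mid_facts:
  assumes t: "0 \<le> t"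
  shows "norm (of_real (- u) * sq t + sq t * of_real x) = sqrt t * \<bar>x - u\<bar>"
    "norm (gauss t (of_real (- u) * sq t) x) = 1"
proof -
  have e: "of_real (- u) * sq t + sq t * of_real x = sq t * of_real (x - u)"
    by (simp add: algebra_simps)
  show "norm (of_real (- u) * sq t + sq t * of_real x) = sqrt t * \<bar>x - u\<bar>"
    unfolding e norm_mult sq_facts(2)[OF t] by (simp del: of_real_diff)
  show "norm (gauss t (of_real (- u) * sq t) x) = 1"
    unfolding e power_mult_distrib sq_facts(1)[OF t] norm_exp_eq_Re by (simp flip: of_real_power del: of_real_diff)
qed

text \<open>Here \<open>v = sqrt t * u\<close> is the distance of the stationary point from the
  endpoint in units of the oscillation length. For \<open>v > 1\<close>, the range
  \<open>s \<le> u/2\<close> has the cap \<open>2 / (t u)\<close> and contributes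
  \<open>t^(-p/2) v^(-p)\<close>; the range beyond has the cap \<open>4 / sqrt t\<close> and
  contributes \<open>t^(-p/2) v^(p-1)\<close>. The gain is the worse of the two exponents, whence
  \<open>\<rho> \<le> p\<close> and \<open>\<rho> \<le> 1 - p\<close>.\<close>

lemma stationary_weight:
  fixes E :: "real \<Rightarrow> real"
  assumes p: "0 < p" "p < 1" and \<rho>: "0 \<le> \<rho>" "\<rho> \<le> p" "\<rho> \<le> 1 - p" and t: "1 \<le> t" and u: "0 < u" "u \<le> 1"
    and E1: "\<And>s. 0 < s \<Longrightarrow> s < 1 \<Longrightarrow> E s \<le> s" and E2: "\<And>s. 0 < s \<Longrightarrow> s < 1 \<Longrightarrow> E s \<le> 4 / sqrt t"
    and E3: "\<And>s. 0 < s \<Longrightarrow> s < 1 \<Longrightarrow> s \<le> u / 2 \<Longrightarrow> E s \<le> 2 / (t * u)"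
  shows "weight_le p E (10 * (1/p + 1/(1-p)) * (t powr (- p/2) * (sqrt t * u) powr (-\<rho>)))"
proof -
  define \<kappa> where "\<kappa> = 1/p + 1/(1-p)"
  have \<kappa>: "0 < \<kappa>" "1/(1-p) \<le> \<kappa>" "0 < 1/(1-p)" using p unfolding \<kappa>_def by (auto intro!: add_pos_pos)
  have \<kappa>0: "0 \<le> \<kappa>" using \<kappa>(1) by simp
  define v where "v = sqrt t * u"
  have v: "0 < v" using t u unfolding v_def by simp
  have four: "4 powr p \<le> (4::real)" using powr_mono[of p 1 "4::real"] p by simp
  have two: "2 powr p \<le> (2::real)" using powr_mono[of p 1 "2::real"] p by simp
  have sqp: "sqrt t powr a = t powr (a/2)" for a
    using t by (simp add: powr_half_sqrt[symmetric] powr_powr)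
  show ?thesis
  proof (cases "v \<le> 1")
    case True
    \<comment> \<open>Close to the endpoint nothing has to be gained:
      \<open>v powr (-\<rho>)\<close> is at least one, so the cap \<open>4 / sqrt t\<close> alone
      suffices.\<close>
    define A where "A = 4 / sqrt t"
    have A: "0 < A" using t unfolding A_def by simp
    have "(LBINT s. cut_weight p A s) = \<kappa> * A powr p" unfolding \<kappa>_def by (rule cut_weight_integral(2)[OF p A])
    also have "A powr p = 4 powr p * t powr (- p/2)"
      unfolding A_def using t by (simp add: powr_divide sqp powr_minus_divide)
    also have "\<kappa> * (4 powr p * t powr (- p/2)) \<le> \<kappa> * (10 * (t powr (- p/2) * v powr (-\<rho>)))"
    proof (intro mult_left_mono)
      have "1 \<le> v powr (-\<rho>)" using powr_mono'[of "-\<rho>" 0 v] True v \<rho> by auto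
      then have "4 * t powr (- p/2) * 1 \<le> 10 * t powr (- p/2) * v powr (-\<rho>)"
        by (intro mult_mono) auto
      moreover have "4 powr p * t powr (- p/2) \<le> 4 * t powr (- p/2)" using four by (intro mult_right_mono) auto
      ultimately show "4 powr p * t powr (- p/2) \<le> 10 * (t powr (- p/2) * v powr (-\<rho>))" by linarith
    qed (rule less_imp_le[OF \<kappa>(1)])
    finally have I: "(LBINT s. cut_weight p A s) \<le> 10 * \<kappa> * (t powr (- p/2) * v powr (-\<rho>))" by (simp add: mult_ac)
    show ?thesis unfolding weight_le_def
      using cut_weight_integral(1)[OF p A] I[unfolded \<kappa>_def v_def] cut_weight_nonneg[of A] A E1 E2
      by (intro exI[of _ "cut_weight p A"]) (auto simp: A_def intro!: le_cut_weight)
  next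
    case False
    define A1 where "A1 = 2 / (t * u)"
    define A2 where "A2 = 4 / sqrt t"
    have A: "0 < A1" "0 < A2" using t u unfolding A1_def A2_def by auto
    define w where "w = (\<lambda>s. cut_weight p A1 s + A2 * (indicator {u/2..} s * s powr (p - 2)))"
    have u2: "0 < u/2" using u by simp
    have i1: "integrable lborel (cut_weight p A1)" by (rule cut_weight_integral(1)[OF p A(1)])
    have i2: "integrable lborel (\<lambda>s. indicator {u/2..} s * s powr (p - 2))"
      using powr_integral_tail(1)[OF p(2) u2] by (simp add: set_integrable_def)
    have wi: "integrable lborel w" unfolding w_def using i1 i2 by auto
    have "(LBINT s. w s) = \<kappa> * A1 powr p + A2 * ((u/2) powr (p - 1) / (1 - p))"
      unfolding w_def using i1 i2 cut_weight_integral(2)[OF p A(1)] powr_integral_tail(2)[OF p(2) u2]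
      by (simp add: \<kappa>_def set_lebesgue_integral_def)
    also have "A1 powr p = 2 powr p * (t powr (- p/2) * v powr (-p))"
    proof -
      have "t * u = sqrt t * v" unfolding v_def using t by simp
      then have "A1 powr p = 2 powr p / (sqrt t * v) powr p" unfolding A1_def using v t by (simp add: powr_divide)
      also have "(sqrt t * v) powr p = t powr (p/2) * v powr p" using v t by (simp add: powr_mult sqp)
      finally show ?thesis by (simp add: powr_minus_divide)
    qed
    also have "A2 * ((u/2) powr (p - 1) / (1 - p)) = 1/(1-p) * (4 * 2 powr (1 - p) * (t powr (- p/2) * v powr (p - 1)))"
    proof -
      have "u/2 = v * (1 / sqrt t) * (1/2)" unfolding v_def using t by simp
      then have "(u/2) powr (p - 1) = v powr (p - 1) * (1 / sqrt t) powr (p - 1) * (1/2) powr (p - 1)"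
        using v t by (simp only: powr_mult)
      also have "(1/2::real) powr (p - 1) = 2 powr (1 - p)"
        using powr_minus_divide[of 2 "p - 1"] by (simp add: powr_divide)
      also have "(1 / sqrt t) powr (p - 1) = t powr ((1 - p)/2)"
      proof -
        have "1 / sqrt t = t powr (-1/2)" using t by (simp add: powr_minus_divide powr_half_sqrt)
        moreover have "(-1/2) * (p - 1) = (1 - p)/2" by (simp add: field_simps)
        ultimately show ?thesis by (simp only: powr_powr)
      qed
      finally have "A2 * (u/2) powr (p - 1) = 4 * 2 powr (1 - p) * ((1 / sqrt t) * t powr ((1 - p)/2) * v powr (p - 1))"
        unfolding A2_def by simp
      also have "(1 / sqrt t) * t powr ((1 - p)/2) = t powr (- p/2)"
      proof -
        have "1 / sqrt t = t powr (-1/2)" using t by (simp add: powr_minus_divide powr_half_sqrt)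
        then show ?thesis using t by (simp add: powr_add[symmetric]) (simp add: field_simps)
      qed
      finally show ?thesis by (simp add: field_simps)
    qed
    \<comment> \<open>The constant 10 is 2 + 8: \<open>2 powr p\<close> is at most 2, and
      \<open>4 * 2 powr (1 - p)\<close> at most 8.\<close>
    also have "\<kappa> * (2 powr p * (t powr (- p/2) * v powr (-p))) + 1/(1-p) * (4 * 2 powr (1 - p) * (t powr (- p/2) * v powr (p - 1)))
      \<le> 10 * \<kappa> * (t powr (- p/2) * v powr (-\<rho>))"
    proof -
      have m: "v powr (-p) \<le> v powr (-\<rho>)" "v powr (p-1) \<le> v powr (-\<rho>)"
        using False \<rho> by (auto intro!: powr_mono)
      have two': "2 powr (1 - p) \<le> (2::real)" using powr_mono[of "1 - p" 1 "2::real"] p by simp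
      define T where "T = t powr (- p/2) * v powr (-\<rho>)"
      have T: "0 \<le> T" unfolding T_def by simp
      have "2 powr p * (t powr (- p/2) * v powr (-p)) \<le> 2 * T"
        unfolding T_def using two m by (intro mult_mono) auto
      then have a: "\<kappa> * (2 powr p * (t powr (- p/2) * v powr (-p))) \<le> \<kappa> * (2 * T)"
        using \<kappa>0 by (rule mult_left_mono)
      have "4 * 2 powr (1 - p) * (t powr (- p/2) * v powr (p - 1)) \<le> 8 * T"
        unfolding T_def using two' m by (intro mult_mono) auto
      note b = this
      have "1/(1-p) * (4 * 2 powr (1 - p) * (t powr (- p/2) * v powr (p - 1))) \<le> \<kappa> * (8 * T)"
        by (rule mult_mono[OF \<kappa>(2) b \<kappa>0]) simp
      with a show ?thesis unfolding T_def[symmetric] by linarith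
    qed
    finally have I: "(LBINT s. w s) \<le> 10 * \<kappa> * (t powr (- p/2) * v powr (-\<rho>))" .
    show ?thesis unfolding weight_le_def
    proof (intro exI[of _ w] conjI allI impI wi I[unfolded \<kappa>_def v_def])
      show "0 \<le> w s" for s unfolding w_def using A cut_weight_nonneg[of A1] by (auto simp: indicator_def intro!: add_nonneg_nonneg)
      fix s :: real assume s: "0 < s" "s < 1"
      show "s powr (p - 2) * E s \<le> w s"
      proof (cases "s \<le> u/2")
        case True
        have "s powr (p - 2) * E s \<le> cut_weight p A1 s"
          by (rule le_cut_weight) (use s True E1[OF s] E3[OF s] A in \<open>auto simp: A1_def\<close>)
        also have "\<dots> \<le> w s" unfolding w_def using A by (auto simp: indicator_def)
        finally show ?thesis .
      next
        case False
        have "s powr (p - 2) * E s \<le> s powr (p - 2) * A2"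
          using E2[OF s] by (intro mult_left_mono) (auto simp: A2_def)
        also have "\<dots> \<le> w s" unfolding w_def using A cut_weight_nonneg[of A1 p s] False by (auto simp: indicator_def)
        finally show ?thesis .
      qed
    qed
  qed
qed


section \<open>Bounds on psi for a density with endpoint exponents at least p\<close>

locale BVC_star_density =
  fixes f :: "real \<Rightarrow> real" and ps qs :: "real list" and p :: real
  assumes BVC_star: "BVC_star ps qs f" and p: "0 < p" "p < 1"
    and ps: "\<And>r. r \<in> set ps \<union> set qs \<Longrightarrow> p \<le> r \<and> r < 1"
    and meas: "(\<lambda>x. indicator {0<..<1} x * f x) \<in> borel_measurable borel"
    and nonneg: "\<And>x. x \<in> {0<..<1} \<Longrightarrow> 0 \<le> f x"
    and int_f: "set_integrable lborel {0<..<1} f" "(LBINT x:{0<..<1}. f x) = 1"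
begin

lemma psi_alt: "psi f t z = (LBINT x. of_real (indicator {0<..<1} x * f x) * gauss t z x)"
  unfolding psi_def set_lebesgue_integral_def
  by (rule Bochner_Integration.integral_cong) (auto simp: indicator_def)

lemma psi_measurable [measurable]:
  assumes [measurable]: "g \<in> borel_measurable N"
  shows "(\<lambda>u. psi f t (g u)) \<in> borel_measurable N"
proof -
  note meas[measurable]
  have "(\<lambda>u. LBINT x. of_real (indicator {0<..<1} x * f x) * gauss t (g u) x) \<in> borel_measurable N"
    by measurable
  then show ?thesis unfolding psi_alt .
qed

lemma psi_trivial_bound:
  assumes K: "\<And>x. 0 \<le> x \<Longrightarrow> x \<le> 1 \<Longrightarrow> norm (gauss t z x) \<le> K"
  shows "norm (psi f t z) \<le> K"
proof -
  note meas[measurable]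
  have K0: "0 \<le> K" using K[of 0] norm_ge_zero order_trans by blast
  have i: "integrable lborel (\<lambda>x. indicator {0<..<1} x * f x)" using int_f by (simp add: set_integrable_def)
  have b: "norm (of_real (indicator {0<..<1} x * f x) * gauss t z x)
      \<le> K * (indicator {0<..<1} x * f x)" for x
  proof (cases "x \<in> {0<..<1}")
    case True
    then have "f x * norm (gauss t z x) \<le> f x * K"
      using K[of x] nonneg[of x] by (intro mult_left_mono) auto
    then show ?thesis using True nonneg[OF True] by (simp add: norm_mult mult.commute)
  qed auto
  have "norm (psi f t z) \<le> (LBINT x. K * (indicator {0<..<1} x * f x))"
    unfolding psi_alt
  proof (rule Bochner_Integration.integral_norm_bound_integral[OF _ _ b])
    show "integrable lborel (\<lambda>x. K * (indicator {0<..<1} x * f x))" using i by auto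
    then show "integrable lborel (\<lambda>x. of_real (indicator {0<..<1} x * f x) * gauss t z x)"
    proof (rule Bochner_Integration.integrable_bound)
      show "(\<lambda>x. of_real (indicator {0<..<1} x * f x) * gauss t z x) \<in> borel_measurable lborel"
        by measurable
      show "AE x in lborel. norm (of_real (indicator {0<..<1} x * f x) * gauss t z x)
          \<le> norm (K * (indicator {0<..<1} x * f x))"
        unfolding real_norm_def by (intro AE_I2 order_trans[OF b abs_ge_self])
    qed
  qed
  also have "\<dots> = K" using int_f by (simp add: set_lebesgue_integral_def)
  finally show ?thesis .
qed

text \<open>The primitive of the kernel is at most \<open>K * s\<close> and at most
  \<open>4 * K / sqrt t\<close>, so its weighted integral is of order
  \<open>K * t powr (- p/2)\<close>. The point \<open>c\<close> is left free to serve the right ray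
  with \<open>c = 0\<close> and the left ray with \<open>c = 1\<close>; \<open>K\<close> will carry
  the Gaussian factor in \<open>y\<close>.\<close>

lemma psi_uniform_bound:
  obtains C where "0 \<le> C"
    "\<And>t z c K. 1 \<le> t \<Longrightarrow>
      (\<And>x. 0 \<le> x \<Longrightarrow> x \<le> 1 \<Longrightarrow> sqrt t * \<bar>x - c\<bar> \<le> norm (z + sq t * of_real x)) \<Longrightarrow>
      (\<And>x. 0 \<le> x \<Longrightarrow> x \<le> 1 \<Longrightarrow> norm (gauss t z x) \<le> K) \<Longrightarrow>
      norm (psi f t z) \<le> C * K * t powr (- p/2)"
proof (rule BVC_star_pairing_bound[OF BVC_star ps p(1)])
  fix C0 assume C0: "0 \<le> C0" and
    main: "\<And>G B. pairing_le p G B \<Longrightarrow> norm (LBINT x:{0<..<1}. of_real (f x) * G x) \<le> C0 * B"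
  define \<kappa> where "\<kappa> = 1/p + 1/(1-p)"
  have \<kappa>: "1 \<le> \<kappa>" using p by (simp add: \<kappa>_def add_increasing2)
  show thesis
  proof (rule that[of "C0 * (16 * \<kappa>)"])
    show "0 \<le> C0 * (16 * \<kappa>)" using C0 \<kappa> by simp
    fix t z c K
    assume t: "1 \<le> t"
      and low: "\<And>x. 0 \<le> x \<Longrightarrow> x \<le> 1 \<Longrightarrow> sqrt t * \<bar>x - c\<bar> \<le> norm (z + sq t * of_real x)"
      and K: "\<And>x. 0 \<le> x \<Longrightarrow> x \<le> 1 \<Longrightarrow> norm (gauss t z x) \<le> K"
    define G where "G = (\<lambda>x::real. gauss t z x)"
    have K0: "0 < K" using K[of 0] by (metis norm_exp_eq_Re exp_gt_zero less_le_trans order_refl zero_le_one)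
    have G: "continuous_on {0..1} G" unfolding G_def by (intro continuous_intros)
    define A where "A = 4 / sqrt t"
    have A: "0 < A" "A \<le> 4" using t unfolding A_def by (auto simp: field_simps)
    define B where "B = K * (4 * \<kappa> * A powr p)"
    have osc: "norm (integral {a..b} G) \<le> K * A" if "0 \<le> a" "a \<le> b" "b \<le> 1" for a b
    proof -
      have "norm (integral {a..b} G) \<le> 4 * K / sqrt t"
        unfolding G_def by (rule gauss_osc_uniform[where c = c]) (use that t low K sq_facts(2)[of t] in auto)
      then show ?thesis by (simp add: A_def mult.commute)
    qed
    have lin: "norm (integral {a..b} G) \<le> K * (b - a)" if "0 \<le> a" "a \<le> b" "b \<le> 1" for a b
      by (rule integral_bound[OF that(2) continuous_on_subset[OF G]]) (use that K in \<open>auto simp: G_def\<close>)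
    \<comment> \<open>Unweighted interval integrals are of order \<open>A\<close>, which is a
      smaller power of \<open>t\<close> than \<open>A powr p\<close>; the comparison uses
      \<open>A \<le> 4\<close>, that is \<open>t \<ge> 1\<close>.\<close>
    have Ap: "A \<le> 4 * A powr p"
    proof -
      have "A = A powr p * A powr (1 - p)" using A by (simp add: powr_add[symmetric])
      also have "\<dots> \<le> A powr p * 4"
      proof (rule mult_left_mono)
        have "A powr (1 - p) \<le> 4 powr (1 - p)" using A p by (intro powr_mono2) auto
        also have "\<dots> \<le> 4" using powr_mono[of "1 - p" 1 "4::real"] p by simp
        finally show "A powr (1 - p) \<le> 4" .
      qed simp
      finally show ?thesis by simp
    qed
    define w where "w = (\<lambda>s. K * cut_weight p A s)"
    have wi: "integrable lborel w" unfolding w_def using cut_weight_integral(1)[OF p A(1)] by auto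
    have "(LBINT s. w s) = K * (\<kappa> * A powr p)" unfolding w_def \<kappa>_def using cut_weight_integral(2)[OF p A(1)] by simp
    also have "\<dots> \<le> B" unfolding B_def using K0 \<kappa> by (intro mult_left_mono) auto
    finally have wB: "(LBINT s. w s) \<le> B" .
    have w0: "0 \<le> w s" for s unfolding w_def using K0 cut_weight_nonneg[of A p s] A by simp
    have ww: "s powr (p - 2) * e \<le> w s" if "0 < s" "e \<le> K * s" "e \<le> K * A" for s e
    proof -
      have "s powr (p - 2) * (e / K) \<le> cut_weight p A s"
        using that K0 A by (intro le_cut_weight) (auto simp: field_simps)
      then show ?thesis unfolding w_def using K0 by (simp add: field_simps)
    qed
    have "norm (LBINT x:{0<..<1}. of_real (f x) * G x) \<le> C0 * B"
    proof (rule main, unfold pairing_le_def weight_le_def, intro conjI allI impI exI[of _ w] G wi wB w0)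
      fix a b :: real assume "0 \<le> a" "a \<le> b" "b \<le> 1"
      then have "norm (integral {a..b} G) \<le> K * A" by (rule osc)
      also have "\<dots> \<le> K * (4 * A powr p)" using Ap K0 by simp
      also have "\<dots> \<le> B" unfolding B_def using K0 \<kappa> by (intro mult_left_mono mult_right_mono) auto
      finally show "norm (integral {a..b} G) \<le> B" .
    next
      fix s :: real assume s: "0 < s" "s < 1"
      show "s powr (p - 2) * norm (integral {0..s} G) \<le> w s"
        by (rule ww) (use s osc[of 0 s] lin[of 0 s] in auto)
      show "s powr (p - 2) * norm (integral {1-s..1} G) \<le> w s"
        by (rule ww) (use s osc[of "1-s" 1] lin[of "1-s" 1] in auto)
    qed
    also have "\<dots> \<le> C0 * (K * (4 * \<kappa> * (4 * t powr (- p/2))))"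
    proof -
      have "A powr p = 4 powr p * t powr (- p/2)"
        unfolding A_def using t by (simp add: powr_divide powr_half_sqrt[symmetric] powr_powr powr_minus_divide)
      also have "\<dots> \<le> 4 * t powr (- p/2)"
        using powr_mono[of p 1 "4::real"] p by (intro mult_right_mono) auto
      finally show ?thesis unfolding B_def using C0 K0 \<kappa> by (intro mult_left_mono) auto
    qed
    finally show "norm (psi f t z) \<le> C0 * (16 * \<kappa>) * K * t powr (- p/2)"
      by (simp add: psi_def G_def mult_ac)
  qed
qed auto

text \<open>The stationary point \<open>u\<close> has distance \<open>u\<close> from the left and
  \<open>1 - u\<close> from the right endpoint. Each distance governs the weighted primitive from
  its own end, so the two gains appear as a sum.\<close>

lemma psi_star_bound:
  assumes \<rho>: "0 \<le> \<rho>" "\<rho> \<le> p" "\<rho> \<le> 1 - p"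
  obtains C where "0 \<le> C"
    "\<And>t u. 1 \<le> t \<Longrightarrow> 0 < u \<Longrightarrow> u < 1 \<Longrightarrow>
      norm (psi_star f t (- u)) \<le> C * (t powr (- p/2) * ((sqrt t * u) powr (-\<rho>) + (sqrt t * (1 - u)) powr (-\<rho>)))"
proof (rule BVC_star_pairing_bound[OF BVC_star ps p(1)])
  fix C0 assume C0: "0 \<le> C0" and
    main: "\<And>G B. pairing_le p G B \<Longrightarrow> norm (LBINT x:{0<..<1}. of_real (f x) * G x) \<le> C0 * B"
  define \<kappa> where "\<kappa> = 1/p + 1/(1-p)"
  have \<kappa>: "1 \<le> \<kappa>" using p by (simp add: \<kappa>_def add_increasing2)
  show thesis
  proof (rule that[of "C0 * (10 * \<kappa>)"])
    show "0 \<le> C0 * (10 * \<kappa>)" using C0 \<kappa> by simp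
    fix t u :: real
    assume t: "1 \<le> t" and u: "0 < u" "u < 1"
    define z where "z = of_real (- u) * sq t"
    define G where "G = (\<lambda>x::real. gauss t z x)"
    have low: "sqrt t * \<bar>x - u\<bar> \<le> norm (z + sq t * of_real x)" for x
      unfolding z_def using gauss_mid_facts(1)[of t u x] t by simp
    have K: "norm (gauss t z x) \<le> 1" for x
      unfolding z_def using gauss_mid_facts(2)[of t u x] t by simp
    have G: "continuous_on {0..1} G" unfolding G_def by (intro continuous_intros)
    have nsq: "norm (sq t) = sqrt t" using sq_facts(2)[of t] t by simp
    have osc: "norm (integral {a..b} G) \<le> 4 / sqrt t" if "0 \<le> a" "a \<le> b" "b \<le> 1" for a b
      using gauss_osc_uniform[of a b t "sq t" u z 1, OF that(2) _ nsq low K] t by (simp add: G_def)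
    have lin: "norm (integral {a..b} G) \<le> b - a" if "0 \<le> a" "a \<le> b" "b \<le> 1" for a b
      using integral_bound[OF that(2) continuous_on_subset[OF G], of 1] that K by (auto simp: G_def)
    define B0 where "B0 = t powr (- p/2) * (sqrt t * u) powr (-\<rho>)"
    define B1 where "B1 = t powr (- p/2) * (sqrt t * (1 - u)) powr (-\<rho>)"
    have B01: "0 \<le> B0" "0 \<le> B1" unfolding B0_def B1_def by auto
    define B where "B = 10 * \<kappa> * (B0 + B1)"
    have B0B: "10 * \<kappa> * B0 \<le> B" "10 * \<kappa> * B1 \<le> B"
      unfolding B_def using B01 \<kappa> by (intro mult_left_mono; simp)+
    have w0: "weight_le p (\<lambda>s. norm (integral {0..s} G)) (10 * \<kappa> * B0)"
      unfolding \<kappa>_def B0_def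
    proof (rule stationary_weight[OF p \<rho> t u(1)])
      fix s :: real assume s: "0 < s" "s < 1"
      show "norm (integral {0..s} G) \<le> s" using lin[of 0 s] s by simp
      show "norm (integral {0..s} G) \<le> 4 / sqrt t" using osc[of 0 s] s by simp
      assume su: "s \<le> u / 2"
      have "norm (integral {0..s} G) \<le> 1 / (t * (u - s))"
        using gauss_osc_left[of 0 s u t "sq t" z 1, OF _ _ _ nsq low K] t s u su by (simp add: G_def)
      also have "\<dots> \<le> 1 / (t * (u / 2))" using t u su s by (intro divide_left_mono mult_left_mono) auto
      finally show "norm (integral {0..s} G) \<le> 2 / (t * u)" by simp
    qed (use u in auto)
    have w1: "weight_le p (\<lambda>s. norm (integral {1-s..1} G)) (10 * \<kappa> * B1)"
      unfolding \<kappa>_def B1_def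
    proof (rule stationary_weight[OF p \<rho> t])
      fix s :: real assume s: "0 < s" "s < 1"
      show "norm (integral {1-s..1} G) \<le> s" using lin[of "1-s" 1] s by simp
      show "norm (integral {1-s..1} G) \<le> 4 / sqrt t" using osc[of "1-s" 1] s by simp
      assume su: "s \<le> (1 - u) / 2"
      have "norm (integral {1-s..1} G) \<le> 1 / (t * (1 - s - u))"
        using gauss_osc_right[of "1-s" 1 u t "sq t" z 1, OF _ _ _ nsq low K] t s u su by (simp add: G_def)
      also have "\<dots> \<le> 1 / (t * ((1 - u) / 2))" using t u su s by (intro divide_left_mono mult_left_mono) auto
      finally show "norm (integral {1-s..1} G) \<le> 2 / (t * (1 - u))" by simp
    qed (use u in auto)
    \<comment> \<open>Unweighted interval integrals only give \<open>1 / sqrt t\<close>. This is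
      absorbed because \<open>p + \<rho> \<le> 1\<close> and \<open>u < 1\<close>.\<close>
    have tB: "1 / sqrt t \<le> B0"
    proof -
      have "1 / sqrt t = t powr (-1/2)" using t by (simp add: powr_minus_divide powr_half_sqrt)
      also have "\<dots> \<le> t powr (- p/2 + (-\<rho>/2))" using t \<rho> by (intro powr_mono) auto
      also have "\<dots> = t powr (- p/2) * sqrt t powr (-\<rho>)"
      proof -
        have "sqrt t powr (-\<rho>) = t powr (-\<rho>/2)"
          using t by (simp add: powr_half_sqrt[symmetric] powr_powr)
        then show ?thesis by (simp only: powr_add)
      qed
      also have "\<dots> \<le> B0" unfolding B0_def using t u \<rho> by (intro mult_left_mono powr_mono2') auto
      finally show ?thesis .
    qed
    have "norm (LBINT x:{0<..<1}. of_real (f x) * G x) \<le> C0 * B"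
    proof (rule main, unfold pairing_le_def, intro conjI allI impI G weight_le_mono[OF w0 B0B(1)] weight_le_mono[OF w1 B0B(2)])
      fix a b :: real assume "0 \<le> a" "a \<le> b" "b \<le> 1"
      then have "norm (integral {a..b} G) \<le> 4 / sqrt t" by (rule osc)
      also have "\<dots> \<le> 10 * \<kappa> * B0"
        using tB mult_mono[of 4 "10 * \<kappa>" "1 / sqrt t" B0] \<kappa> t by simp
      also have "\<dots> \<le> B" by (rule B0B)
      finally show "norm (integral {a..b} G) \<le> B" .
    qed
    then show "norm (psi_star f t (- u)) \<le> C0 * (10 * \<kappa>) * (t powr (- p/2) * ((sqrt t * u) powr (-\<rho>) + (sqrt t * (1 - u)) powr (-\<rho>)))"
      by (simp add: psi_star_def psi_def G_def z_def B_def B0_def B1_def algebra_simps)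
  qed
qed auto

end

section \<open>Integrals of powers of psi along the contour\<close>

lemma gaussian_half_line:
  "set_integrable lborel {0<..} (\<lambda>y::real. exp (- (y^2)))"
  "(LBINT y:{0<..}. exp (- (y^2))) = sqrt pi / 2"
proof -
  have 1: "set_integrable lborel {0..} (\<lambda>y::real. exp (- (y^2)))" "(LBINT y:{0..}. exp (- (y^2))) = sqrt pi / 2"
    using gaussian_moment_0 by (auto simp: has_bochner_integral_iff set_integrable_def set_lebesgue_integral_def)
  show "set_integrable lborel {0<..} (\<lambda>y::real. exp (- (y^2)))"
    by (rule set_integrable_subset[OF 1(1)]) auto
  have "(LBINT y:{0<..}. exp (- (y^2))) = (LBINT y:{0..}. exp (- (y^2::real)))"
    unfolding set_lebesgue_integral_def
    by (rule integral_discrete_difference[of "{0}"]) (auto simp: indicator_def)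
  with 1 show "(LBINT y:{0<..}. exp (- (y^2))) = sqrt pi / 2" by simp
qed

lemma add_power_le:
  fixes x y :: real
  assumes "0 \<le> x" "0 \<le> y"
  shows "(x + y) ^ n \<le> 2 ^ n * (x ^ n + y ^ n)"
proof -
  have "(x + y) ^ n \<le> (2 * max x y) ^ n" using assms by (intro power_mono) auto
  also have "\<dots> = 2 ^ n * max x y ^ n" by (simp add: power_mult_distrib)
  also have "\<dots> \<le> 2 ^ n * (x ^ n + y ^ n)" using assms by (intro mult_left_mono) (auto simp: max_def)
  finally show ?thesis .
qed

lemma gaussian_power_integrable:
  fixes g :: "real \<Rightarrow> complex"
  assumes [measurable]: "g \<in> borel_measurable borel" and n: "1 \<le> n" and "0 \<le> C"
    and le: "\<And>y. 0 < y \<Longrightarrow> norm (g y) \<le> C * exp (- (y^2))"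
  shows "set_integrable lborel {0<..} (\<lambda>y. g y ^ n)"
    "(LBINT y:{0<..}. norm (g y) ^ n) \<le> C ^ n * (sqrt pi / 2)"
proof -
  have *: "norm (g y) ^ n \<le> C ^ n * exp (- (y^2))" if "0 < y" for y
  proof -
    have "norm (g y) ^ n \<le> (C * exp (- (y^2))) ^ n" using le[OF that] by (intro power_mono) auto
    also have "\<dots> = C ^ n * exp (- (y^2)) ^ n" by (simp add: power_mult_distrib)
    also have "\<dots> \<le> C ^ n * exp (- (y^2)) ^ 1" using n assms(3)
      by (intro mult_left_mono power_decreasing) auto
    finally show ?thesis by simp
  qed
  have i: "set_integrable lborel {0<..} (\<lambda>y. C ^ n * exp (- (y^2)))" using gaussian_half_line(1) by simp
  show gi: "set_integrable lborel {0<..} (\<lambda>y. g y ^ n)"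
  proof (rule set_integrable_bound[OF i])
    show "set_borel_measurable lborel {0<..} (\<lambda>u. g u ^ n)"
      unfolding set_borel_measurable_def by measurable
    show "AE y in lborel. y \<in> {0<..} \<longrightarrow> norm (g y ^ n) \<le> norm (C ^ n * exp (- (y^2)))"
      using * assms(3) by (intro AE_I2) (auto simp: norm_power)
  qed
  have "(LBINT y:{0<..}. norm (g y) ^ n) \<le> (LBINT y:{0<..}. C ^ n * exp (- (y^2)))"
    by (rule set_integral_mono[OF _ i *]) (use set_integrable_norm[OF gi] in \<open>auto simp: norm_power\<close>)
  also have "\<dots> = C ^ n * (sqrt pi / 2)" by (simp add: gaussian_half_line(2))
  finally show "(LBINT y:{0<..}. norm (g y) ^ n) \<le> C ^ n * (sqrt pi / 2)" .
qed

context BVC_star_density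
begin

lemma psi_right_le: "0 \<le> t \<Longrightarrow> 0 \<le> y \<Longrightarrow> norm (psi f t (of_real y)) \<le> exp (- (y^2))"
  by (rule psi_trivial_bound) (use gauss_right_facts(2) in auto)

lemma psi_left_le: "0 \<le> t \<Longrightarrow> 0 \<le> y \<Longrightarrow> norm (psi f t (- of_real y - sq t)) \<le> exp (- (y^2))"
  by (rule psi_trivial_bound) (use gauss_left_facts(2) in auto)

lemma psi_star_le: "0 \<le> t \<Longrightarrow> norm (psi_star f t (- u)) \<le> 1"
  unfolding psi_star_def by (rule psi_trivial_bound) (use gauss_mid_facts(2)[of t u] in auto)

lemma psi_star_power_integrable:
  assumes "0 \<le> t"
  shows "set_integrable lborel {0<..<1} (\<lambda>u. psi_star f t (- u) ^ n)"
proof (rule set_integrable_bound[where f = "\<lambda>_. 1::real"])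
  show "set_borel_measurable lborel {0<..<1} (\<lambda>u. psi_star f t (- u) ^ n)"
    unfolding set_borel_measurable_def psi_star_def by measurable
  show "set_integrable lborel {0<..<1} (\<lambda>_::real. 1::real)"
    by (simp add: set_integrable_def)
  show "AE x in lborel. x \<in> {0<..<1} \<longrightarrow> norm (psi_star f t (- x) ^ n) \<le> norm (1::real)"
    using psi_star_le[OF assms] by (intro AE_I2) (simp add: norm_power power_le_one)
qed

text \<open>The absolute version of the three contour pieces, \<open>sqrt t\<close> being the speed
  \<open>\<bar>dz/du\<bar>\<close> on the segment. This one quantity bounds the characteristic
  function up to a constant and dominates the terms when sum and integral are exchanged.\<close>

definition total :: "nat \<Rightarrow> real \<Rightarrow> real" where
  "total n t = sqrt t * (LBINT u:{0<..<1}. norm (psi_star f t (- u)) ^ n)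
     + (LBINT y:{0<..}. norm (psi f t (of_real y)) ^ n)
     + (LBINT y:{0<..}. norm (psi f t (- of_real y - sq t)) ^ n)"

text \<open>After splitting the power of a sum, \<open>u powr (- n \<rho>)\<close> has to be
  integrated near both ends, which needs \<open>n \<rho> < 1\<close>. The powers of \<open>t\<close>
  add up to \<open>1/2 - n p/2 - n \<rho>/2\<close>.\<close>

lemma psi_star_power_bound:
  assumes \<rho>: "0 \<le> \<rho>" "\<rho> \<le> p" "\<rho> \<le> 1 - p" and b: "real n * \<rho> < 1"
  obtains C where "0 \<le> C"
    "\<And>t. 1 \<le> t \<Longrightarrow> sqrt t * (LBINT u:{0<..<1}. norm (psi_star f t (- u)) ^ n)
       \<le> C * t powr (- (real n * p/2 - (1 - real n * \<rho>)/2))"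
proof (rule psi_star_bound[OF \<rho>])
  fix C0 assume C0: "0 \<le> C0" and le: "\<And>t u. 1 \<le> t \<Longrightarrow> 0 < u \<Longrightarrow> u < 1 \<Longrightarrow>
      norm (psi_star f t (- u)) \<le> C0 * (t powr (- p/2) * ((sqrt t * u) powr (-\<rho>) + (sqrt t * (1 - u)) powr (-\<rho>)))"
  define b where "b = real n * \<rho>"
  have b: "b < 1" using assms(4) by (simp add: b_def)
  define C where "C = (2 * C0) ^ n * (2 / (1 - b))"
  show thesis
  proof (rule that[of C])
    show "0 \<le> C" unfolding C_def using C0 b by simp
    fix t :: real assume t: "1 \<le> t"
    define D where "D = (2 * C0) ^ n * t powr (- (real n * p/2)) * t powr (- b/2)"
    have D0: "0 \<le> D" unfolding D_def using C0 by simp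
    have pw: "((sqrt t * v) powr (-\<rho>)) ^ n = t powr (- b/2) * v powr (- b)" if "0 < v" for v
    proof -
      have "((sqrt t * v) powr (-\<rho>)) ^ n = (sqrt t * v) powr (- b)"
        using that t by (subst powr_power) (auto simp: b_def)
      also have "\<dots> = sqrt t powr (- b) * v powr (- b)" using that t by (simp add: powr_mult)
      also have "sqrt t powr (- b) = t powr (- b/2)" using t by (simp add: powr_half_sqrt[symmetric] powr_powr)
      finally show ?thesis .
    qed
    have pt: "norm (psi_star f t (- u)) ^ n \<le> D * (u powr (- b) + (1 - u) powr (- b))" if "u \<in> {0<..<1}" for u
    proof -
      define x y where "x = (sqrt t * u) powr (-\<rho>)" and "y = (sqrt t * (1 - u)) powr (-\<rho>)"
      have "norm (psi_star f t (- u)) ^ n \<le> (C0 * (t powr (- p/2) * (x + y))) ^ n"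
        unfolding x_def y_def using le[OF t] that by (intro power_mono) auto
      also have "\<dots> = C0 ^ n * ((t powr (- p/2)) ^ n * (x + y) ^ n)" by (simp add: power_mult_distrib)
      also have "(t powr (- p/2)) ^ n = t powr (- (real n * p/2))"
        using t by (subst powr_power) auto
      also have "C0 ^ n * (t powr (- (real n * p/2)) * (x + y) ^ n)
          \<le> C0 ^ n * (t powr (- (real n * p/2)) * (2 ^ n * (x ^ n + y ^ n)))"
        using C0 by (intro mult_left_mono add_power_le) (auto simp: x_def y_def)
      also have "x ^ n = t powr (- b/2) * u powr (- b)" unfolding x_def using that by (intro pw) auto
      also have "y ^ n = t powr (- b/2) * (1 - u) powr (- b)" unfolding y_def using that by (intro pw) auto
      finally show ?thesis unfolding D_def by (simp add: power_mult_distrib algebra_simps)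
    qed
    have i1: "set_integrable lborel {0<..<1} (\<lambda>u. u powr (- b))" "(LBINT u:{0<..<1}. u powr (- b)) = 1 / (1 - b)"
    proof -
      have 1: "set_integrable lborel {0..1} (\<lambda>u. u powr (- b))" "(LBINT u:{0..1}. u powr (- b)) = 1 / (1 - b)"
        using powr_integral_0[of "1 - b" 1] b by auto
      show "set_integrable lborel {0<..<1} (\<lambda>u. u powr (- b))"
        by (rule set_integrable_subset[OF 1(1)]) auto
      have "(LBINT u:{0<..<1}. u powr (- b)) = (LBINT u:{0..1}. u powr (- b))"
        unfolding set_lebesgue_integral_def
        by (rule integral_discrete_difference[of "{0,1}"]) (auto simp: indicator_def)
      then show "(LBINT u:{0<..<1}. u powr (- b)) = 1 / (1 - b)" using 1 by simp
    qed
    have e: "{x. 1 - x \<in> {0<..<1::real}} = {0<..<1}" by auto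
    have i2: "set_integrable lborel {0<..<1} (\<lambda>u. (1 - u) powr (- b))" "(LBINT u:{0<..<1}. (1 - u) powr (- b)) = 1 / (1 - b)"
      using lborel_set_integral_reflect_unit[of "{0<..<1}" "\<lambda>u. u powr (- b)"] i1 unfolding e by auto
    have i: "set_integrable lborel {0<..<1} (\<lambda>u. D * (u powr (- b) + (1 - u) powr (- b)))"
      using i1(1) i2(1) by (intro set_integrable_mult_right set_integral_add)
    have "(LBINT u:{0<..<1}. norm (psi_star f t (- u)) ^ n) \<le> (LBINT u:{0<..<1}. D * (u powr (- b) + (1 - u) powr (- b)))"
      using set_integrable_norm[OF psi_star_power_integrable[of t n]] t
      by (intro set_integral_mono[OF _ i pt]) (auto simp: norm_power)
    also have "\<dots> = D * (2 / (1 - b))"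
      using i1 i2 by (simp add: set_integral_add)
    finally have "sqrt t * (LBINT u:{0<..<1}. norm (psi_star f t (- u)) ^ n) \<le> sqrt t * (D * (2 / (1 - b)))"
      using t by (intro mult_left_mono) auto
    also have "\<dots> = C * (t powr (1/2) * t powr (- (real n * p/2)) * t powr (- b/2))"
      unfolding C_def D_def using t by (simp add: powr_half_sqrt)
    also have "t powr (1/2) * t powr (- (real n * p/2)) * t powr (- b/2) = t powr (1/2 + - (real n * p/2) + - b/2)"
      by (simp only: powr_add)
    also have "1/2 + - (real n * p/2) + - b/2 = - (real n * p/2 - (1 - real n * \<rho>)/2)"
      unfolding b_def by (simp add: field_simps)
    finally show "sqrt t * (LBINT u:{0<..<1}. norm (psi_star f t (- u)) ^ n)
       \<le> C * t powr (- (real n * p/2 - (1 - real n * \<rho>)/2))" .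
  qed
qed

text \<open>The ray integrals decay like \<open>t powr (- n p/2)\<close>, so the segment is the
  bottleneck and \<rho> is taken as large as its three constraints permit. The strict hypotheses on
  \<theta> are the three resulting caps on the exponent.\<close>

lemma total_decay:
  assumes n: "1 \<le> n" and \<theta>: "0 \<le> \<theta>" "\<theta> < real n * p/2" "\<theta> < (real n - 1)/2" "\<theta> < real n * p - 1/2"
  obtains C \<gamma> where "\<theta> < \<gamma>" "0 \<le> C" "\<And>t. 1 \<le> t \<Longrightarrow> total n t \<le> C * t powr (- \<gamma>)"
proof -
  \<comment> \<open>The slack \<eta> keeps \<open>n \<rho> \<le> 1 - \<eta>\<close> strictly below 1
    and is small enough that the loss \<open>\<eta>/2\<close> in the exponent \<open>n p/2\<close>
    stays above \<theta>; the minimum with 1 keeps \<rho> nonnegative.\<close>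
  define \<eta> where "\<eta> = min 1 ((real n * p - 2 * \<theta>)/2)"
  have \<eta>: "0 < \<eta>" "\<eta> \<le> 1" "\<eta> < real n * p - 2 * \<theta>" using \<theta> unfolding \<eta>_def by (auto simp: min_def field_simps)
  define \<rho> where "\<rho> = min (min p (1 - p)) ((1 - \<eta>) / real n)"
  have \<rho>: "0 \<le> \<rho>" "\<rho> \<le> p" "\<rho> \<le> 1 - p" "\<rho> \<le> (1 - \<eta>) / real n" using p \<eta> n unfolding \<rho>_def by auto
  have "real n * \<rho> \<le> 1 - \<eta>" using \<rho>(4) n by (simp add: field_simps)
  then have b: "real n * \<rho> < 1" using \<eta> by simp
  define \<gamma> where "\<gamma> = real n * p/2 - (1 - real n * \<rho>)/2"
  have "\<theta> < \<gamma>"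
  proof -
    \<comment> \<open>According to the active constraint, \<gamma> equals \<open>n p - 1/2\<close>,
      \<open>(n - 1)/2\<close> or \<open>n p/2 - \<eta>/2\<close>.\<close>
    consider "\<rho> = p" | "\<rho> = 1 - p" | "\<rho> = (1 - \<eta>) / real n" unfolding \<rho>_def by linarith
    then show ?thesis
    proof cases
      case 1 then show ?thesis unfolding \<gamma>_def using \<theta> by (simp add: field_simps)
    next
      case 2
      then have "real n * \<rho> = real n - real n * p" by (simp only: right_diff_distrib mult_1_right)
      then show ?thesis unfolding \<gamma>_def using \<theta> by (simp add: field_simps)
    next
      case 3
      then have "real n * \<rho> = 1 - \<eta>" using n by simp
      then show ?thesis unfolding \<gamma>_def using \<eta> by (simp add: field_simps)
    qed
  qed
  moreover obtain C1 where C1: "0 \<le> C1" "\<And>t. 1 \<le> t \<Longrightarrow> sqrt t * (LBINT u:{0<..<1}. norm (psi_star f t (- u)) ^ n)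
       \<le> C1 * t powr (- \<gamma>)"
    unfolding \<gamma>_def using psi_star_power_bound[OF \<rho>(1-3) b] by blast
  moreover obtain C2 where C2: "0 \<le> C2" and C2b:
    "\<And>t z c K. 1 \<le> t \<Longrightarrow>
      (\<And>x. 0 \<le> x \<Longrightarrow> x \<le> 1 \<Longrightarrow> sqrt t * \<bar>x - c\<bar> \<le> norm (z + sq t * of_real x)) \<Longrightarrow>
      (\<And>x. 0 \<le> x \<Longrightarrow> x \<le> 1 \<Longrightarrow> norm (gauss t z x) \<le> K) \<Longrightarrow>
      norm (psi f t z) \<le> C2 * K * t powr (- p/2)"
    by (rule psi_uniform_bound) blast
  define C3 where "C3 = C2 ^ n * (sqrt pi / 2)"
  have exps: "(C2 * t powr (- p/2)) ^ n * (sqrt pi / 2) \<le> C3 * t powr (- \<gamma>)" if t: "1 \<le> t" for t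
  proof -
    have "(t powr (- p/2)) ^ n = t powr (- (real n * p/2))"
      using t by (subst powr_power) auto
    also have "\<dots> \<le> t powr (- \<gamma>)" using t b unfolding \<gamma>_def by (intro powr_mono) auto
    finally have "C2 ^ n * (sqrt pi / 2) * (t powr (- p/2)) ^ n \<le> C2 ^ n * (sqrt pi / 2) * t powr (- \<gamma>)"
      using C2 by (intro mult_left_mono) auto
    then show ?thesis unfolding C3_def by (simp add: power_mult_distrib mult_ac)
  qed
  have J1: "(LBINT y:{0<..}. norm (psi f t (of_real y)) ^ n) \<le> C3 * t powr (- \<gamma>)" if t: "1 \<le> t" for t
  proof (rule order_trans[OF gaussian_power_integrable(2) exps[OF t]])
    fix y :: real assume y: "0 < y"
    have "norm (psi f t (of_real y)) \<le> C2 * exp (- (y^2)) * t powr (- p/2)"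
      by (rule C2b[where c = 0]) (use t y gauss_right_facts[of t y] in auto)
    then show "norm (psi f t (of_real y)) \<le> C2 * t powr (- p/2) * exp (- (y^2))" by (simp add: mult_ac)
  qed (use n C2 in auto)
  have J2: "(LBINT y:{0<..}. norm (psi f t (- of_real y - sq t)) ^ n) \<le> C3 * t powr (- \<gamma>)" if t: "1 \<le> t" for t
  proof (rule order_trans[OF gaussian_power_integrable(2) exps[OF t]])
    fix y :: real assume y: "0 < y"
    have "norm (psi f t (- of_real y - sq t)) \<le> C2 * exp (- (y^2)) * t powr (- p/2)"
      by (rule C2b[where c = 1]) (use t y gauss_left_facts[of t y] in \<open>auto simp: abs_if\<close>)
    then show "norm (psi f t (- of_real y - sq t)) \<le> C2 * t powr (- p/2) * exp (- (y^2))" by (simp add: mult_ac)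
  qed (use n C2 in auto)
  show thesis
  proof (rule that[of \<gamma> "C1 + C3 + C3"])
    show "0 \<le> C1 + C3 + C3" using C1 C2 unfolding C3_def by simp
    show "total n t \<le> (C1 + C3 + C3) * t powr (- \<gamma>)" if "1 \<le> t" for t
      unfolding total_def using C1(2)[OF that] J1[OF that] J2[OF that] by (simp add: algebra_simps)
  qed fact
qed

end

section \<open>The characteristic function of Q\<close>

text \<open>The integrand is even, so antisymmetrizing any primitive yields an odd one. Oddness lets
  the value left over from the left ray cancel against the end value at the corner
  \<open>- sq t\<close>.\<close>

lemma gauss_power_primitive:
  obtains P :: "complex \<Rightarrow> complex" where
    "\<And>z. (P has_field_derivative exp (- (z^2)) ^ n) (at z)" "\<And>z. P (- z) = - P z"
proof -
  have "(\<lambda>z::complex. exp (- (z^2)) ^ n) holomorphic_on UNIV" by (intro holomorphic_intros)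
  then obtain F :: "complex \<Rightarrow> complex" where F: "\<And>z. (F has_field_derivative exp (- (z^2)) ^ n) (at z)"
    by (rule holomorphic_convex_primitive'[OF convex_UNIV open_UNIV]) auto
  define P where "P = (\<lambda>z. (F z - F (- z)) / 2)"
  show thesis
  proof (rule that[of P])
    fix z
    have "((\<lambda>z. F (- z)) has_field_derivative (exp (- ((- z)^2)) ^ n * (- 1))) (at z)"
      by (rule DERIV_chain2[OF F]) (auto intro!: derivative_eq_intros)
    from DERIV_cdivide[OF DERIV_diff[OF F this], of 2]
    show "(P has_field_derivative exp (- (z^2)) ^ n) (at z)" unfolding P_def by simp
    show "P (- z) = - P z" unfolding P_def by (simp add: field_simps)
  qed
qed

lemma gaussian_power_half_line:
  assumes n: "1 \<le> n"
  shows "(LBINT y:{0<..}. exp (- (complex_of_real y ^ 2)) ^ n) = of_real (sqrt (pi / real n) / 2)"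
proof -
  have sn: "sqrt (real n) > 0" using n by simp
  have "sqrt pi / 2 = (LBINT y. indicator {0<..} y *\<^sub>R exp (- (y^2)) :: real)"
    using gaussian_half_line(2) by (simp add: set_lebesgue_integral_def)
  also have "\<dots> = sqrt (real n) * (LBINT y. indicator {0<..} (sqrt (real n) * y) *\<^sub>R exp (- ((sqrt (real n) * y)^2)))"
    using lborel_integral_real_affine[of "sqrt (real n)" "\<lambda>y. indicator {0<..} y *\<^sub>R exp (- (y^2)) :: real" 0] sn by simp
  also have "(LBINT y. indicator {0<..} (sqrt (real n) * y) *\<^sub>R exp (- ((sqrt (real n) * y)^2)))
      = (LBINT y:{0<..}. exp (- (y^2)) ^ n)"
    unfolding set_lebesgue_integral_def
    by (rule Bochner_Integration.integral_cong)
      (use sn in \<open>auto simp: indicator_def power_mult_distrib exp_of_nat_mult[symmetric] zero_less_mult_iff\<close>)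
  finally have "(LBINT y:{0<..}. exp (- (y^2)) ^ n) = sqrt (pi / real n) / 2"
    using sn by (simp add: real_sqrt_divide field_simps)
  moreover have "(LBINT y:{0<..}. exp (- (complex_of_real y ^ 2)) ^ n) = of_real (LBINT y:{0<..}. exp (- (y^2)) ^ n)"
    unfolding set_integral_complex_of_real[symmetric]
    by (simp flip: exp_of_real)
  ultimately show ?thesis by (simp only:)
qed

text \<open>Cauchy's theorem without contours: the difference of the shifted and the unshifted
  integrand has the primitive \<open>D y = P (y + c) - P y\<close>, which vanishes at infinity, so
  only \<open>- D 0\<close> remains.\<close>

lemma gauss_shifted_half_line:
  assumes n: "1 \<le> n" and t: "0 \<le> t" and m: "0 \<le> m"
    and P: "\<And>z. (P has_field_derivative exp (- (z^2)) ^ n) (at z)"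
  shows "(LBINT y:{0<..}. gauss t (of_real y) m ^ n)
     = of_real (sqrt (pi / real n) / 2) - (P (sq t * of_real m) - P 0)"
proof -
  define h where "h = (\<lambda>(c::complex) (y::real). exp (- ((of_real y + c)^2)) ^ n)"
  define c where "c = sq t * of_real m"
  have bd: "norm (gauss t (of_real y) \<tau>) \<le> 1 * exp (- (y^2))" if "0 \<le> y" "0 \<le> \<tau>" for y \<tau>
    using gauss_right_facts(2)[OF t that] by simp
  have i1: "set_integrable lborel {0<..} (\<lambda>y. h c y)"
    unfolding h_def c_def by (rule gaussian_power_integrable(1)[OF _ n, of _ 1]) (use bd m in auto)
  have i0: "set_integrable lborel {0<..} (\<lambda>y. h 0 y)"
    unfolding h_def by (rule gaussian_power_integrable(1)[OF _ n, of _ 1]) (use bd[of _ 0] in auto)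
  have i: "set_integrable lborel {0<..} (\<lambda>y. h c y - h 0 y)" by (rule set_integral_diff(1)[OF i1 i0])
  have ein: "einterval 0 \<infinity> = {0<..}" by (auto simp: einterval_def)
  define D where "D = (\<lambda>y::real. P (of_real y + c) - P (of_real y))"
  have dP: "((\<lambda>y::real. P (of_real y + d)) has_vector_derivative h d y) (at y)" for d y
  proof -
    have "((\<lambda>w. P (w + d)) has_field_derivative exp (- ((of_real y + d)^2)) ^ n * 1) (at (of_real y))"
      by (rule DERIV_chain2[OF P]) (auto intro!: derivative_eq_intros)
    then show ?thesis unfolding h_def by (intro has_vector_derivative_real_field) simp
  qed
  have "(LBINT y=0..\<infinity>. h c y - h 0 y) = 0 - D 0"
  proof (rule interval_integral_FTC_integrable[where F = D])
    show "(D has_vector_derivative h c y - h 0 y) (at y)" for y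
      unfolding D_def using has_vector_derivative_diff[OF dP[of c y] dP[of 0 y]] by simp
    show "isCont (\<lambda>y. h c y - h 0 y) y" for y unfolding h_def by (intro continuous_intros)
    show "set_integrable lborel (einterval 0 \<infinity>) (\<lambda>y. h c y - h 0 y)" unfolding ein by (rule i)
    have "(D \<longlongrightarrow> D 0) (at_right 0)"
    proof -
      have "isCont D 0" unfolding D_def
        using has_vector_derivative_continuous[OF has_vector_derivative_diff[OF dP[of c 0] dP[of 0 0]]] by simp
      then show ?thesis by (simp add: isCont_def filterlim_at_split)
    qed
    then show "((D \<circ> real_of_ereal) \<longlongrightarrow> D 0) (at_right 0)"
      using ereal_tendsto_simps1(2)[of D "D 0" 0] by (simp add: zero_ereal_def)
    have "(D \<longlongrightarrow> 0) at_top"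
    proof (rule Lim_null_comparison)
      show "\<forall>\<^sub>F y in at_top. norm (D y) \<le> exp (- y) * norm c"
        using eventually_ge_at_top[of 1]
      proof eventually_elim
        fix y :: real assume y: "1 \<le> y"
        have "norm (P (of_real y + c) - P (of_real y)) \<le> exp (- y) * norm (of_real y + c - of_real y)"
        \<comment> \<open>Every point of the segment from \<open>y\<close> to \<open>y + c\<close>
          is \<open>y + sq t * (\<tau> m)\<close> with a nonnegative \<open>\<tau> m\<close>, so the
          right-ray bound applies along the whole segment, and
          \<open>exp (- (y^2)) \<le> exp (- y)\<close> for \<open>y \<ge> 1\<close>.\<close>
        proof (rule field_differentiable_bound[of "closed_segment (of_real y) (of_real y + c)"])
          fix z assume "z \<in> closed_segment (of_real y) (of_real y + c)"
          then obtain \<tau> where \<tau>: "0 \<le> \<tau>" "\<tau> \<le> 1" "z = (1 - \<tau>) *\<^sub>R of_real y + \<tau> *\<^sub>R (of_real y + c)"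
            by (auto simp: in_segment)
          then have z: "z = of_real y + sq t * of_real (\<tau> * m)"
            unfolding c_def by (simp add: scaleR_conv_of_real algebra_simps)
          show "(P has_field_derivative exp (- (z^2)) ^ n) (at z within closed_segment (of_real y) (of_real y + c))"
            by (rule has_field_derivative_at_within[OF P])
          have "norm (exp (- (z^2))) \<le> exp (- (y^2))" unfolding z using bd[of y "\<tau> * m"] y m \<tau> by simp
          also have "\<dots> \<le> exp (- y)" using y by (simp add: self_le_power)
          finally have le: "norm (exp (- (z^2))) \<le> exp (- y)" .
          have "norm (exp (- (z^2)) ^ n) \<le> exp (- y) ^ n" unfolding norm_power using le by (intro power_mono) auto
          also have "\<dots> \<le> exp (- y) ^ 1" using n y by (intro power_decreasing) auto
          finally show "norm (exp (- (z^2)) ^ n) \<le> exp (- y)" by simp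
        qed auto
        then show "norm (D y) \<le> exp (- y) * norm c" unfolding D_def by simp
      qed
      have "((\<lambda>y::real. exp (- y)) \<longlongrightarrow> 0) at_top"
        by (rule filterlim_compose[OF exp_at_bot filterlim_uminus_at_bot_at_top])
      then show "((\<lambda>y::real. exp (- y) * norm c) \<longlongrightarrow> 0) at_top" by (rule tendsto_mult_left_zero)
    qed
    then show "((D \<circ> real_of_ereal) \<longlongrightarrow> 0) (at_left \<infinity>)" by (simp add: ereal_tendsto_simps1)
  qed auto
  also have "(LBINT y=0..\<infinity>. h c y - h 0 y) = (LBINT y:{0<..}. h c y - h 0 y)"
    by (simp add: interval_lebesgue_integral_def ein)
  also have "\<dots> = (LBINT y:{0<..}. h c y) - (LBINT y:{0<..}. h 0 y)"
    by (rule set_integral_diff(2)[OF i1 i0])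
  finally have "(LBINT y:{0<..}. h c y) = (LBINT y:{0<..}. h 0 y) - D 0" by (simp add: algebra_simps)
  then show ?thesis
    unfolding h_def D_def c_def using gaussian_power_half_line[OF n] by simp
qed

text \<open>The integral of an entire Gaussian along the broken line from \<open>-\<infinity> - s\<close> to \<open>-s\<close> to \<open>0\<close> to \<open>\<infinity>\<close>
  equals that along the real line.\<close>

lemma gauss_broken_line:
  assumes n: "1 \<le> n" and t: "0 \<le> t" and m: "0 \<le> m" "m \<le> 1"
  shows "sq t * (LBINT u:{0<..<1}. gauss t (of_real (- u) * sq t) m ^ n)
    + (LBINT y:{0<..}. gauss t (of_real y) m ^ n)
    + (LBINT y:{0<..}. gauss t (- of_real y - sq t) m ^ n) = of_real (sqrt (pi / real n))"
proof -
  obtain P :: "complex \<Rightarrow> complex" where P: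
    "\<And>z. (P has_field_derivative exp (- (z^2)) ^ n) (at z)" "\<And>z. P (- z) = - P z"
    by (rule gauss_power_primitive) blast
  have P0: "P 0 = 0" using P(2)[of 0] by simp
  have 1: "(LBINT y:{0<..}. gauss t (of_real y) m ^ n)
     = of_real (sqrt (pi / real n) / 2) - P (sq t * of_real m)"
    using gauss_shifted_half_line[OF n t m(1) P(1)] P0 by simp
  have e: "- of_real y - sq t + sq t * of_real m = - (of_real y + sq t * of_real (1 - m))" for y :: real
    by (simp add: algebra_simps)
  have 2: "(LBINT y:{0<..}. gauss t (- of_real y - sq t) m ^ n)
     = of_real (sqrt (pi / real n) / 2) - P (sq t * of_real (1 - m))"
  proof -
    have m': "0 \<le> 1 - m" using m by simp
    show ?thesis unfolding e power2_minus gauss_shifted_half_line[OF n t m' P(1)] P0 diff_zero ..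
  qed
  define h where "h = (\<lambda>u::real. gauss t (of_real (- u) * sq t) m ^ n)"
  have hc: "continuous_on {0..1} h" unfolding h_def by (intro continuous_intros)
  have hi: "set_integrable lborel {0..1} h" by (rule borel_integrable_atLeastAtMost'[OF hc])
  have "((\<lambda>u. sq t * h u) has_integral (- P (of_real (- 1) * sq t + sq t * of_real m) - - P (of_real (- 0) * sq t + sq t * of_real m))) {0..1}"
  proof (rule fundamental_theorem_of_calculus)
    fix u :: real
    have "((\<lambda>w. P (- w * sq t + sq t * of_real m)) has_field_derivative
        (gauss t (- of_real u * sq t) m) ^ n * (- sq t)) (at (of_real u))"
      by (rule DERIV_chain2[OF P(1)]) (auto intro!: derivative_eq_intros)
    from has_vector_derivative_real_field[OF DERIV_minus[OF this]]
    show "((\<lambda>u. - P (of_real (- u) * sq t + sq t * of_real m)) has_vector_derivative sq t * h u) (at u within {0..1})"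
      unfolding h_def by (auto intro: has_vector_derivative_at_within simp: mult.commute)
  qed simp
  from integral_unique[OF this]
  have "integral {0..1} (\<lambda>u. sq t * h u) = P (sq t * of_real m) - P (- sq t + sq t * of_real m)"
    by simp
  also have "- sq t + sq t * of_real m = - (sq t * of_real (1 - m))" by (simp add: algebra_simps)
  also have "integral {0..1} (\<lambda>u. sq t * h u) = sq t * integral {0..1} h" by simp
  also have "integral {0..1} h = (LBINT u:{0..1}. h u)" using set_borel_integral_eq_integral(2)[OF hi] by simp
  also have "\<dots> = (LBINT u:{0<..<1}. h u)"
    unfolding set_lebesgue_integral_def
    by (rule integral_discrete_difference[of "{0,1}"]) (auto simp: indicator_def)
  \<comment> \<open>By oddness of \<open>P\<close>, the segment contributes exactly the two values
    that the rays lack; the sum no longer depends on \<open>m\<close>.\<close>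
  finally have 3: "sq t * (LBINT u:{0<..<1}. h u) = P (sq t * of_real m) + P (sq t * of_real (1 - m))"
    by (simp add: P(2))
  show ?thesis unfolding 1 2 3[unfolded h_def] by (simp flip: of_real_add)
qed

text \<open>Steiner's decomposition: deviations from the mean sum to zero, which removes the cross
  term. The field is general because the identity serves complex \<open>z\<close> and
  \<open>s\<close>, and also real data with \<open>z = 0\<close> and \<open>s = 1\<close>.\<close>

lemma sum_shifted_squares:
  fixes x :: "nat \<Rightarrow> 'a::field_char_0" and z s :: 'a
  assumes "1 \<le> n"
  defines "m \<equiv> (\<Sum>i<n. x i) / of_nat n"
  shows "(\<Sum>i<n. (z + s * x i)^2) = of_nat n * (z + s * m)^2 + s^2 * (\<Sum>i<n. (x i - m)^2)"
proof -
  have n0: "of_nat n \<noteq> (0::'a)" using assms(1) by simp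
  have S: "(\<Sum>i<n. x i) = of_nat n * m" unfolding m_def using n0 by simp
  have "(z + s * x i)^2 = (z + s * m)^2 + 2 * (z + s * m) * s * (x i - m) + s^2 * (x i - m)^2" for i
    by (simp add: power2_eq_square algebra_simps)
  then have "(\<Sum>i<n. (z + s * x i)^2)
      = (\<Sum>i<n. (z + s * m)^2) + 2 * (z + s * m) * s * (\<Sum>i<n. x i - m) + s^2 * (\<Sum>i<n. (x i - m)^2)"
    by (simp only: sum.distrib sum_distrib_left[symmetric])
  also have "(\<Sum>i<n. x i - m) = 0" using S by (simp add: sum_subtractf)
  finally show ?thesis by simp
qed

section \<open>Independence, and exchange of expectation with the contour integral\<close>

locale iid_sample = prob_space M + BVC_star_density f ps qs p
  for M :: "'a measure" and f ps qs p +
  fixes X :: "nat \<Rightarrow> 'a \<Rightarrow> real" and n :: nat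
  assumes indep: "indep_vars (\<lambda>_. borel) X {..<n}"
    and dist: "\<And>i. i < n \<Longrightarrow> distributed M lborel (X i) (\<lambda>x. ennreal (indicator {0<..<1} x * f x))"
    and n2: "2 \<le> n"
begin

definition mean :: "'a \<Rightarrow> real" where "mean \<omega> = (\<Sum>j<n. X j \<omega>) / real n"
definition Q :: "'a \<Rightarrow> real" where "Q \<omega> = (\<Sum>i<n. (X i \<omega> - mean \<omega>)^2)"
definition \<Phi> :: "real \<Rightarrow> complex" where "\<Phi> t = (\<integral>\<omega>. exp (\<i> * of_real (t * Q \<omega>)) \<partial>M)"

lemma n1: "1 \<le> n" using n2 by simp

lemma X_measurable: "i < n \<Longrightarrow> X i \<in> borel_measurable M"
  using distributed_measurable[OF dist] by simp

lemma mean_measurable [measurable]: "mean \<in> borel_measurable M"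
  unfolding mean_def[abs_def] using X_measurable by (auto intro!: borel_measurable_sum borel_measurable_divide)

lemma Q_measurable [measurable]: "Q \<in> borel_measurable M"
  unfolding Q_def[abs_def] using X_measurable
  by (auto intro!: borel_measurable_sum borel_measurable_power borel_measurable_diff)

lemma density_nonneg: "0 \<le> indicator {0<..<1} x * f x"
  using nonneg by (auto simp: indicator_def)

lemma expectation_X:
  fixes g :: "real \<Rightarrow> complex"
  assumes i: "i < n" and [measurable]: "g \<in> borel_measurable borel"
  shows "(\<integral>\<omega>. g (X i \<omega>) \<partial>M) = (LBINT x. of_real (indicator {0<..<1} x * f x) * g x)"
proof -
  note meas[measurable] X_measurable[OF i, measurable]
  have "(\<integral>\<omega>. g (X i \<omega>) \<partial>M) = integral\<^sup>L (distr M lborel (X i)) g"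
    by (subst integral_distr) auto
  also have "distr M lborel (X i) = density lborel (\<lambda>x. ennreal (indicator {0<..<1} x * f x))"
    using distributed_distr_eq_density[OF dist[OF i]] .
  also have "integral\<^sup>L \<dots> g = (LBINT x. (indicator {0<..<1} x * f x) *\<^sub>R g x)"
    by (rule integral_density) (use density_nonneg in auto)
  finally show ?thesis by (simp only: scaleR_conv_of_real)
qed

lemma AE_X: "AE \<omega> in M. \<forall>i<n. 0 < X i \<omega> \<and> X i \<omega> < 1"
proof -
  have "AE \<omega> in M. 0 < X i \<omega> \<and> X i \<omega> < 1" if i: "i < n" for i
  proof -
    note meas[measurable] X_measurable[OF i, measurable]
    have "AE x in density lborel (\<lambda>x. ennreal (indicator {0<..<1} x * f x)). 0 < x \<and> x < 1"
    proof (subst AE_density)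
      show "(\<lambda>x. ennreal (indicator {0<..<1} x * f x)) \<in> borel_measurable lborel" by measurable
    qed (auto simp: indicator_def)
    then have "AE x in distr M lborel (X i). 0 < x \<and> x < 1"
      by (simp only: distributed_distr_eq_density[OF dist[OF i]])
    then show ?thesis by (subst (asm) AE_distr_iff) auto
  qed
  then have "AE \<omega> in M. \<forall>i\<in>{..<n}. 0 < X i \<omega> \<and> X i \<omega> < 1"
    by (intro AE_finite_allI) auto
  then show ?thesis by (rule AE_mp) auto
qed

lemma AE_mean: "AE \<omega> in M. 0 \<le> mean \<omega> \<and> mean \<omega> \<le> 1"
  using AE_X
proof eventually_elim
  case (elim \<omega>)
  have "0 \<le> (\<Sum>j<n. X j \<omega>)" using elim by (intro sum_nonneg) (auto simp: less_imp_le)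
  moreover have "(\<Sum>j<n. X j \<omega>) \<le> (\<Sum>j<n. 1)" using elim by (intro sum_mono) (auto simp: less_imp_le)
  ultimately show ?case unfolding mean_def using n1 by (auto simp: field_simps)
qed

lemma prod_gauss:
  assumes t: "0 \<le> t"
  shows "(\<Prod>i<n. gauss t z (X i \<omega>))
    = exp (\<i> * of_real (t * Q \<omega>)) * gauss t z (mean \<omega>) ^ n"
proof -
  have "(\<Prod>i<n. gauss t z (X i \<omega>)) = exp (- (\<Sum>i<n. (z + sq t * of_real (X i \<omega>))^2))"
    by (simp add: exp_sum sum_negf[symmetric] del: csqrt.simps)
  also have "(\<Sum>i<n. (z + sq t * of_real (X i \<omega>))^2)
      = of_nat n * (z + sq t * of_real (mean \<omega>))^2 + sq t^2 * of_real (Q \<omega>)"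
    using sum_shifted_squares[OF n1, of z "sq t" "\<lambda>i. of_real (X i \<omega>)"]
    by (simp add: mean_def Q_def)
  also have "sq t^2 * of_real (Q \<omega>) = - (\<i> * of_real (t * Q \<omega>))" unfolding sq_facts(1)[OF t] by simp
  finally have "(\<Prod>i<n. gauss t z (X i \<omega>))
     = exp (\<i> * of_real (t * Q \<omega>) + of_nat n * (- ((z + sq t * of_real (mean \<omega>))^2)))"
    by (simp add: algebra_simps)
  then show ?thesis by (simp only: exp_add exp_of_nat_mult)
qed

lemma psi_power:
  assumes t: "0 \<le> t"
  shows "psi f t z ^ n = (\<integral>\<omega>. exp (\<i> * of_real (t * Q \<omega>)) * gauss t z (mean \<omega>) ^ n \<partial>M)"
proof -
  define g where "g = (\<lambda>x::real. gauss t z x)"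
  have gm [measurable]: "g \<in> borel_measurable borel" unfolding g_def by measurable
  have gi: "integrable M (\<lambda>\<omega>. g (X i \<omega>))" if i: "i < n" for i
  proof (rule integrable_const_bound)
    note X_measurable[OF i, measurable]
    show "(\<lambda>\<omega>. g (X i \<omega>)) \<in> borel_measurable M" by measurable
    show "AE \<omega> in M. norm (g (X i \<omega>)) \<le> exp ((norm z + norm (sq t))^2)"
      using AE_X
    proof eventually_elim
      case (elim \<omega>)
      have "norm (g (X i \<omega>)) \<le> exp (norm (- ((z + sq t * of_real (X i \<omega>))^2)))"
        unfolding g_def by (rule norm_exp)
      also have "norm (- ((z + sq t * of_real (X i \<omega>))^2)) = norm (z + sq t * of_real (X i \<omega>))^2"
        by (simp only: norm_minus_cancel norm_power)
      also have "exp (norm (z + sq t * of_real (X i \<omega>))^2) \<le> exp ((norm z + norm (sq t))^2)"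
      proof -
        have "norm (z + sq t * of_real (X i \<omega>)) \<le> norm z + norm (sq t) * 1"
          using elim i by (intro norm_triangle_le add_left_mono) (auto simp: norm_mult intro!: mult_left_le)
        then have "norm (z + sq t * of_real (X i \<omega>))^2 \<le> (norm z + norm (sq t))^2"
          by (intro power_mono) auto
        then show ?thesis by simp
      qed
      finally show ?case .
    qed
  qed
  have ind: "indep_vars (\<lambda>_. borel) (\<lambda>i \<omega>. g (X i \<omega>)) {..<n}"
    by (rule indep_vars_compose2[OF indep]) auto
  have "(\<integral>\<omega>. (\<Prod>i<n. g (X i \<omega>)) \<partial>M) = (\<Prod>i<n. \<integral>\<omega>. g (X i \<omega>) \<partial>M)"
    using gi by (intro indep_vars_lebesgue_integral ind) auto
  also have "\<dots> = (\<Prod>i<n. psi f t z)"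
    by (intro prod.cong refl) (use expectation_X[OF _ gm] in \<open>auto simp: psi_alt g_def\<close>)
  also have "\<dots> = psi f t z ^ n" by simp
  finally show ?thesis unfolding g_def prod_gauss[OF t] ..
qed

text \<open>Once the expectation is outside, the contour integral is taken for each fixed outcome,
  where the sample mean is merely a number in the unit interval.\<close>

lemma psi_power_Fubini:
  fixes A :: "real set" and z :: "real \<Rightarrow> complex" and b :: "real \<Rightarrow> real"
  assumes t: "0 \<le> t" and A [measurable]: "A \<in> sets borel" and z [measurable]: "z \<in> borel_measurable borel"
    and b: "set_integrable lborel A b"
    and bound: "\<And>y m. y \<in> A \<Longrightarrow> 0 \<le> m \<Longrightarrow> m \<le> 1 \<Longrightarrow> norm (gauss t (z y) m ^ n) \<le> b y"
  shows "(LBINT y:A. psi f t (z y) ^ n)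
     = (\<integral>\<omega>. exp (\<i> * of_real (t * Q \<omega>)) * (LBINT y:A. gauss t (z y) (mean \<omega>) ^ n) \<partial>M)"
    "integrable M (\<lambda>\<omega>. exp (\<i> * of_real (t * Q \<omega>)) * (LBINT y:A. gauss t (z y) (mean \<omega>) ^ n))"
proof -
  \<comment> \<open>The mean lies in the unit interval only almost surely. Clamping makes the
    majorant \<open>b\<close> valid at every outcome, and the clamp is removed by almost sure
    equality at the end.\<close>
  define mc where "mc = (\<lambda>\<omega>. max 0 (min 1 (mean \<omega>)))"
  have mcm [measurable]: "mc \<in> borel_measurable M" unfolding mc_def by measurable
  have mc01: "0 \<le> mc \<omega>" "mc \<omega> \<le> 1" for \<omega> unfolding mc_def by auto
  have mcmean: "AE \<omega> in M. mc \<omega> = mean \<omega>" using AE_mean unfolding mc_def by (rule AE_mp) auto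
  interpret PS: pair_sigma_finite M "lborel :: real measure" ..
  define H where "H = (\<lambda>\<omega> y. indicator A y *\<^sub>R (exp (\<i> * of_real (t * Q \<omega>)) * gauss t (z y) (mc \<omega>) ^ n))"
  have Hm: "case_prod H \<in> borel_measurable (M \<Otimes>\<^sub>M lborel)" unfolding H_def by measurable
  have bA: "integrable lborel (\<lambda>y. indicator A y *\<^sub>R b y)" using b by (simp add: set_integrable_def)
  have Hi: "integrable (M \<Otimes>\<^sub>M lborel) (case_prod H)"
  proof (rule PS.integrable_pair_bound[OF Hm _ bA, of "\<lambda>_. 1"])
    fix \<omega> y
    show "norm (case (\<omega>, y) of (x, xa) \<Rightarrow> H x xa) \<le> 1 * (indicator A y *\<^sub>R b y)"
      using bound[of y "mc \<omega>"] mc01[of \<omega>] by (auto simp: H_def norm_mult indicator_def)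
  qed simp
  have "psi f t (z y) ^ n = (\<integral>\<omega>. exp (\<i> * of_real (t * Q \<omega>)) * gauss t (z y) (mc \<omega>) ^ n \<partial>M)" for y
    unfolding psi_power[OF t] by (rule integral_cong_AE) (use mcmean in \<open>auto elim!: AE_mp\<close>)
  then have 1: "indicator A y *\<^sub>R psi f t (z y) ^ n = (\<integral>\<omega>. H \<omega> y \<partial>M)" for y
    by (simp add: H_def)
  have 2: "(LBINT y. H \<omega> y) = exp (\<i> * of_real (t * Q \<omega>)) * (LBINT y:A. gauss t (z y) (mc \<omega>) ^ n)" for \<omega>
  proof -
    have "(LBINT y. H \<omega> y) = (LBINT y:A. exp (\<i> * of_real (t * Q \<omega>)) * gauss t (z y) (mc \<omega>) ^ n)"
      by (simp only: H_def set_lebesgue_integral_def)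
    then show ?thesis by (simp only: set_integral_mult_right)
  qed
  have Hf: "integrable M (\<lambda>\<omega>. LBINT y. H \<omega> y)" using PS.integrable_fst[OF Hi] .
  have cong: "AE \<omega> in M. (LBINT y. H \<omega> y) = exp (\<i> * of_real (t * Q \<omega>)) * (LBINT y:A. gauss t (z y) (mean \<omega>) ^ n)"
    using mcmean unfolding 2 by eventually_elim simp
  have mm: "(\<lambda>\<omega>. exp (\<i> * of_real (t * Q \<omega>)) * (LBINT y:A. gauss t (z y) (mean \<omega>) ^ n)) \<in> borel_measurable M"
    unfolding set_lebesgue_integral_def by measurable
  show "integrable M (\<lambda>\<omega>. exp (\<i> * of_real (t * Q \<omega>)) * (LBINT y:A. gauss t (z y) (mean \<omega>) ^ n))"
    using Hf integrable_cong_AE[OF borel_measurable_integrable[OF Hf] mm cong] by blast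
  have "(LBINT y:A. psi f t (z y) ^ n) = (LBINT y. (\<integral>\<omega>. H \<omega> y \<partial>M))"
    unfolding set_lebesgue_integral_def 1 ..
  also have "\<dots> = (\<integral>\<omega>. (LBINT y. H \<omega> y) \<partial>M)" by (rule PS.Fubini_integral[OF Hi])
  also have "\<dots> = (\<integral>\<omega>. exp (\<i> * of_real (t * Q \<omega>)) * (LBINT y:A. gauss t (z y) (mean \<omega>) ^ n) \<partial>M)"
    by (rule integral_cong_AE[OF borel_measurable_integrable[OF Hf] mm cong])
  finally show "(LBINT y:A. psi f t (z y) ^ n)
     = (\<integral>\<omega>. exp (\<i> * of_real (t * Q \<omega>)) * (LBINT y:A. gauss t (z y) (mean \<omega>) ^ n) \<partial>M)" .
qed

text \<open>For almost every outcome the three inner integrals add up to the constant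
  \<open>sqrt (pi / n)\<close>, so only the factor \<open>exp (i t Q)\<close> survives under the
  expectation.\<close>

lemma char_repr:
  assumes t: "0 \<le> t"
  shows "of_real (sqrt (pi / real n)) * \<Phi> t = sq t * (LBINT u:{0<..<1}. psi_star f t (- u) ^ n)
    + (LBINT y:{0<..}. psi f t (of_real y) ^ n) + (LBINT y:{0<..}. psi f t (- of_real y - sq t) ^ n)"
proof -
  have gi: "set_integrable lborel {0<..} (\<lambda>y. exp (- (y^2)) ^ n :: real)"
  proof -
    have "set_integrable lborel {0<..} (\<lambda>y. (of_real (exp (- (y^2))) :: complex) ^ n)"
      by (rule gaussian_power_integrable(1)[OF _ n1, of _ 1]) auto
    from set_integrable_norm[OF this] show ?thesis by (simp add: norm_power)
  qed
  define E where "E = (\<lambda>\<omega>. exp (\<i> * of_real (t * Q \<omega>)))"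
  define J1 where "J1 = (\<lambda>m. (LBINT u:{0<..<1}. gauss t (of_real (- u) * sq t) m ^ n))"
  define J2 where "J2 = (\<lambda>m. (LBINT y:{0<..}. gauss t (of_real y) m ^ n))"
  define J3 where "J3 = (\<lambda>m. (LBINT y:{0<..}. gauss t (- of_real y - sq t) m ^ n))"
  have F1: "(LBINT u:{0<..<1}. psi_star f t (- u) ^ n) = (\<integral>\<omega>. E \<omega> * J1 (mean \<omega>) \<partial>M)"
    "integrable M (\<lambda>\<omega>. E \<omega> * J1 (mean \<omega>))"
    unfolding E_def J1_def psi_star_def
    by (rule psi_power_Fubini[OF t, where b = "\<lambda>_. 1"];
        use gauss_mid_facts(2)[OF t] in \<open>simp add: norm_power set_integrable_def del: of_real_minus csqrt.simps\<close>)+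
  have F2: "(LBINT y:{0<..}. psi f t (of_real y) ^ n) = (\<integral>\<omega>. E \<omega> * J2 (mean \<omega>) \<partial>M)"
    "integrable M (\<lambda>\<omega>. E \<omega> * J2 (mean \<omega>))"
    unfolding E_def J2_def
    by (rule psi_power_Fubini[OF t _ _ gi]; use gauss_right_facts(2)[OF t] in \<open>auto simp: norm_power intro!: power_mono\<close>)+
  have F3: "(LBINT y:{0<..}. psi f t (- of_real y - sq t) ^ n) = (\<integral>\<omega>. E \<omega> * J3 (mean \<omega>) \<partial>M)"
    "integrable M (\<lambda>\<omega>. E \<omega> * J3 (mean \<omega>))"
    unfolding E_def J3_def
    by (rule psi_power_Fubini[OF t _ _ gi]; use gauss_left_facts(2)[OF t] in \<open>auto simp: norm_power intro!: power_mono\<close>)+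
  have "sq t * (LBINT u:{0<..<1}. psi_star f t (- u) ^ n)
    + (LBINT y:{0<..}. psi f t (of_real y) ^ n) + (LBINT y:{0<..}. psi f t (- of_real y - sq t) ^ n)
    = (\<integral>\<omega>. sq t * (E \<omega> * J1 (mean \<omega>)) + E \<omega> * J2 (mean \<omega>) + E \<omega> * J3 (mean \<omega>) \<partial>M)"
    unfolding F1(1) F2(1) F3(1)
    by (subst Bochner_Integration.integral_add; (intro Bochner_Integration.integrable_add integrable_mult_right F1 F2 F3)?)+
      (simp only: integral_mult_right_zero)
  also have "\<dots> = (\<integral>\<omega>. of_real (sqrt (pi / real n)) * E \<omega> \<partial>M)"
  proof (rule integral_cong_AE)
    show "(\<lambda>\<omega>. sq t * (E \<omega> * J1 (mean \<omega>)) + E \<omega> * J2 (mean \<omega>) + E \<omega> * J3 (mean \<omega>)) \<in> borel_measurable M"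
      by (intro borel_measurable_integrable Bochner_Integration.integrable_add integrable_mult_right F1 F2 F3)
    show "(\<lambda>\<omega>. of_real (sqrt (pi / real n)) * E \<omega>) \<in> borel_measurable M"
      unfolding E_def by measurable
    show "AE \<omega> in M. sq t * (E \<omega> * J1 (mean \<omega>)) + E \<omega> * J2 (mean \<omega>) + E \<omega> * J3 (mean \<omega>) = of_real (sqrt (pi / real n)) * E \<omega>"
      using AE_mean
    proof eventually_elim
      case (elim \<omega>)
      then have "sq t * J1 (mean \<omega>) + J2 (mean \<omega>) + J3 (mean \<omega>) = of_real (sqrt (pi / real n))"
        unfolding J1_def J2_def J3_def using gauss_broken_line[OF n1 t] by blast
      moreover have "sq t * (E \<omega> * J1 (mean \<omega>)) + E \<omega> * J2 (mean \<omega>) + E \<omega> * J3 (mean \<omega>)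
        = (sq t * J1 (mean \<omega>) + J2 (mean \<omega>) + J3 (mean \<omega>)) * E \<omega>" by (simp only: ring_distribs mult_ac)
      ultimately show ?case by (simp only:)
    qed
  qed
  also have "\<dots> = of_real (sqrt (pi / real n)) * \<Phi> t" unfolding \<Phi>_def E_def by (rule integral_mult_right_zero)
  finally show ?thesis by (rule sym)
qed

lemma Phi_total_bound:
  assumes t: "0 \<le> t"
  shows "norm (\<Phi> t) \<le> sqrt (real n / pi) * total n t"
proof -
  have nb: "norm (LBINT y:A. g y ^ n) \<le> (LBINT y:A. norm (g y) ^ n)" for A and g :: "real \<Rightarrow> complex"
  proof -
    have "norm (LBINT y:A. g y ^ n) \<le> (LBINT y. norm (indicator A y *\<^sub>R g y ^ n))"
      unfolding set_lebesgue_integral_def by (rule integral_norm_bound)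
    also have "\<dots> = (LBINT y:A. norm (g y) ^ n)"
      unfolding set_lebesgue_integral_def by (simp add: norm_power)
    finally show ?thesis .
  qed
  have "sqrt (pi / real n) * norm (\<Phi> t) = norm (of_real (sqrt (pi / real n)) * \<Phi> t)"
    unfolding norm_mult norm_of_real by simp
  also have "\<dots> \<le> total n t"
    unfolding char_repr[OF t] total_def
    by (intro norm_triangle_le add_mono nb)
      (auto simp only: norm_mult sq_facts(2)[OF t] intro!: mult_left_mono nb real_sqrt_ge_zero t)
  finally have "sqrt (real n / pi) * (sqrt (pi / real n) * norm (\<Phi> t)) \<le> sqrt (real n / pi) * total n t"
    by (intro mult_left_mono) auto
  moreover have "sqrt (real n / pi) * sqrt (pi / real n) = 1"
    using n1 by (simp add: real_sqrt_mult[symmetric])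
  ultimately show ?thesis by (simp add: mult.assoc[symmetric])
qed

end

section \<open>Sine series of a distribution on an interval\<close>

lemma continuous_on_suminf_dominated:
  fixes g :: "nat \<Rightarrow> 'a::topological_space \<Rightarrow> real"
  assumes c: "\<And>k. continuous_on A (g k)" and le: "\<And>k x. x \<in> A \<Longrightarrow> \<bar>g k x\<bar> \<le> b k" and b: "summable b"
  shows "continuous_on A (\<lambda>x. \<Sum>k. g k x)"
proof (rule uniform_limit_theorem[where F = sequentially and f = "\<lambda>N x. \<Sum>k<N. g k x"])
  show "\<forall>\<^sub>F N in sequentially. continuous_on A (\<lambda>x. \<Sum>k<N. g k x)"
    by (intro always_eventually allI continuous_on_sum c)
  show "uniform_limit A (\<lambda>N x. \<Sum>k<N. g k x) (\<lambda>x. \<Sum>k. g k x) sequentially"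
    by (rule Weierstrass_m_test[OF _ b]) (use le in auto)
qed simp

text \<open>The Abel mean of the sawtooth series \<open>\<Sum> sin (k \<theta>) / k\<close>, in
  closed form. At \<open>r = 1\<close> it is \<open>(pi - \<theta>) / 2\<close> between 0 and
  \<open>2 pi\<close>.\<close>

definition saw :: "real \<Rightarrow> real \<Rightarrow> real" where
  "saw r \<theta> = - Im (Ln (1 - of_real r * cis \<theta>))"

lemma saw_sums:
  assumes "0 \<le> r" "r < 1"
  shows "(\<lambda>k. r ^ Suc k * sin (real (Suc k) * \<theta>) / real (Suc k)) sums saw r \<theta>"
proof -
  define z where "z = of_real r * cis \<theta>"
  have "norm (- z) < 1" using assms by (simp add: z_def norm_mult)
  from Ln_series'[OF this] have "(\<lambda>k. - (z ^ k) / of_nat k) sums Ln (1 - z)" by simp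
  from sums_minus[OF sums_Im[OF this]]
  have "(\<lambda>k. - Im (- (z ^ k) / of_nat k)) sums saw r \<theta>" by (simp add: saw_def z_def)
  moreover have "- Im (- (z ^ k) / of_nat k) = r ^ k * sin (real k * \<theta>) / real k" for k
  proof -
    have "z ^ k = of_real (r ^ k) * cis (real k * \<theta>)"
      unfolding z_def by (simp add: power_mult_distrib Complex.DeMoivre)
    moreover have "- Im (- w / of_nat k) = Im w / real k" for w
      by (metis Im_divide_of_nat minus_divide_left minus_minus uminus_complex.simps(2))
    ultimately show ?thesis by (simp del: of_real_power)
  qed
  ultimately have "(\<lambda>k. r ^ k * sin (real k * \<theta>) / real k) sums saw r \<theta>" by (simp only:)
  then show ?thesis by (subst sums_Suc_iff) simp
qed

text \<open>\<open>1 - r cis \<theta>\<close> lies in the right half-plane, so its argument is at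
  most \<open>pi / 2\<close> in modulus. Uniformity in \<open>r\<close> is what dominated
  convergence requires.\<close>

lemma saw_bound: assumes "0 \<le> r" "r < 1" shows "\<bar>saw r \<theta>\<bar> \<le> pi / 2"
proof -
  have "r * cos \<theta> \<le> r * 1" using assms by (intro mult_left_mono) auto
  then have pos: "0 < Re (1 - of_real r * cis \<theta>)" using assms by simp
  then have "1 - of_real r * cis \<theta> \<noteq> 0" by (metis less_irrefl zero_complex.simps(1))
  then have "\<bar>Im (Ln (1 - of_real r * cis \<theta>))\<bar> \<le> pi / 2"
    using Re_Ln_pos_le pos less_imp_le by blast
  then show ?thesis unfolding saw_def by simp
qed

text \<open>In polar form \<open>1 - cis \<theta>\<close> is
  \<open>2 sin (\<theta>/2) cis ((\<theta> - pi)/2)\<close>; for \<theta> in this range the modulus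
  is positive and the angle is the principal one.\<close>

lemma saw_one: assumes "0 < \<theta>" "\<theta> < 2 * pi" shows "saw 1 \<theta> = (pi - \<theta>) / 2"
proof -
  have s: "0 < sin (\<theta> / 2)" using assms by (intro sin_gt_zero) auto
  define w where "w = of_real (ln (2 * sin (\<theta> / 2))) + \<i> * of_real ((\<theta> - pi) / 2)"
  have "exp w = of_real (2 * sin (\<theta> / 2)) * cis ((\<theta> - pi) / 2)"
    unfolding w_def exp_add cis_conv_exp using s by (simp add: exp_of_real del: of_real_mult)
  also have "\<dots> = 1 - cis \<theta>"
  proof -
    have 1: "cos ((\<theta> - pi) / 2) = sin (\<theta> / 2)" "sin ((\<theta> - pi) / 2) = - cos (\<theta> / 2)"
      by (simp_all add: diff_divide_distrib cos_diff sin_diff)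
    have 2: "cos \<theta> = 1 - 2 * sin (\<theta> / 2) ^ 2" "sin \<theta> = 2 * sin (\<theta> / 2) * cos (\<theta> / 2)"
      using cos_double_sin[of "\<theta> / 2"] sin_double[of "\<theta> / 2"] by simp_all
    show ?thesis by (rule complex_eqI) (simp_all add: 1 2 power2_eq_square)
  qed
  finally have "Ln (1 - cis \<theta>) = w"
    using Ln_exp[of w] assms by (simp add: w_def)
  then have "saw 1 \<theta> = - Im w" unfolding saw_def by simp
  also have "Im w = (\<theta> - pi) / 2" unfolding w_def by (simp only: plus_complex.simps Im_complex_of_real Im_i_times Re_complex_of_real)
  finally show ?thesis by (simp add: field_simps)
qed

lemma saw_minus: "0 \<le> r \<Longrightarrow> r < 1 \<Longrightarrow> saw r (- \<theta>) = - saw r \<theta>"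
proof -
  assume r: "0 \<le> r" "r < 1"
  from sums_minus[OF saw_sums[OF r, of \<theta>]] saw_sums[OF r, of "- \<theta>"]
  show ?thesis by (simp add: sums_unique2)
qed

lemma saw_zero: "0 \<le> r \<Longrightarrow> r < 1 \<Longrightarrow> saw r 0 = 0"
  using saw_minus[of r 0] by simp

lemma saw_tendsto:
  assumes "0 < \<theta>" "\<theta> < 2 * pi" and r: "r \<longlonglongrightarrow> 1"
  shows "(\<lambda>j. saw (r j) \<theta>) \<longlonglongrightarrow> (pi - \<theta>) / 2"
proof -
  have "cos \<theta> < 1"
  proof -
    have "cos \<theta> \<noteq> 1"
    proof
      assume "cos \<theta> = 1"
      then have "sin (\<theta> / 2) ^ 2 = 0" using cos_double_sin[of "\<theta> / 2"] by simp
      moreover have "0 < sin (\<theta> / 2)" using assms by (intro sin_gt_zero) auto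
      ultimately show False by simp
    qed
    then show ?thesis using cos_le_one[of \<theta>] by linarith
  qed
  then have "1 - of_real 1 * cis \<theta> \<notin> \<real>\<^sub>\<le>\<^sub>0" by (auto simp: complex_nonpos_Reals_iff)
  then have "(\<lambda>j. - Im (Ln (1 - of_real (r j) * cis \<theta>))) \<longlonglongrightarrow> - Im (Ln (1 - of_real 1 * cis \<theta>))"
    by (intro tendsto_intros r)
  then show ?thesis using saw_one[OF assms(1,2)] unfolding saw_def by (simp only:)
qed

lemma saw_tendsto_neg:
  assumes "- 2 * pi < \<theta>" "\<theta> < 0" and r: "r \<longlonglongrightarrow> 1" "\<And>j. 0 \<le> r j" "\<And>j. r j < 1"
  shows "(\<lambda>j. saw (r j) \<theta>) \<longlonglongrightarrow> (- pi - \<theta>) / 2"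
proof -
  have "(\<lambda>j. - saw (r j) (- \<theta>)) \<longlonglongrightarrow> - ((pi - (- \<theta>)) / 2)"
    by (intro tendsto_minus saw_tendsto r) (use assms in auto)
  moreover have "- saw (r j) (- \<theta>) = saw (r j) \<theta>" for j using saw_minus[OF r(2,3)] by simp
  moreover have "- ((pi - (- \<theta>)) / 2) = (- pi - \<theta>) / 2" by (simp add: field_simps)
  ultimately show ?thesis by (simp only:)
qed

text \<open>The Abel means of the sine expansion of the indicator of \<open>{0<..<\<xi>}\<close>.\<close>

definition step_mean :: "real \<Rightarrow> real \<Rightarrow> real \<Rightarrow> real" where
  "step_mean r \<xi> y = (2 / pi) * (saw r y - saw r (y + \<xi>) / 2 - saw r (y - \<xi>) / 2)"

lemma step_mean_sums:
  assumes "0 \<le> r" "r < 1"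
  shows "(\<lambda>k. (2 / pi) * (r ^ Suc k * (sin (real (Suc k) * y) * (1 - cos (real (Suc k) * \<xi>)) / real (Suc k)))) sums step_mean r \<xi> y"
proof -
  have "(\<lambda>k. (2 / pi) * (r ^ Suc k * sin (real (Suc k) * y) / real (Suc k)
      - r ^ Suc k * sin (real (Suc k) * (y + \<xi>)) / real (Suc k) / 2
      - r ^ Suc k * sin (real (Suc k) * (y - \<xi>)) / real (Suc k) / 2)) sums step_mean r \<xi> y"
    unfolding step_mean_def by (intro sums_mult sums_diff sums_divide saw_sums assms)
  moreover have "r ^ Suc k * sin (real (Suc k) * y) / real (Suc k)
      - r ^ Suc k * sin (real (Suc k) * (y + \<xi>)) / real (Suc k) / 2
      - r ^ Suc k * sin (real (Suc k) * (y - \<xi>)) / real (Suc k) / 2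
      = r ^ Suc k * (sin (real (Suc k) * y) * (1 - cos (real (Suc k) * \<xi>)) / real (Suc k))" for k
  proof -
    define K where "K = real (Suc k)"
    have e: "sin (K * (y + \<xi>)) = sin (K * y) * cos (K * \<xi>) + cos (K * y) * sin (K * \<xi>)"
      "sin (K * (y - \<xi>)) = sin (K * y) * cos (K * \<xi>) - cos (K * y) * sin (K * \<xi>)"
      by (simp_all only: distrib_left right_diff_distrib sin_add sin_diff)
    have K: "K \<noteq> 0" unfolding K_def by simp
    show ?thesis unfolding K_def[symmetric] e using K by (simp add: field_simps)
  qed
  ultimately show ?thesis by (simp only:)
qed

lemma step_mean_bound: assumes "0 \<le> r" "r < 1" shows "\<bar>step_mean r \<xi> y\<bar> \<le> 2"
proof -
  have "\<bar>saw r y - saw r (y + \<xi>) / 2 - saw r (y - \<xi>) / 2\<bar> \<le> pi"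
    using saw_bound[OF assms, of y] saw_bound[OF assms, of "y + \<xi>"] saw_bound[OF assms, of "y - \<xi>"]
    by linarith
  then have "(2 / pi) * \<bar>saw r y - saw r (y + \<xi>) / 2 - saw r (y - \<xi>) / 2\<bar> \<le> (2 / pi) * pi"
    by (intro mult_left_mono) auto
  then show ?thesis unfolding step_mean_def abs_mult by (simp only: abs_divide abs_numeral abs_of_pos pi_gt_zero) simp
qed

text \<open>The ranges of \<open>y\<close> and \<xi> keep \<open>y + \<xi>\<close> below
  \<open>2 pi\<close>, so only the sawtooth at \<open>y - \<xi>\<close> meets a jump. There the Abel
  means vanish identically, which yields the value one half.\<close>

lemma step_mean_tendsto:
  assumes y: "0 < y" "y < pi" and \<xi>: "0 \<le> \<xi>" "\<xi> \<le> pi"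
    and r: "r \<longlonglongrightarrow> 1" "\<And>j. 0 \<le> r j" "\<And>j. r j < 1"
  shows "(\<lambda>j. step_mean (r j) \<xi> y) \<longlonglongrightarrow> (if y < \<xi> then 1 else if y = \<xi> then 1/2 else 0)"
proof -
  define c where "c = (if y < \<xi> then (- pi - (y - \<xi>)) / 2 else if y = \<xi> then 0 else (pi - (y - \<xi>)) / 2)"
  have "(\<lambda>j. saw (r j) (y - \<xi>)) \<longlonglongrightarrow> c"
  proof (cases y \<xi> rule: linorder_cases)
    case less
    then show ?thesis unfolding c_def using saw_tendsto_neg[of "y - \<xi>" r, OF _ _ r] y \<xi> by simp
  next
    case equal
    then show ?thesis unfolding c_def using saw_zero[OF r(2,3)] by simp
  next
    case greater
    then show ?thesis unfolding c_def using saw_tendsto[of "y - \<xi>" r, OF _ _ r(1)] y \<xi> by simp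
  qed
  moreover have "(\<lambda>j. saw (r j) y) \<longlonglongrightarrow> (pi - y) / 2" using y by (intro saw_tendsto r) auto
  moreover have "(\<lambda>j. saw (r j) (y + \<xi>)) \<longlonglongrightarrow> (pi - (y + \<xi>)) / 2" using y \<xi> by (intro saw_tendsto r) auto
  ultimately have "(\<lambda>j. step_mean (r j) \<xi> y) \<longlonglongrightarrow> (2 / pi) * ((pi - y) / 2 - (pi - (y + \<xi>)) / 2 / 2 - c / 2)"
    unfolding step_mean_def by (intro tendsto_intros) auto
  also have "(2 / pi) * ((pi - y) / 2 - (pi - (y + \<xi>)) / 2 / 2 - c / 2) = (if y < \<xi> then 1 else if y = \<xi> then 1/2 else 0)"
    unfolding c_def by (simp add: field_simps)
  finally show ?thesis .
qed

text \<open>For \<open>s < 1\<close> geometric decay permits taking the expectation term by term. As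
  \<open>s\<close> tends to 1, the series converges by its absolute summability and the expectation
  by bounded convergence. The limit counts an atom at \<xi> with weight one half, so only two
  inequalities come out at this stage.\<close>

lemma (in prob_space) sine_series_sandwich:
  fixes Y :: "'a \<Rightarrow> real"
  assumes [measurable]: "Y \<in> borel_measurable M" and Y: "AE \<omega> in M. 0 < Y \<omega> \<and> Y \<omega> < pi"
    and \<xi>: "0 \<le> \<xi>" "\<xi> \<le> pi"
    and a: "\<And>k. a k = (\<integral>\<omega>. sin (real (Suc k) * Y \<omega>) \<partial>M)"
    and sm: "summable (\<lambda>k. \<bar>a k\<bar> / real (Suc k))"
  shows "prob {\<omega>\<in>space M. Y \<omega> < \<xi>} \<le> (2 / pi) * (\<Sum>k. a k * ((1 - cos (real (Suc k) * \<xi>)) / real (Suc k)))"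
    "(2 / pi) * (\<Sum>k. a k * ((1 - cos (real (Suc k) * \<xi>)) / real (Suc k))) \<le> prob {\<omega>\<in>space M. Y \<omega> \<le> \<xi>}"
proof -
  define c where "c = (\<lambda>k. a k * ((1 - cos (real (Suc k) * \<xi>)) / real (Suc k)))"
  define r where "r = (\<lambda>j. 1 - 1 / real (Suc (Suc j)))"
  have r: "r \<longlonglongrightarrow> 1" "\<And>j. 0 \<le> r j" "\<And>j. r j < 1"
  proof -
    have "(\<lambda>j. 1 - 1 / real (Suc (Suc j))) \<longlonglongrightarrow> 1 - 0"
      by (rule tendsto_diff[OF tendsto_const LIMSEQ_Suc[OF LIMSEQ_Suc[OF lim_1_over_n]]])
    then show "r \<longlonglongrightarrow> 1" unfolding r_def by simp
    show "0 \<le> r j" "r j < 1" for j unfolding r_def by auto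
  qed
  have w2: "\<bar>1 - cos \<theta>\<bar> \<le> 2" for \<theta> :: real using cos_le_one[of \<theta>] cos_ge_minus_one[of \<theta>] by linarith
  have cle: "\<bar>c k\<bar> \<le> 2 * (\<bar>a k\<bar> / real (Suc k))" for k
    unfolding c_def abs_mult abs_divide using w2[of "real (Suc k) * \<xi>"] by (simp add: divide_right_mono mult_left_mono mult.commute[of 2])
  have csm: "summable (\<lambda>k. 2 * (\<bar>a k\<bar> / real (Suc k)))" using sm by (rule summable_mult)
  have mean: "(2 / pi) * (\<Sum>k. s ^ Suc k * c k) = (\<integral>\<omega>. step_mean s \<xi> (Y \<omega>) \<partial>M)" if s: "0 \<le> s" "s < 1" for s
  proof -
    define g where "g = (\<lambda>k \<omega>. (2 / pi) * (s ^ Suc k * (sin (real (Suc k) * Y \<omega>) * (1 - cos (real (Suc k) * \<xi>)) / real (Suc k))))"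
    have gb: "norm (g k \<omega>) \<le> (4 / pi) * s ^ Suc k" for k \<omega>
    proof -
      have "\<bar>sin (real (Suc k) * Y \<omega>)\<bar> * \<bar>1 - cos (real (Suc k) * \<xi>)\<bar> / real (Suc k) \<le> (1 * 2) / 1"
        by (intro frac_le mult_mono w2) auto
      then have "(2 / pi) * (s ^ Suc k * (\<bar>sin (real (Suc k) * Y \<omega>)\<bar> * \<bar>1 - cos (real (Suc k) * \<xi>)\<bar> / real (Suc k)))
          \<le> (2 / pi) * (s ^ Suc k * 2)"
        using s by (intro mult_left_mono) auto
      then show ?thesis unfolding g_def using s by (simp add: abs_mult)
    qed
    have gi: "integrable M (g k)" for k
      by (rule integrable_const_bound[OF AE_I2[OF gb]]) (simp add: g_def)
    have gs: "summable (\<lambda>k. (4 / pi) * s ^ Suc k)"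
      using s by (intro summable_mult) (simp add: summable_geometric)
    have "(\<integral>\<omega>. (\<Sum>k. g k \<omega>) \<partial>M) = (\<Sum>k. \<integral>\<omega>. g k \<omega> \<partial>M)"
    proof (rule integral_suminf[OF gi])
      show "AE \<omega> in M. summable (\<lambda>k. norm (g k \<omega>))"
        by (intro AE_I2 summable_comparison_test'[OF gs]) (use gb in auto)
      show "summable (\<lambda>k. \<integral>\<omega>. norm (g k \<omega>) \<partial>M)"
      proof (rule summable_comparison_test'[OF gs])
        fix k
        have "(\<integral>\<omega>. norm (g k \<omega>) \<partial>M) \<le> (\<integral>\<omega>. (4 / pi) * s ^ Suc k \<partial>M)"
          by (rule integral_mono) (use gi gb in auto)
        then show "norm (\<integral>\<omega>. norm (g k \<omega>) \<partial>M) \<le> (4 / pi) * s ^ Suc k"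
          by (simp add: prob_space)
      qed
    qed
    moreover have "(\<Sum>k. g k \<omega>) = step_mean s \<xi> (Y \<omega>)" for \<omega>
      using sums_unique[OF step_mean_sums[OF s]] unfolding g_def by simp
    moreover have "(\<integral>\<omega>. g k \<omega> \<partial>M) = (2 / pi) * (s ^ Suc k * c k)" for k
      unfolding g_def c_def a by (simp add: mult.commute)
    moreover have "summable (\<lambda>k. s ^ Suc k * c k)"
    proof (rule summable_comparison_test'[OF csm])
      fix k
      have "s ^ Suc k * \<bar>c k\<bar> \<le> 1 * \<bar>c k\<bar>" using s by (intro mult_right_mono power_le_one) auto
      then show "norm (s ^ Suc k * c k) \<le> 2 * (\<bar>a k\<bar> / real (Suc k))" using cle[of k] s by (simp add: abs_mult)
    qed
    ultimately show ?thesis by (simp only: suminf_mult)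
  qed
  have "continuous_on {0..1} (\<lambda>s. \<Sum>k. s ^ Suc k * c k)"
  proof (rule continuous_on_suminf_dominated[OF _ _ csm])
    fix k and s :: real assume "s \<in> {0..1}"
    then have "s ^ Suc k * \<bar>c k\<bar> \<le> 1 * \<bar>c k\<bar>" by (intro mult_right_mono power_le_one) auto
    then show "\<bar>s ^ Suc k * c k\<bar> \<le> 2 * (\<bar>a k\<bar> / real (Suc k))"
      using cle[of k] \<open>s \<in> {0..1}\<close> by (simp add: abs_mult)
  qed (intro continuous_intros)
  from continuous_on_tendsto_compose[OF this r(1)] r
  have lim1: "(\<lambda>j. \<Sum>k. r j ^ Suc k * c k) \<longlonglongrightarrow> (\<Sum>k. c k)"
    by (simp add: less_imp_le eventually_sequentially)
  define L where "L = (\<lambda>y. if y < \<xi> then 1 else if y = \<xi> then 1/2 else (0::real))"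
  have Lm [measurable]: "L \<in> borel_measurable borel" unfolding L_def by measurable
  have sm [measurable]: "(\<lambda>y. step_mean s \<xi> y) \<in> borel_measurable borel" if "0 \<le> s" "s < 1" for s
  proof -
    have "(\<lambda>y. \<Sum>k. (2 / pi) * (s ^ Suc k * (sin (real (Suc k) * y) * (1 - cos (real (Suc k) * \<xi>)) / real (Suc k)))) \<in> borel_measurable borel"
      by measurable
    then show ?thesis using sums_unique[OF step_mean_sums[OF that]] by simp
  qed
  have lim2: "(\<lambda>j. \<integral>\<omega>. step_mean (r j) \<xi> (Y \<omega>) \<partial>M) \<longlonglongrightarrow> (\<integral>\<omega>. L (Y \<omega>) \<partial>M)"
  proof (rule integral_dominated_convergence[where w = "\<lambda>_. 2"])
    show "AE \<omega> in M. (\<lambda>j. step_mean (r j) \<xi> (Y \<omega>)) \<longlonglongrightarrow> L (Y \<omega>)"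
      using Y unfolding L_def by eventually_elim (intro step_mean_tendsto \<xi> r, auto)
    show "AE \<omega> in M. norm (step_mean (r j) \<xi> (Y \<omega>)) \<le> 2" for j
      using step_mean_bound[of "r j"] r(2,3)[of j] by (intro AE_I2) auto
    show "(\<lambda>\<omega>. step_mean (r j) \<xi> (Y \<omega>)) \<in> borel_measurable M" for j
      using sm[OF r(2,3)] by measurable
  qed auto
  have ii: "integrable M (indicator A :: 'a \<Rightarrow> real)" if "A \<in> sets M" for A
    using that by (intro integrable_real_indicator) (auto simp: emeasure_eq_measure)
  have "(2 / pi) * (\<Sum>k. c k) = (\<integral>\<omega>. L (Y \<omega>) \<partial>M)"
  proof (rule LIMSEQ_unique)
    show "(\<lambda>j. (2 / pi) * (\<Sum>k. r j ^ Suc k * c k)) \<longlonglongrightarrow> (2 / pi) * (\<Sum>k. c k)"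
      by (intro tendsto_mult lim1 tendsto_const)
    show "(\<lambda>j. (2 / pi) * (\<Sum>k. r j ^ Suc k * c k)) \<longlonglongrightarrow> (\<integral>\<omega>. L (Y \<omega>) \<partial>M)"
      using lim2 mean[OF r(2,3)] by simp
  qed
  moreover have Li: "integrable M (\<lambda>\<omega>. L (Y \<omega>))"
    by (rule integrable_const_bound[where B = 1]) (auto simp: L_def)
  moreover have "prob {\<omega>\<in>space M. Y \<omega> < \<xi>} = (\<integral>\<omega>. indicator {\<omega>\<in>space M. Y \<omega> < \<xi>} \<omega> \<partial>M)"
    "prob {\<omega>\<in>space M. Y \<omega> \<le> \<xi>} = (\<integral>\<omega>. indicator {\<omega>\<in>space M. Y \<omega> \<le> \<xi>} \<omega> \<partial>M)"
    by (simp_all add: inf.absorb1 subset_eq)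
  moreover have "(\<integral>\<omega>. indicator {\<omega>\<in>space M. Y \<omega> < \<xi>} \<omega> \<partial>M) \<le> (\<integral>\<omega>. L (Y \<omega>) \<partial>M)"
    by (rule integral_mono[OF ii Li]) (auto simp: L_def indicator_def)
  moreover have "(\<integral>\<omega>. L (Y \<omega>) \<partial>M) \<le> (\<integral>\<omega>. indicator {\<omega>\<in>space M. Y \<omega> \<le> \<xi>} \<omega> \<partial>M)"
    by (rule integral_mono[OF Li ii]) (auto simp: L_def indicator_def)
  ultimately show "prob {\<omega>\<in>space M. Y \<omega> < \<xi>} \<le> (2 / pi) * (\<Sum>k. a k * ((1 - cos (real (Suc k) * \<xi>)) / real (Suc k)))"
    "(2 / pi) * (\<Sum>k. a k * ((1 - cos (real (Suc k) * \<xi>)) / real (Suc k))) \<le> prob {\<omega>\<in>space M. Y \<omega> \<le> \<xi>}"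
    unfolding c_def by simp_all
qed

text \<open>The series is continuous in \<xi>, which excludes atoms: the probability of
  \<open>Y \<le> \<xi>\<close> is at most that of \<open>Y < x\<close>, hence at most the series at
  \<open>x\<close>, for every \<open>x\<close> slightly to the right, and \<open>x\<close> may tend
  to \<xi>.\<close>

lemma (in prob_space) sine_series_cdf:
  fixes Y :: "'a \<Rightarrow> real"
  assumes Ym [measurable]: "Y \<in> borel_measurable M" and Y: "AE \<omega> in M. 0 < Y \<omega> \<and> Y \<omega> < pi"
    and \<xi>: "0 \<le> \<xi>" "\<xi> \<le> pi"
    and a: "\<And>k. a k = (\<integral>\<omega>. sin (real (Suc k) * Y \<omega>) \<partial>M)"
    and sm: "summable (\<lambda>k. \<bar>a k\<bar> / real (Suc k))"
  shows "prob {\<omega>\<in>space M. Y \<omega> \<le> \<xi>} = (2 / pi) * (\<Sum>k. a k * ((1 - cos (real (Suc k) * \<xi>)) / real (Suc k)))"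
proof -
  define G where "G \<xi> = (2 / pi) * (\<Sum>k. a k * ((1 - cos (real (Suc k) * \<xi>)) / real (Suc k)))" for \<xi>
  note sw = sine_series_sandwich[OF Ym Y _ _ a sm, folded G_def]
  have "continuous_on UNIV (\<lambda>\<xi>. \<Sum>k. a k * ((1 - cos (real (Suc k) * \<xi>)) / real (Suc k)))"
  proof (rule continuous_on_suminf_dominated)
    show "summable (\<lambda>k. 2 * (\<bar>a k\<bar> / real (Suc k)))" using sm by (rule summable_mult)
    fix k and x :: real
    have "\<bar>1 - cos (real (Suc k) * x)\<bar> \<le> 2"
      using cos_le_one[of "real (Suc k) * x"] cos_ge_minus_one[of "real (Suc k) * x"] by linarith
    then show "\<bar>a k * ((1 - cos (real (Suc k) * x)) / real (Suc k))\<bar> \<le> 2 * (\<bar>a k\<bar> / real (Suc k))"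
      unfolding abs_mult abs_divide by (simp add: divide_right_mono mult_left_mono mult.commute[of 2])
  qed (intro continuous_intros, simp)
  then have Gc: "isCont G \<xi>" unfolding G_def[abs_def]
    by (intro continuous_intros) (simp add: continuous_on_eq_continuous_at)
  show ?thesis
  proof (cases "\<xi> < pi")
    case True
    have "prob {\<omega>\<in>space M. Y \<omega> \<le> \<xi>} \<le> G \<xi>"
    proof (rule tendsto_lowerbound)
      show "(G \<longlongrightarrow> G \<xi>) (at_right \<xi>)" using Gc by (simp add: isCont_def filterlim_at_split)
      show "\<forall>\<^sub>F x in at_right \<xi>. prob {\<omega>\<in>space M. Y \<omega> \<le> \<xi>} \<le> G x"
        unfolding eventually_at_right_field
      proof (intro exI[of _ pi] conjI allI impI True)
        fix x assume x: "\<xi> < x" "x < pi"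
        have "prob {\<omega>\<in>space M. Y \<omega> \<le> \<xi>} \<le> prob {\<omega>\<in>space M. Y \<omega> < x}"
          using x by (intro finite_measure_mono) auto
        also have "\<dots> \<le> G x" using sw(1)[of x] x \<xi> by simp
        finally show "prob {\<omega>\<in>space M. Y \<omega> \<le> \<xi>} \<le> G x" .
      qed
    qed simp
    then show ?thesis using sw(2)[OF \<xi>] unfolding G_def by simp
  next
    case False
    \<comment> \<open>There is no room to the right of \<open>pi\<close>; instead
      \<open>Y < pi\<close> holds almost surely, so the lower bound of the sandwich is already
      one.\<close>
    then have e: "\<xi> = pi" using \<xi> by simp
    have "prob {\<omega>\<in>space M. Y \<omega> < \<xi>} = 1"
      using Y unfolding e by (subst prob_eq_1) (auto elim!: AE_mp)
    moreover have "prob {\<omega>\<in>space M. Y \<omega> \<le> \<xi>} \<le> 1" by simp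
    ultimately show ?thesis using sw[OF \<xi>] unfolding G_def[symmetric] by linarith
  qed
qed

text \<open>By monotone convergence the sum of the norms has a finite integral. This supplies the
  almost everywhere premise of termwise integration.\<close>

lemma AE_summable_norm:
  fixes g :: "nat \<Rightarrow> 'a \<Rightarrow> 'b::{banach, second_countable_topology}"
  assumes g: "\<And>k. integrable M (g k)" and s: "summable (\<lambda>k. \<integral>x. norm (g k x) \<partial>M)"
  shows "AE x in M. summable (\<lambda>k. norm (g k x))"
proof -
  have [measurable]: "g k \<in> borel_measurable M" for k using g by auto
  have "(\<integral>\<^sup>+x. (\<Sum>k. ennreal (norm (g k x))) \<partial>M) = (\<Sum>k. \<integral>\<^sup>+x. ennreal (norm (g k x)) \<partial>M)"
    by (rule nn_integral_suminf) simp
  also have "\<dots> = (\<Sum>k. ennreal (\<integral>x. norm (g k x) \<partial>M))"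
    using g by (simp add: nn_integral_eq_integral)
  also have "\<dots> = ennreal (\<Sum>k. \<integral>x. norm (g k x) \<partial>M)"
    by (rule suminf_ennreal2) (use s in auto)
  finally have "(\<integral>\<^sup>+x. (\<Sum>k. ennreal (norm (g k x))) \<partial>M) \<noteq> \<infinity>" by simp
  then have "AE x in M. (\<Sum>k. ennreal (norm (g k x))) \<noteq> \<infinity>"
    by (intro nn_integral_PInf_AE) auto
  then show ?thesis
    by eventually_elim (auto intro: summable_suminf_not_top)
qed

section \<open>Orthogonal sine modes and square integrable sums\<close>

lemma sine_integral:
  fixes T \<xi> :: real
  assumes "0 < T" "0 \<le> \<xi>"
  shows "(LBINT x:{0..\<xi>}. sin (T * x)) = (1 - cos (T * \<xi>)) / T"
proof -
  have "((\<lambda>x. sin (T * x)) has_integral (- cos (T * \<xi>) / T - - cos (T * 0) / T)) {0..\<xi>}"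
  proof (rule fundamental_theorem_of_calculus[OF assms(2)])
    fix x
    show "((\<lambda>x. - cos (T * x) / T) has_vector_derivative sin (T * x)) (at x within {0..\<xi>})"
      unfolding has_real_derivative_iff_has_vector_derivative[symmetric]
      using assms by (auto intro!: derivative_eq_intros)
  qed
  moreover have "set_integrable lborel {0..\<xi>} (\<lambda>x. sin (T * x))"
    by (rule borel_integrable_atLeastAtMost') (intro continuous_intros)
  ultimately show ?thesis
    by (simp add: set_borel_integral_eq_integral(2) integral_unique diff_divide_distrib)
qed

lemma cos_integral_zero:
  assumes "0 < q" and m: "m \<in> \<int>" "m \<noteq> 0"
  shows "((\<lambda>x. cos (m * pi / q * x)) has_integral 0) {0..q}"
proof -
  define T where "T = m * pi / q"
  have T: "T \<noteq> 0" unfolding T_def using assms by simp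
  have "((\<lambda>x. cos (T * x)) has_integral (sin (T * q) / T - sin (T * 0) / T)) {0..q}"
  proof (rule fundamental_theorem_of_calculus)
    fix x
    show "((\<lambda>x. sin (T * x) / T) has_vector_derivative cos (T * x)) (at x within {0..q})"
      unfolding has_real_derivative_iff_has_vector_derivative[symmetric]
      using T by (auto intro!: derivative_eq_intros)
  qed (use assms in simp)
  moreover have "sin (T * q) = 0" unfolding T_def using assms sin_integer_2pi
    by (auto simp: sin_zero_iff_int2 elim!: Ints_cases)
  ultimately show ?thesis unfolding T_def by simp
qed

definition sine_mode :: "real \<Rightarrow> nat \<Rightarrow> real \<Rightarrow> real" where
  "sine_mode q k x = indicator {0<..<q} x * sin (real (Suc k) * pi / q * x)"

lemma sine_mode_measurable [measurable]: "sine_mode q k \<in> borel_measurable borel"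
  unfolding sine_mode_def by measurable

lemma sine_mode_le: "\<bar>sine_mode q k x\<bar> \<le> indicator {0<..<q} x"
  by (auto simp: sine_mode_def indicator_def)

lemma indicator_integrable: "integrable lborel (\<lambda>x::real. indicator {0<..<q} x :: real)"
  by (cases "0 \<le> q") auto

lemma sine_mode_integrable: "integrable lborel (sine_mode q k)"
  by (rule Bochner_Integration.integrable_bound[OF indicator_integrable]) (use sine_mode_le in auto)

lemma sine_mode_mult_integrable: "integrable lborel (\<lambda>x. sine_mode q j x * sine_mode q k x)"
proof (rule Bochner_Integration.integrable_bound[OF indicator_integrable[of q]])
  have "\<bar>sine_mode q j x\<bar> * \<bar>sine_mode q k x\<bar> \<le> indicator {0<..<q} x" for x
  proof -
    have "\<bar>sine_mode q j x\<bar> * \<bar>sine_mode q k x\<bar> \<le> indicator {0<..<q} x * indicator {0<..<q} x"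
      by (intro mult_mono sine_mode_le) auto
    also have "\<dots> = indicator {0<..<q} x" by (simp add: indicator_def)
    finally show ?thesis .
  qed
  then show "AE x in lborel. norm (sine_mode q j x * sine_mode q k x) \<le> norm (indicator {0<..<q} x :: real)"
    by (intro AE_I2) (simp add: abs_mult)
qed measurable

lemma sine_mode_orthogonal:
  assumes q: "0 < q"
  shows "(LBINT x. sine_mode q j x * sine_mode q k x) = (if j = k then q / 2 else 0)"
proof -
  define J K where "J = real (Suc j)" and "K = real (Suc k)"
  have prod: "sin (J * pi / q * x) * sin (K * pi / q * x) = cos ((J - K) * pi / q * x) / 2 - cos ((J + K) * pi / q * x) / 2" for x
  proof -
    have "(J - K) * pi / q * x = J * pi / q * x - K * pi / q * x" "(J + K) * pi / q * x = J * pi / q * x + K * pi / q * x"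
      by (simp_all add: algebra_simps diff_divide_distrib add_divide_distrib)
    then show ?thesis by (simp add: sin_times_sin diff_divide_distrib)
  qed
  have c1: "((\<lambda>x. cos ((J - K) * pi / q * x)) has_integral (if j = k then q else 0)) {0..q}"
  proof (cases "j = k")
    case True
    then show ?thesis using has_integral_const_real[of "1::real" 0 q] q by (simp add: J_def K_def)
  next
    case False
    then show ?thesis using cos_integral_zero[OF q, of "J - K"] by (simp add: J_def K_def)
  qed
  have c2: "((\<lambda>x. cos ((J + K) * pi / q * x)) has_integral 0) {0..q}"
    by (rule cos_integral_zero[OF q]) (auto simp: J_def K_def intro!: Ints_add)
  have h: "((\<lambda>x. sin (J * pi / q * x) * sin (K * pi / q * x)) has_integral ((if j = k then q else 0) / 2 - 0 / 2)) {0..q}"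
    unfolding prod by (intro has_integral_diff has_integral_divide c1 c2)
  have i: "set_integrable lborel {0..q} (\<lambda>x. sin (J * pi / q * x) * sin (K * pi / q * x))"
    by (rule borel_integrable_atLeastAtMost') (intro continuous_intros)
  have "(LBINT x. sine_mode q j x * sine_mode q k x) = (LBINT x:{0<..<q}. sin (J * pi / q * x) * sin (K * pi / q * x))"
    unfolding set_lebesgue_integral_def
    by (rule Bochner_Integration.integral_cong) (auto simp: sine_mode_def indicator_def J_def K_def)
  also have "\<dots> = (LBINT x:{0..q}. sin (J * pi / q * x) * sin (K * pi / q * x))"
    unfolding set_lebesgue_integral_def
    by (rule integral_discrete_difference[of "{0,q}"]) (auto simp: indicator_def)
  also have "\<dots> = (if j = k then q else 0) / 2 - 0 / 2"
    unfolding set_borel_integral_eq_integral(2)[OF i] by (rule integral_unique[OF h])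
  finally show ?thesis by (auto split: if_splits)
qed

lemma sine_sum_square:
  assumes q: "0 < q" and A: "finite A"
  shows "integrable lborel (\<lambda>x. (\<Sum>k\<in>A. b k * sine_mode q k x)^2)"
    "(LBINT x. (\<Sum>k\<in>A. b k * sine_mode q k x)^2) = (q / 2) * (\<Sum>k\<in>A. (b k)^2)"
proof -
  have e: "(\<Sum>k\<in>A. b k * sine_mode q k x)^2 = (\<Sum>j\<in>A. \<Sum>k\<in>A. (b j * b k) * (sine_mode q j x * sine_mode q k x))" for x
    unfolding power2_eq_square sum_product by (simp add: mult_ac)
  have i: "integrable lborel (\<lambda>x. (b j * b k) * (sine_mode q j x * sine_mode q k x))" for j k
    using sine_mode_mult_integrable by (rule integrable_mult_right)
  show "integrable lborel (\<lambda>x. (\<Sum>k\<in>A. b k * sine_mode q k x)^2)"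
    unfolding e by (intro Bochner_Integration.integrable_sum i)
  have "(LBINT x. (\<Sum>k\<in>A. b k * sine_mode q k x)^2)
      = (\<Sum>j\<in>A. \<Sum>k\<in>A. (b j * b k) * (LBINT x. sine_mode q j x * sine_mode q k x))"
    unfolding e integral_mult_right_zero[symmetric]
    by (subst Bochner_Integration.integral_sum; (intro Bochner_Integration.integrable_sum i sum.cong refl)?)+
  also have "\<dots> = (\<Sum>j\<in>A. \<Sum>k\<in>A. if j = k then (q / 2) * (b j)^2 else 0)"
    by (intro sum.cong refl) (simp add: sine_mode_orthogonal[OF q] power2_eq_square)
  also have "\<dots> = (q / 2) * (\<Sum>k\<in>A. (b k)^2)" using A by (simp add: sum_distrib_left)
  finally show "(LBINT x. (\<Sum>k\<in>A. b k * sine_mode q k x)^2) = (q / 2) * (\<Sum>k\<in>A. (b k)^2)" .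
qed

abbreviation sine_int :: "real \<Rightarrow> nat \<Rightarrow> real \<Rightarrow> real" where
  "sine_int q k \<xi> \<equiv> (1 - cos (real (Suc k) * pi / q * \<xi>)) / (real (Suc k) * pi / q)"

lemma sine_mode_integral:
  assumes q: "0 < q" and \<xi>: "0 \<le> \<xi>" "\<xi> \<le> q"
  shows "(LBINT x:{0..\<xi>}. sine_mode q k x) = sine_int q k \<xi>"
proof -
  have "(LBINT x:{0..\<xi>}. sine_mode q k x) = (LBINT x:{0..\<xi>}. sin (real (Suc k) * pi / q * x))"
    unfolding set_lebesgue_integral_def
    by (rule integral_discrete_difference[of "{0,q}"]) (use \<xi> in \<open>auto simp: indicator_def sine_mode_def\<close>)
  also have "\<dots> = sine_int q k \<xi>"
    by (rule sine_integral) (use q \<xi> in auto)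
  finally show ?thesis .
qed


text \<open>A Riesz--Fischer argument: along a subsequence the partial sums converge fast enough in
  \<open>L\<^sup>2\<close>, hence absolutely in \<open>L\<^sup>1\<close> and almost everywhere.\<close>

lemma sine_series_L2:
  fixes b :: "nat \<Rightarrow> real"
  assumes q: "0 < q" and b2: "summable (\<lambda>k. (b k)^2)"
  obtains h where "integrable lborel h" "\<And>x. x \<notin> {0<..<q} \<Longrightarrow> h x = 0" "integrable lborel (\<lambda>x. (h x)^2)"
    "\<And>\<xi>. 0 \<le> \<xi> \<Longrightarrow> \<xi> \<le> q \<Longrightarrow>
       summable (\<lambda>k. b k * sine_int q k \<xi>) \<Longrightarrow>
       (LBINT x:{0..\<xi>}. h x) = (\<Sum>k. b k * sine_int q k \<xi>)"
proof -
  define R where "R = (\<lambda>N. \<Sum>k. (b (k + N))^2)"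
  have R0: "R \<longlonglongrightarrow> 0" unfolding R_def by (rule suminf_exist_split2[OF b2])
  have "\<exists>m. \<forall>N\<ge>m. R N < (1/4) ^ j" for j :: nat
    using order_tendstoD(2)[OF R0, of "(1/4) ^ j"] by (auto simp: eventually_sequentially)
  then obtain m where m: "\<And>j N. m j \<le> N \<Longrightarrow> R N < (1/4) ^ j" by metis
  \<comment> \<open>\<open>N j\<close> is at least \<open>m j\<close>, so the block from
    \<open>N j\<close> onwards has squared coefficients of total size below \<open>(1/4)^j\<close>;
    the extra summand \<open>j\<close> makes \<open>N\<close> strictly increasing.\<close>
  define N where "N = (\<lambda>j. j + (\<Sum>i\<le>j. m i))"
  have Nm: "m j \<le> N j" for j unfolding N_def by (simp add: trans_le_add2 member_le_sum)
  have Nmono: "strict_mono N" unfolding strict_mono_Suc_iff N_def by simp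
  define S where "S = (\<lambda>n x. \<Sum>k<n. b k * sine_mode q k x)"
  define D where "D = (\<lambda>j x. \<Sum>k\<in>{N j..<N (Suc j)}. b k * sine_mode q k x)"
  have Si: "integrable lborel (S n)" for n
    unfolding S_def by (intro Bochner_Integration.integrable_sum integrable_mult_right sine_mode_integrable)
  have Di: "integrable lborel (D j)" for j
    unfolding D_def by (intro Bochner_Integration.integrable_sum integrable_mult_right sine_mode_integrable)
  have NS: "N j \<le> N (Suc j)" for j using Nmono by (simp add: strict_mono_Suc_iff less_imp_le)
  have SD: "S (N (Suc j)) x = S (N j) x + D j x" for j x
    unfolding S_def D_def using NS[of j] by (metis lessThan_atLeast0 sum.atLeastLessThan_concat zero_le)
  have tele: "S (N 0) x + (\<Sum>i<j. D i x) = S (N j) x" for j x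
    by (induction j) (simp_all add: SD add.assoc[symmetric])
  have D2: "(LBINT x. (D j x)^2) \<le> (q / 2) * (1/4) ^ j" for j
  proof -
    have "(\<Sum>k\<in>{N j..<N (Suc j)}. (b k)^2) = (\<Sum>k<N (Suc j) - N j. (b (k + N j))^2)"
      by (rule sum.reindex_bij_witness[of _ "\<lambda>k. k + N j" "\<lambda>k. k - N j"]) auto
    also have "\<dots> \<le> R (N j)" unfolding R_def
      by (rule sum_le_suminf) (use b2 in \<open>auto simp: summable_iff_shift[of "\<lambda>k. (b k)^2"]\<close>)
    also have "\<dots> \<le> (1/4) ^ j" using m[OF Nm[of j]] by simp
    finally show ?thesis
      unfolding D_def sine_sum_square(2)[OF q finite_atLeastLessThan] using q by (intro mult_left_mono) auto
  qed
  have D1: "(LBINT x. norm (D j x)) \<le> q * (1/2) ^ j" for j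
  proof -
    \<comment> \<open>The pointwise inequality \<open>\<bar>D\<bar> \<le> c/2 + D^2/(2 c)\<close>
      replaces Cauchy-Schwarz. The integral of \<open>D^2\<close> is at most
      \<open>(q/2) c^2\<close>, so with this \<open>c\<close> both parts have order
      \<open>q c\<close>, together at most \<open>3/4 q c\<close>.\<close>
    define c where "c = (1/2::real) ^ j"
    have c: "0 < c" "c * c = (1/4) ^ j" unfolding c_def by (auto simp: power_mult_distrib[symmetric])
    have out: "D j x = 0" if "x \<notin> {0<..<q}" for x unfolding D_def sine_mode_def using that by simp
    have am: "norm (D j x) \<le> c / 2 * indicator {0<..<q} x + 1 / (2 * c) * (D j x)^2" for x
    proof (cases "x \<in> {0<..<q}")
      case True
      have "0 \<le> (\<bar>D j x\<bar> - c)^2" by simp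
      then have "2 * c * \<bar>D j x\<bar> \<le> c * c + (D j x)^2" by (simp add: power2_eq_square algebra_simps)
      then have "\<bar>D j x\<bar> \<le> (c * c + (D j x)^2) / (2 * c)" using c(1) by (simp add: field_simps)
      also have "\<dots> = c / 2 + 1 / (2 * c) * (D j x)^2" using c(1) by (simp add: field_simps)
      finally show ?thesis using True by simp
    qed (use out in simp)
    have D2i: "integrable lborel (\<lambda>x. (D j x)^2)" unfolding D_def by (rule sine_sum_square(1)[OF q]) simp
    have "(LBINT x. norm (D j x)) \<le> (LBINT x. c / 2 * indicator {0<..<q} x + 1 / (2 * c) * (D j x)^2)"
      by (rule integral_mono[OF integrable_norm[OF Di] _ am])
        (intro Bochner_Integration.integrable_add integrable_mult_right indicator_integrable D2i)
    also have "\<dots> = c / 2 * q + 1 / (2 * c) * (LBINT x. (D j x)^2)"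
      by (subst Bochner_Integration.integral_add)
        (use q in \<open>auto intro!: integrable_mult_right indicator_integrable D2i\<close>)
    also have "\<dots> \<le> c / 2 * q + 1 / (2 * c) * ((q / 2) * (c * c))"
      unfolding c(2) using c by (intro add_left_mono mult_left_mono D2) auto
    also have "\<dots> = q * c * (3/4)" using c(1) by (simp add: field_simps)
    also have "\<dots> \<le> q * c" using q c by simp
    finally show ?thesis unfolding c_def .
  qed
  have geo: "summable (\<lambda>j. q * (1/2::real) ^ j)" by (intro summable_mult summable_geometric) simp
  have Dsum: "summable (\<lambda>j. LBINT x. norm (D j x))"
    by (rule summable_comparison_test'[OF geo]) (use D1 in simp)
  have AEs: "AE x in lborel. summable (\<lambda>j. norm (D j x))" by (rule AE_summable_norm[OF Di Dsum])
  define h where "h = (\<lambda>x. S (N 0) x + (\<Sum>j. D j x))"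
  have sumi: "integrable lborel (\<lambda>x. \<Sum>j. D j x)" by (rule integrable_suminf[OF Di AEs Dsum])
  have hi: "integrable lborel h" unfolding h_def by (intro Bochner_Integration.integrable_add Si sumi)
  have [measurable]: "h \<in> borel_measurable borel" using hi by auto
  have [measurable]: "S n \<in> borel_measurable borel" for n using Si[of n] by auto
  have lim: "AE x in lborel. (\<lambda>j. S (N j) x) \<longlonglongrightarrow> h x"
    using AEs
  proof eventually_elim
    case (elim x)
    then have "summable (\<lambda>j. D j x)" by (rule summable_norm_cancel)
    then have "(\<lambda>j. S (N 0) x + (\<Sum>i<j. D i x)) \<longlonglongrightarrow> h x"
      unfolding h_def by (intro tendsto_add tendsto_const summable_LIMSEQ)
    then show ?case by (simp only: tele)
  qed
  show thesis
  proof (rule that[OF hi])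
    show "h x = 0" if "x \<notin> {0<..<q}" for x
      unfolding h_def S_def D_def sine_mode_def using that by simp
    show "integrable lborel (\<lambda>x. (h x)^2)"
    proof (rule integrableI_bounded)
      define B where "B = (q / 2) * (\<Sum>k. (b k)^2)"
      \<comment> \<open>Fatou along the subsequence: by orthogonality, each partial sum has squared
        norm \<open>q/2\<close> times a partial sum of the squared coefficients.\<close>
      have "(\<integral>\<^sup>+x. ennreal ((h x)^2) \<partial>lborel) = (\<integral>\<^sup>+x. liminf (\<lambda>j. ennreal ((S (N j) x)^2)) \<partial>lborel)"
      proof (rule nn_integral_cong_AE)
        show "AE x in lborel. ennreal ((h x)^2) = liminf (\<lambda>j. ennreal ((S (N j) x)^2))"
          using lim
        proof eventually_elim
          case (elim x)
          then have "(\<lambda>j. ennreal ((S (N j) x)^2)) \<longlonglongrightarrow> ennreal ((h x)^2)"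
            by (intro tendsto_ennrealI tendsto_power)
          from lim_imp_Liminf[OF _ this] show ?case by simp
        qed
      qed
      also have "\<dots> \<le> liminf (\<lambda>j. \<integral>\<^sup>+x. ennreal ((S (N j) x)^2) \<partial>lborel)"
        by (rule nn_integral_liminf) simp
      also have "\<dots> \<le> liminf (\<lambda>j. ennreal B)"
      proof (intro Liminf_mono always_eventually allI)
        fix j
        have "(\<integral>\<^sup>+x. ennreal ((S (N j) x)^2) \<partial>lborel) = ennreal (LBINT x. (S (N j) x)^2)"
          unfolding S_def by (intro nn_integral_eq_integral sine_sum_square(1)[OF q]) auto
        also have "(LBINT x. (S (N j) x)^2) = (q / 2) * (\<Sum>k<N j. (b k)^2)"
          unfolding S_def by (rule sine_sum_square(2)[OF q]) simp
        also have "\<dots> \<le> B" unfolding B_def using q by (intro mult_left_mono sum_le_suminf b2) auto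
        finally show "(\<integral>\<^sup>+x. ennreal ((S (N j) x)^2) \<partial>lborel) \<le> ennreal B" by (simp add: ennreal_leI)
      qed
      also have "\<dots> < \<infinity>" by (simp add: Liminf_const)
      finally show "(\<integral>\<^sup>+x. ennreal (norm ((h x)^2)) \<partial>lborel) < \<infinity>" by simp
    qed measurable
    fix \<xi> :: real assume \<xi>: "0 \<le> \<xi>" "\<xi> \<le> q"
    define c where "c = (\<lambda>k. b k * sine_int q k \<xi>)"
    assume "summable (\<lambda>k. b k * sine_int q k \<xi>)"
    then have cs: "summable c" by (simp only: c_def)
    have ind: "integrable lborel (\<lambda>x. indicator {0..\<xi>} x *\<^sub>R g x)" if "integrable lborel g" for g :: "real \<Rightarrow> real"
      using that by (intro integrable_mult_indicator) auto
    have partial: "(LBINT x:{0..\<xi>}. S n x) = (\<Sum>k<n. c k)" for n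
    proof -
      have "(LBINT x:{0..\<xi>}. S n x) = (LBINT x. \<Sum>k<n. b k * (indicator {0..\<xi>} x *\<^sub>R sine_mode q k x))"
        unfolding set_lebesgue_integral_def S_def
        by (rule Bochner_Integration.integral_cong) (auto simp: indicator_def)
      also have "\<dots> = (\<Sum>k<n. b k * (LBINT x:{0..\<xi>}. sine_mode q k x))"
        unfolding set_lebesgue_integral_def
        by (subst Bochner_Integration.integral_sum; (intro integrable_mult_right ind sine_mode_integrable)?)
          (simp only: integral_mult_right_zero)
      finally show ?thesis by (simp only: sine_mode_integral[OF q \<xi>] c_def)
    qed
    have "(\<lambda>j. LBINT x:{0..\<xi>}. D j x) sums (LBINT x:{0..\<xi>}. \<Sum>j. D j x)"
    proof -
      have "(\<lambda>j. LBINT x. indicator {0..\<xi>} x *\<^sub>R D j x) sums (LBINT x. \<Sum>j. indicator {0..\<xi>} x *\<^sub>R D j x)"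
      proof (rule sums_integral[OF ind[OF Di]])
        show "AE x in lborel. summable (\<lambda>j. norm (indicator {0..\<xi>} x *\<^sub>R D j x))"
          using AEs by eventually_elim (auto simp: indicator_def)
        show "summable (\<lambda>j. LBINT x. norm (indicator {0..\<xi>} x *\<^sub>R D j x))"
        proof (rule summable_comparison_test'[OF Dsum])
          fix j
          have "(LBINT x. norm (indicator {0..\<xi>} x *\<^sub>R D j x)) \<le> (LBINT x. norm (D j x))"
            by (rule integral_mono[OF integrable_norm[OF ind[OF Di]] integrable_norm[OF Di]])
              (simp add: indicator_def)
          then show "norm (LBINT x. norm (indicator {0..\<xi>} x *\<^sub>R D j x)) \<le> (LBINT x. norm (D j x))" by simp
        qed
      qed
      moreover have "(\<Sum>j. indicator {0..\<xi>} x *\<^sub>R D j x) = indicator {0..\<xi>} x *\<^sub>R (\<Sum>j. D j x)" for x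
        by (auto simp: indicator_def)
      ultimately show ?thesis unfolding set_lebesgue_integral_def by simp
    qed
    then have "(\<lambda>j. \<Sum>i<j. LBINT x:{0..\<xi>}. D i x) \<longlonglongrightarrow> (LBINT x:{0..\<xi>}. \<Sum>j. D j x)"
      by (simp only: sums_def)
    then have "(\<lambda>j. (LBINT x:{0..\<xi>}. S (N 0) x) + (\<Sum>i<j. LBINT x:{0..\<xi>}. D i x)) \<longlonglongrightarrow> (LBINT x:{0..\<xi>}. h x)"
      unfolding h_def
      by (subst set_integral_add(2)) (auto simp only: set_integrable_def intro!: ind Si sumi tendsto_add tendsto_const)
    moreover have "(LBINT x:{0..\<xi>}. S (N 0) x) + (\<Sum>i<j. LBINT x:{0..\<xi>}. D i x) = (\<Sum>k<N j. c k)" for j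
    proof (induction j)
      case 0
      show ?case by (simp add: partial)
    next
      case (Suc j)
      have "(LBINT x:{0..\<xi>}. S (N (Suc j)) x) = (LBINT x:{0..\<xi>}. S (N j) x) + (LBINT x:{0..\<xi>}. D j x)"
        unfolding SD by (rule set_integral_add(2)) (auto simp only: set_integrable_def intro!: ind Si Di)
      then show ?case using Suc by (simp add: partial)
    qed
    ultimately have "(\<lambda>j. \<Sum>k<N j. c k) \<longlonglongrightarrow> (LBINT x:{0..\<xi>}. h x)" by simp
    \<comment> \<open>The integrals converge only along \<open>N\<close> so far; the assumed
      summability of the integrated series identifies the limit with its full sum.\<close>
    moreover have "(\<lambda>j. \<Sum>k<N j. c k) \<longlonglongrightarrow> (\<Sum>k. c k)"
      using LIMSEQ_subseq_LIMSEQ[OF summable_LIMSEQ[OF cs] Nmono] by (simp add: o_def)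
    ultimately show "(LBINT x:{0..\<xi>}. h x) = (\<Sum>k. b k * sine_int q k \<xi>)"
      unfolding c_def[symmetric] by (rule LIMSEQ_unique)
  qed
qed

text \<open>\<open>h\<close> might be negative somewhere a priori. Its signed integral agrees with
  the law of \<open>Y\<close> on half-lines, hence on all Borel sets by the pi-lambda theorem, and
  this forces \<open>h\<close> to be nonnegative almost everywhere. Truncating at 0 then changes it
  on a null set only.\<close>

lemma (in prob_space) distributed_from_cdf:
  fixes Y :: "'a \<Rightarrow> real"
  assumes Ym [measurable]: "Y \<in> borel_measurable M" and Y: "AE \<omega> in M. 0 < Y \<omega> \<and> Y \<omega> < q"
    and q: "0 < q" and hi: "integrable lborel h" and h0: "\<And>x. x \<notin> {0<..<q} \<Longrightarrow> h x = 0"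
    and cdf: "\<And>\<xi>. 0 \<le> \<xi> \<Longrightarrow> \<xi> \<le> q \<Longrightarrow> prob {\<omega>\<in>space M. Y \<omega> \<le> \<xi>} = (LBINT x:{0..\<xi>}. h x)"
  shows "distributed M lborel Y (\<lambda>x. ennreal (max 0 (h x)))"
proof -
  have [measurable]: "h \<in> borel_measurable borel" using hi by auto
  interpret D: prob_space "distr M borel Y" by (rule prob_space_distr) simp
  have hS: "set_integrable lborel A h" if "A \<in> sets borel" for A
    unfolding set_integrable_def using that hi by (intro integrable_mult_indicator) auto
  have le: "(LBINT x:{..a}. h x) = prob {\<omega>\<in>space M. Y \<omega> \<le> a}" for a
  proof -
    consider "a < 0" | "0 \<le> a" "a \<le> q" | "q < a" by linarith
    then show ?thesis
    proof cases
      case 1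
      have "(LBINT x:{..a}. h x) = (LBINT x::real. 0)" unfolding set_lebesgue_integral_def
        by (rule Bochner_Integration.integral_cong) (use 1 h0 in \<open>auto simp: indicator_def\<close>)
      moreover have "prob {\<omega>\<in>space M. Y \<omega> \<le> a} = 0"
        using Y 1 by (subst prob_eq_0) (auto elim!: AE_mp)
      ultimately show ?thesis by simp
    next
      case 2
      have "(LBINT x:{..a}. h x) = (LBINT x:{0..a}. h x)" unfolding set_lebesgue_integral_def
        by (rule Bochner_Integration.integral_cong) (use 2 h0 in \<open>auto simp: indicator_def\<close>)
      then show ?thesis using cdf[OF 2] by simp
    next
      case 3
      have "(LBINT x:{..a}. h x) = (LBINT x:{0..q}. h x)" unfolding set_lebesgue_integral_def
        by (rule Bochner_Integration.integral_cong) (use 3 h0 in \<open>auto simp: indicator_def\<close>)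
      also have "\<dots> = prob {\<omega>\<in>space M. Y \<omega> \<le> q}" using cdf[of q] q by simp
      also have "\<dots> = 1" using Y by (subst prob_eq_1) (auto elim!: AE_mp)
      also have "\<dots> = prob {\<omega>\<in>space M. Y \<omega> \<le> a}" using Y 3 by (subst eq_commute, subst prob_eq_1) (auto elim!: AE_mp)
      finally show ?thesis .
    qed
  qed
  have total: "(LBINT x. h x) = 1"
  proof -
    have "(LBINT x. h x) = (LBINT x:{..q}. h x)" unfolding set_lebesgue_integral_def
      by (rule Bochner_Integration.integral_cong) (use h0 in \<open>auto simp: indicator_def\<close>)
    also have "\<dots> = prob {\<omega>\<in>space M. Y \<omega> \<le> q}" by (rule le)
    also have "\<dots> = 1" using Y by (subst prob_eq_1) (auto elim!: AE_mp)
    finally show ?thesis .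
  qed
  have meas_eq: "(LBINT x:A. h x) = measure (distr M borel Y) A" if "A \<in> sets borel" for A
  proof -
    have bs: "sets borel = sigma_sets UNIV (range (\<lambda>a::real. {..a}))"
      by (subst borel_eq_atMost) (simp add: sets_measure_of)
    have "Int_stable (range (\<lambda>a::real. {..a}))" "range (\<lambda>a::real. {..a}) \<subseteq> Pow UNIV"
      "A \<in> sigma_sets UNIV (range (\<lambda>a::real. {..a}))" using that bs by (auto simp: Int_stable_def)
    then show ?thesis
    proof (induction rule: sigma_sets_induct_disjoint)
      case empty
      show ?case by (simp add: set_lebesgue_integral_def)
    next
      case (basic A)
      then obtain a where A: "A = {..a}" by auto
      have "measure (distr M borel Y) A = prob (Y -` {..a} \<inter> space M)" unfolding A by (simp add: measure_distr)
      also have "Y -` {..a} \<inter> space M = {\<omega>\<in>space M. Y \<omega> \<le> a}" by auto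
      finally show ?case unfolding A by (simp add: le)
    next
      case (compl A)
      then have [measurable]: "A \<in> sets borel" using bs by simp
      have "(LBINT x:UNIV - A. h x) + (LBINT x:A. h x) = (LBINT x. h x)"
        using set_integral_Un[of "UNIV - A" A lborel h] hS[of A] hS[of "UNIV - A"]
        by (simp add: set_lebesgue_integral_def Diff_disjoint Int_commute)
      then show ?case using compl.IH total D.prob_compl[of A] by simp
    next
      case (union A)
      then have [measurable]: "A i \<in> sets borel" for i using bs by auto
      have "(LBINT x:(\<Union>i. A i). h x) = (\<Sum>i. (LBINT x:(A i). h x))"
        by (rule lebesgue_integral_countable_add) (use union hS[of "\<Union>i. A i"] in \<open>auto simp: disjoint_family_on_def\<close>)
      also have "\<dots> = (\<Sum>i. measure (distr M borel Y) (A i))" using union by simp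
      also have "\<dots> = measure (distr M borel Y) (\<Union>i. A i)"
        by (rule sums_unique[symmetric], rule D.finite_measure_UNION) (use union in auto)
      finally show ?case .
    qed
  qed
  have AEh: "AE x in lborel. 0 \<le> h x"
  proof -
    \<comment> \<open>The law gives \<open>Z\<close> the mass \<open>\<integral> h\<close> over
      \<open>Z\<close>, which is at most 0; hence it is 0, and \<open>h\<close>, negative on
      \<open>Z\<close>, forces \<open>Z\<close> to be null.\<close>
    define Z where "Z = {x. h x < 0}"
    have Z [measurable]: "Z \<in> sets borel" unfolding Z_def by measurable
    have i: "integrable lborel (\<lambda>x. - (indicator Z x *\<^sub>R h x))" using hS[OF Z] by (simp add: set_integrable_def)
    have nn: "AE x in lborel. 0 \<le> - (indicator Z x *\<^sub>R h x)" by (auto simp: Z_def indicator_def)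
    have "(LBINT x. - (indicator Z x *\<^sub>R h x)) = - measure (distr M borel Y) Z"
      using meas_eq[OF Z] by (simp add: set_lebesgue_integral_def)
    then have "(LBINT x. - (indicator Z x *\<^sub>R h x)) = 0"
      using integral_nonneg_AE[OF nn] measure_nonneg[of "distr M borel Y" Z] by linarith
    then have "AE x in lborel. - (indicator Z x *\<^sub>R h x) = 0"
      using integral_nonneg_eq_0_iff_AE[OF i nn] by simp
    then show ?thesis by eventually_elim (auto simp: Z_def indicator_def split: if_splits)
  qed
  show ?thesis
    unfolding distributed_def
  proof (intro conjI)
    show "distr M lborel Y = density lborel (\<lambda>x. ennreal (max 0 (h x)))"
    proof (rule measure_eqI)
      fix A assume "A \<in> sets (distr M lborel Y)"
      then have A [measurable]: "A \<in> sets borel" by simp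
      have "emeasure (distr M lborel Y) A = emeasure (distr M borel Y) A"
        by (simp add: emeasure_distr)
      also have "\<dots> = ennreal (LBINT x:A. h x)" using meas_eq[OF A] by (simp add: D.emeasure_eq_measure)
      also have "(LBINT x:A. h x) = (LBINT x. max 0 (h x) * indicator A x)"
        unfolding set_lebesgue_integral_def
        by (rule integral_cong_AE) (use AEh in \<open>auto elim!: AE_mp simp: max_def mult.commute\<close>)
      also have "ennreal \<dots> = (\<integral>\<^sup>+x. ennreal (max 0 (h x) * indicator A x) \<partial>lborel)"
        by (rule nn_integral_eq_integral[symmetric])
          (use hi in \<open>auto intro!: integrable_real_mult_indicator integrable_max\<close>)
      also have "\<dots> = emeasure (density lborel (\<lambda>x. ennreal (max 0 (h x)))) A"
        by (subst emeasure_density) (auto intro!: nn_integral_cong simp: indicator_def)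
      finally show "emeasure (distr M lborel Y) A = emeasure (density lborel (\<lambda>x. ennreal (max 0 (h x)))) A" .
    qed simp
  qed auto
qed

lemma sine_series_continuous:
  fixes b :: "nat \<Rightarrow> real"
  assumes q: "0 < q" and bs: "summable (\<lambda>k. \<bar>b k\<bar>)"
  defines "h \<equiv> (\<lambda>x. \<Sum>k. b k * sin (real (Suc k) * pi / q * x))"
  shows "continuous_on UNIV h"
    "\<And>\<xi>. 0 \<le> \<xi> \<Longrightarrow>
       (LBINT x:{0..\<xi>}. h x) = (\<Sum>k. b k * sine_int q k \<xi>)"
proof -
  have le: "\<bar>b k * sin \<theta>\<bar> \<le> \<bar>b k\<bar>" for k \<theta>
    by (simp add: abs_mult mult_left_le)
  show "continuous_on UNIV h" unfolding h_def
    by (rule continuous_on_suminf_dominated[OF _ le bs]) (intro continuous_intros)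
  fix \<xi> :: real assume \<xi>: "0 \<le> \<xi>"
  define g where "g = (\<lambda>k x. indicator {0..\<xi>} x *\<^sub>R (b k * sin (real (Suc k) * pi / q * x)))"
  have gi: "integrable lborel (g k)" for k
    unfolding g_def set_integrable_def[symmetric]
    by (rule borel_integrable_atLeastAtMost') (intro continuous_intros)
  have gle: "norm (g k x) \<le> \<bar>b k\<bar> * indicator {0..\<xi>} x" for k x
    unfolding g_def using le[of k] by (auto simp: indicator_def)
  have ii: "integrable lborel (\<lambda>x. \<bar>b k\<bar> * indicator {0..\<xi>} x)" for k using \<xi> by simp
  have "(LBINT x. norm (g k x)) \<le> \<bar>b k\<bar> * \<xi>" for k
    using integral_mono[OF integrable_norm[OF gi[of k]] ii[of k] gle] \<xi> by simp
  then have gs: "summable (\<lambda>k. LBINT x. norm (g k x))"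
    by (intro summable_comparison_test'[OF summable_mult2[OF bs, of \<xi>]]) simp
  have "(LBINT x. (\<Sum>k. g k x)) = (\<Sum>k. LBINT x. g k x)"
    by (rule integral_suminf[OF gi AE_summable_norm[OF gi gs] gs])
  moreover have "(\<Sum>k. g k x) = indicator {0..\<xi>} x *\<^sub>R h x" for x
    unfolding g_def h_def by (auto simp: indicator_def)
  moreover have "(LBINT x. g k x) = b k * sine_int q k \<xi>" for k
  proof -
    have "(LBINT x. g k x) = b k * (LBINT x:{0..\<xi>}. sin (real (Suc k) * pi / q * x))"
      unfolding g_def set_lebesgue_integral_def
      by (subst integral_mult_right_zero[symmetric]) (simp add: mult_ac)
    then show ?thesis using sine_integral[of "real (Suc k) * pi / q" \<xi>] q \<xi> by simp
  qed
  ultimately show "(LBINT x:{0..\<xi>}. h x) = (\<Sum>k. b k * sine_int q k \<xi>)"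
    by (simp only: set_lebesgue_integral_def)
qed

section \<open>The range of Q and the representation of its law\<close>

lemma summable_powr_Suc: "s < -1 \<Longrightarrow> summable (\<lambda>k. real (Suc k) powr s)"
  using summable_real_powr_iff[of s] summable_Suc_iff[of "\<lambda>k. real k powr s"] by simp

text \<open>For \<open>N > 1\<close> the expression is strictly convex in each coordinate, so
  pushing the coordinates to 0 or 1 one after another increases it; \<open>j\<close> counts those
  pushed to 1. \<open>B\<close> and \<open>C\<close> hold the contributions of coordinates not yet
  treated. The weak inequality is carried along because strictness fails at \<open>k = 0\<close>,
  and a single strict push suffices.\<close>

lemma unit_square_sum_less_vertex:
  fixes x :: "nat \<Rightarrow> real" and N :: real
  assumes x: "\<And>i. i < k \<Longrightarrow> 0 < x i \<and> x i < 1" and N: "1 < N"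
  shows "\<exists>j\<le>k. (\<Sum>i<k. (x i)^2) + B - ((\<Sum>i<k. x i) + C)^2 / N \<le> real j + B - (real j + C)^2 / N
     \<and> (0 < k \<longrightarrow> (\<Sum>i<k. (x i)^2) + B - ((\<Sum>i<k. x i) + C)^2 / N < real j + B - (real j + C)^2 / N)"
  using x
proof (induction k arbitrary: B C)
  case 0
  then show ?case by simp
next
  case (Suc k)
  define y where "y = x k"
  have y: "0 < y" "y < 1" using Suc.prems[of k] unfolding y_def by auto
  have "\<exists>j\<le>k. (\<Sum>i<k. (x i)^2) + (B + y^2) - ((\<Sum>i<k. x i) + (C + y))^2 / N
      \<le> real j + (B + y^2) - (real j + (C + y))^2 / N"
    using Suc.IH[of "B + y^2" "C + y"] Suc.prems by auto
  then obtain j where j: "j \<le> k" "(\<Sum>i<k. (x i)^2) + (B + y^2) - ((\<Sum>i<k. x i) + (C + y))^2 / N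
      \<le> real j + (B + y^2) - (real j + (C + y))^2 / N" by blast
  define \<alpha> where "\<alpha> = 1 - 1 / N"
  define \<beta> where "\<beta> = - 2 * (real j + C) / N"
  define \<gamma> where "\<gamma> = real j + B - (real j + C)^2 / N"
  have \<alpha>: "0 < \<alpha>" unfolding \<alpha>_def using N by simp
  \<comment> \<open>The last coordinate as a variable: \<open>z = 0\<close> is the vertex value for
    \<open>j\<close>, and \<open>z = 1\<close> that for \<open>j + 1\<close>.\<close>
  have quad: "real j + (B + z^2) - (real j + (C + z))^2 / N = \<alpha> * z^2 + \<beta> * z + \<gamma>" for z
    unfolding \<alpha>_def \<beta>_def \<gamma>_def using N by (simp add: power2_eq_square field_simps)
  have "\<alpha> * y^2 < \<alpha> * y" using \<alpha> y by (simp add: power2_eq_square)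
  then have "\<alpha> * y^2 + \<beta> * y + \<gamma> < (\<alpha> + \<beta>) * y + \<gamma>" by (simp add: algebra_simps)
  also have "\<dots> \<le> max 0 (\<alpha> + \<beta>) + \<gamma>"
  proof -
    have "(\<alpha> + \<beta>) * y \<le> max 0 (\<alpha> + \<beta>) * y" using y by (intro mult_right_mono) auto
    also have "\<dots> \<le> max 0 (\<alpha> + \<beta>) * 1" using y by (intro mult_left_mono) auto
    finally show ?thesis by simp
  qed
  finally have s: "\<alpha> * y^2 + \<beta> * y + \<gamma> < max 0 (\<alpha> + \<beta>) + \<gamma>" .
  have tot: "(\<Sum>i<Suc k. (x i)^2) + B - ((\<Sum>i<Suc k. x i) + C)^2 / N \<le> \<alpha> * y^2 + \<beta> * y + \<gamma>"
    using j(2) unfolding quad[of y] by (simp add: y_def algebra_simps)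
  show ?case
  proof (cases "\<alpha> + \<beta> \<le> 0")
    case True
    then have "(\<Sum>i<Suc k. (x i)^2) + B - ((\<Sum>i<Suc k. x i) + C)^2 / N < real j + B - (real j + C)^2 / N"
      using s tot unfolding \<gamma>_def by simp
    then show ?thesis using j(1) by (intro exI[of _ j]) auto
  next
    case False
    have "\<alpha> + \<beta> + \<gamma> = real (Suc j) + B - (real (Suc j) + C)^2 / N"
      using quad[of 1] by (simp add: algebra_simps)
    then have "(\<Sum>i<Suc k. (x i)^2) + B - ((\<Sum>i<Suc k. x i) + C)^2 / N < real (Suc j) + B - (real (Suc j) + C)^2 / N"
      using s tot False by simp
    then show ?thesis using j(1) by (intro exI[of _ "Suc j"]) auto
  qed
qed

text \<open>Completing the square gives \<open>(n^2 - (n - 2 j)^2) / (4 n)\<close>; for odd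
  \<open>n\<close> the integer \<open>n - 2 j\<close> is odd, so its square is at least 1.\<close>

lemma vertex_le_qmax:
  assumes "1 \<le> n" "j \<le> n"
  shows "real j - (real j)^2 / real n \<le> qmax n"
proof -
  have n0: "0 < real n" using assms by simp
  have e: "real j - (real j)^2 / real n = ((real n)^2 - (real n - 2 * real j)^2) / (4 * real n)"
    using n0 by (simp add: field_simps power2_eq_square)
  show ?thesis
  proof (cases "even n")
    case True
    have "((real n)^2 - (real n - 2 * real j)^2) / (4 * real n) \<le> (real n)^2 / (4 * real n)"
      using n0 by (intro divide_right_mono) auto
    also have "\<dots> = qmax n" unfolding qmax_def using True n0 by (simp add: power2_eq_square)
    finally show ?thesis unfolding e .
  next
    case False
    have "1 \<le> (real n - 2 * real j)^2"
    proof -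
      define d where "d = int n - 2 * int j"
      have "d \<noteq> 0" unfolding d_def using False by presburger
      then have "1 \<le> \<bar>d\<bar>" by linarith
      then have "1 \<le> d^2" by (metis one_le_power power2_abs)
      then have "1 \<le> real_of_int (d^2)" by linarith
      then show ?thesis unfolding d_def by simp
    qed
    then have "((real n)^2 - (real n - 2 * real j)^2) / (4 * real n) \<le> ((real n)^2 - 1) / (4 * real n)"
      using n0 by (intro divide_right_mono) auto
    also have "\<dots> = qmax n" unfolding qmax_def using False by simp
    finally show ?thesis unfolding e .
  qed
qed

lemma qmax_pos: "2 \<le> n \<Longrightarrow> 0 < qmax n"
  unfolding qmax_def by (auto simp: power2_eq_square intro!: divide_pos_pos)
    (smt (verit) mult_le_cancel_left1 of_nat_1 of_nat_add of_nat_le_iff one_add_one)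

context iid_sample
begin

lemma Q_less_qmax:
  assumes "\<And>i. i < n \<Longrightarrow> 0 < X i \<omega> \<and> X i \<omega> < 1"
  shows "Q \<omega> < qmax n"
proof -
  have n0: "real n \<noteq> 0" "1 < real n" using n2 by auto
  obtain j where j: "j \<le> n" "(\<Sum>i<n. (X i \<omega>)^2) + 0 - ((\<Sum>i<n. X i \<omega>) + 0)^2 / real n < real j + 0 - (real j + 0)^2 / real n"
    using unit_square_sum_less_vertex[of n "\<lambda>i. X i \<omega>" "real n" 0 0] assms n0 n2 by auto
  have "(\<Sum>i<n. (0 + 1 * X i \<omega>)^2) = real n * (0 + 1 * mean \<omega>)^2 + 1^2 * Q \<omega>"
    unfolding Q_def mean_def by (rule sum_shifted_squares[OF n1])
  then have "Q \<omega> = (\<Sum>i<n. (X i \<omega>)^2) - (\<Sum>i<n. X i \<omega>)^2 / real n"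
    using n0 by (simp add: mean_def power2_eq_square field_simps)
  then show ?thesis using j vertex_le_qmax[OF n1 j(1)] by simp
qed

text \<open>By independence the joint law is a product, and each section of the diagonal is a point,
  which is null because \<open>X 1\<close> has a density. This excludes
  \<open>Q = 0\<close>.\<close>

lemma AE_X0_neq_X1: "AE \<omega> in M. X 0 \<omega> \<noteq> X 1 \<omega>"
proof -
  have 01: "0 < n" "1 < n" using n2 by auto
  have m0 [measurable]: "X 0 \<in> borel_measurable M" by (rule X_measurable[OF 01(1)])
  have m1 [measurable]: "X 1 \<in> borel_measurable M" by (rule X_measurable[OF 01(2)])
  have "indep_var (PiM {0} (\<lambda>_. borel)) (\<lambda>\<omega>. restrict (\<lambda>i. X i \<omega>) {0}) (PiM {1} (\<lambda>_. borel)) (\<lambda>\<omega>. restrict (\<lambda>i. X i \<omega>) {1})"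
    by (rule indep_var_restrict[OF indep]) (use n2 in auto)
  then have "indep_var borel ((\<lambda>g. g 0) \<circ> (\<lambda>\<omega>. restrict (\<lambda>i. X i \<omega>) {0})) borel ((\<lambda>g. g 1) \<circ> (\<lambda>\<omega>. restrict (\<lambda>i. X i \<omega>) {1}))"
    by (rule indep_var_compose) (auto intro!: measurable_component_singleton)
  then have iv: "indep_var borel (X 0) borel (X 1)" by (simp add: o_def)
  then have pd: "distr M borel (X 0) \<Otimes>\<^sub>M distr M borel (X 1) = distr M (borel \<Otimes>\<^sub>M borel) (\<lambda>\<omega>. (X 0 \<omega>, X 1 \<omega>))"
    by (simp only: indep_var_distribution_eq)
  interpret D1: prob_space "distr M borel (X 1)" by (rule prob_space_distr[OF m1])
  define E where "E = {z :: real \<times> real. fst z = snd z}"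
  have E [measurable]: "E \<in> sets (borel \<Otimes>\<^sub>M borel)"
    unfolding E_def borel_prod by (intro borel_closed closed_Collect_eq continuous_intros)
  have single: "emeasure (distr M borel (X 1)) {a} = 0" for a
  proof -
    note meas[measurable]
    have "emeasure (distr M borel (X 1)) {a} = emeasure (distr M lborel (X 1)) {a}"
      using m1 by (simp add: emeasure_distr)
    also have "\<dots> = emeasure (density lborel (\<lambda>x. ennreal (indicator {0<..<1} x * f x))) {a}"
      by (simp only: distributed_distr_eq_density[OF dist[OF 01(2)]])
    also have "\<dots> = (\<integral>\<^sup>+x. ennreal (indicator {0<..<1} x * f x) * indicator {a} x \<partial>lborel)"
      by (rule emeasure_density) measurable
    also have "\<dots> = (\<integral>\<^sup>+(x::real). 0 \<partial>lborel)"
      by (rule nn_integral_cong_AE) (use AE_lborel_singleton[of a] in \<open>auto elim!: AE_mp\<close>)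
    finally show ?thesis by simp
  qed
  have "emeasure M {\<omega>\<in>space M. X 0 \<omega> = X 1 \<omega>} = emeasure (distr M (borel \<Otimes>\<^sub>M borel) (\<lambda>\<omega>. (X 0 \<omega>, X 1 \<omega>))) E"
  proof (subst emeasure_distr)
    show "random_variable (borel \<Otimes>\<^sub>M borel) (\<lambda>\<omega>. (X 0 \<omega>, X 1 \<omega>))" using m0 m1 by (rule measurable_Pair)
    show "E \<in> sets (borel \<Otimes>\<^sub>M borel)" by (rule E)
    show "emeasure M {\<omega>\<in>space M. X 0 \<omega> = X 1 \<omega>} = emeasure M ((\<lambda>\<omega>. (X 0 \<omega>, X 1 \<omega>)) -` E \<inter> space M)"
      by (rule arg_cong[where f = "emeasure M"]) (auto simp: E_def)
  qed
  also have "\<dots> = emeasure (distr M borel (X 0) \<Otimes>\<^sub>M distr M borel (X 1)) E" by (simp only: pd)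
  also have "\<dots> = (\<integral>\<^sup>+x. emeasure (distr M borel (X 1)) (Pair x -` E) \<partial>distr M borel (X 0))"
    by (rule D1.emeasure_pair_measure_alt) (simp add: pair_measure_def E_def[symmetric] E[unfolded pair_measure_def])
  also have "\<dots> = (\<integral>\<^sup>+x. 0 \<partial>distr M borel (X 0))"
  proof (rule nn_integral_cong)
    fix x
    have "Pair x -` E = {x}" by (auto simp: E_def)
    then show "emeasure (distr M borel (X 1)) (Pair x -` E) = 0" using single by simp
  qed
  finally have z: "emeasure M {\<omega>\<in>space M. X 0 \<omega> = X 1 \<omega>} = 0" by simp
  show ?thesis
  proof (rule AE_I[OF _ z])
    show "{\<omega>\<in>space M. X 0 \<omega> = X 1 \<omega>} \<in> sets M" by measurable
  qed auto
qed

text \<open>Strictness at both ends is required: rescaled to \<open>pi\<close>, the sine series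
  recovers a law only on the open interval.\<close>

lemma AE_Q: "AE \<omega> in M. 0 < Q \<omega> \<and> Q \<omega> < qmax n"
  using AE_X AE_X0_neq_X1
proof eventually_elim
  case (elim \<omega>)
  have "Q \<omega> \<noteq> 0"
  proof
    assume "Q \<omega> = 0"
    then have "\<forall>i\<in>{..<n}. (X i \<omega> - mean \<omega>)^2 = 0"
      unfolding Q_def by (subst (asm) sum_nonneg_eq_0_iff) auto
    then have "X 0 \<omega> = mean \<omega>" "X 1 \<omega> = mean \<omega>" using n2 by auto
    then show False using elim by simp
  qed
  moreover have "0 \<le> Q \<omega>" unfolding Q_def by (intro sum_nonneg) auto
  ultimately show ?case using Q_less_qmax[of \<omega>] elim by auto
qed

lemma Im_Phi: "Im (\<Phi> t) = (\<integral>\<omega>. sin (t * Q \<omega>) \<partial>M)"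
proof -
  have "integrable M (\<lambda>\<omega>. exp (\<i> * of_real (t * Q \<omega>)))"
    by (rule integrable_const_bound[where B = 1]) auto
  from integral_Im[OF this] show ?thesis unfolding \<Phi>_def by (simp add: Im_exp)
qed

abbreviation "T k \<equiv> tk n (Suc k)"

lemma T_pos: "0 < T k"
  unfolding tk_def using qmax_pos[OF n2] by simp

lemma total_nonneg: "0 \<le> t \<Longrightarrow> 0 \<le> total n t"
  unfolding total_def set_lebesgue_integral_def
  by (intro add_nonneg_nonneg mult_nonneg_nonneg integral_nonneg_AE) auto

text \<open>The decay is known for \<open>t \<ge> 1\<close> only, hence the threshold
  \<open>K\<close>. Taking \<theta> to be 0, 1/2 and 1 will give summability of
  \<open>total / k\<close>, of its square and of \<open>total\<close> itself.\<close>

lemma total_frequencies_bound: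
  assumes "0 \<le> \<theta>" "\<theta> < real n * p/2" "\<theta> < (real n - 1)/2" "\<theta> < real n * p - 1/2"
  obtains C \<gamma> K where "\<theta> < \<gamma>" "0 \<le> C" "\<And>k. K \<le> k \<Longrightarrow> total n (T k) \<le> C * real (Suc k) powr (- \<gamma>)"
proof -
  obtain C \<gamma> where C: "\<theta> < \<gamma>" "0 \<le> C" "\<And>t. 1 \<le> t \<Longrightarrow> total n t \<le> C * t powr (- \<gamma>)"
    by (rule total_decay[OF n1 assms]) blast
  have q: "0 < qmax n" by (rule qmax_pos[OF n2])
  obtain K :: nat where K: "qmax n / pi < real K" using reals_Archimedean2 by blast
  show thesis
  proof (rule that[of \<gamma> "C * (pi / qmax n) powr (- \<gamma>)" K])
    fix k assume "K \<le> k"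
    then have "qmax n / pi \<le> real (Suc k)" using K by simp
    then have "1 \<le> T k" unfolding tk_def using q by (simp add: field_simps)
    then have "total n (T k) \<le> C * T k powr (- \<gamma>)" by (rule C(3))
    also have "T k powr (- \<gamma>) = (pi / qmax n) powr (- \<gamma>) * real (Suc k) powr (- \<gamma>)"
      unfolding tk_def powr_mult[symmetric] by (simp add: mult.commute)
    finally show "total n (T k) \<le> C * (pi / qmax n) powr (- \<gamma>) * real (Suc k) powr (- \<gamma>)" by (simp only: mult.assoc)
  qed (use C in auto)
qed

lemma summable_total_over:
  assumes "1/2 < real n * p"
  shows "summable (\<lambda>k. total n (T k) * (1 / real (Suc k)))"
proof -
  have c: "(0::real) \<le> 0" "0 < real n * p/2" "0 < (real n - 1)/2" "0 < real n * p - 1/2" using assms n2 by auto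
  obtain C \<gamma> K where C: "0 < \<gamma>" "0 \<le> C" "\<And>k. K \<le> k \<Longrightarrow> total n (T k) \<le> C * real (Suc k) powr (- \<gamma>)"
    by (rule total_frequencies_bound[OF c]) blast
  have s: "summable (\<lambda>k. C * real (Suc k) powr (- \<gamma> - 1))"
    using C by (intro summable_mult summable_powr_Suc) simp
  show ?thesis
  proof (rule summable_comparison_test'[OF s])
    fix k assume "K \<le> k"
    from mult_right_mono[OF C(3)[OF this], of "1 / real (Suc k)"]
    have "total n (T k) * (1 / real (Suc k)) \<le> C * (real (Suc k) powr (- \<gamma>) * (1 / real (Suc k)))" by simp
    also have "real (Suc k) powr (- \<gamma>) * (1 / real (Suc k)) = real (Suc k) powr (- \<gamma> - 1)"
      by (simp add: powr_diff)
    finally show "norm (total n (T k) * (1 / real (Suc k))) \<le> C * real (Suc k) powr (- \<gamma> - 1)"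
      using total_nonneg[OF less_imp_le[OF T_pos[of k]]] by simp
  qed
qed

lemma summable_total:
  assumes "2 < real n * p" "3 < n"
  shows "summable (\<lambda>k. total n (T k))"
proof -
  have c: "(0::real) \<le> 1" "1 < real n * p/2" "1 < (real n - 1)/2" "1 < real n * p - 1/2" using assms by auto
  obtain C \<gamma> K where C: "1 < \<gamma>" "0 \<le> C" "\<And>k. K \<le> k \<Longrightarrow> total n (T k) \<le> C * real (Suc k) powr (- \<gamma>)"
    by (rule total_frequencies_bound[OF c]) blast
  have s: "summable (\<lambda>k. C * real (Suc k) powr (- \<gamma>))"
    using C by (intro summable_mult summable_powr_Suc) simp
  show ?thesis
    by (rule summable_comparison_test'[OF s]) (use C(3) total_nonneg[OF less_imp_le[OF T_pos]] in auto)
qed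

lemma summable_total_square:
  assumes "1 < real n * p" "2 < n"
  shows "summable (\<lambda>k. (total n (T k))^2)"
proof -
  have c: "(0::real) \<le> 1/2" "1/2 < real n * p/2" "1/2 < (real n - 1)/2" "1/2 < real n * p - 1/2" using assms by auto
  obtain C \<gamma> K where C: "1/2 < \<gamma>" "0 \<le> C" "\<And>k. K \<le> k \<Longrightarrow> total n (T k) \<le> C * real (Suc k) powr (- \<gamma>)"
    by (rule total_frequencies_bound[OF c]) blast
  have s: "summable (\<lambda>k. C^2 * real (Suc k) powr (- (2 * \<gamma>)))"
    using C by (intro summable_mult summable_powr_Suc) simp
  show ?thesis
  proof (rule summable_comparison_test'[OF s])
    fix k assume "K \<le> k"
    then have "(total n (T k))^2 \<le> (C * real (Suc k) powr (- \<gamma>))^2"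
      using C(3) total_nonneg[OF less_imp_le[OF T_pos[of k]]] by (intro power_mono) auto
    also have "\<dots> = C^2 * real (Suc k) powr (- (2 * \<gamma>))"
      by (simp add: power_mult_distrib powr_power)
    finally show "norm ((total n (T k))^2) \<le> C^2 * real (Suc k) powr (- (2 * \<gamma>))" by simp
  qed
qed

text \<open>The weights \<open>w\<close> stay arbitrary so that the distribution function and its
  termwise derivative are covered at once. Domination by \<open>total\<close> permits exchanging sum
  and integrals; the \<open>k\<close>-th integrals then combine to
  \<open>sqrt (pi / n) * Im (\<Phi> (T k))\<close>, and the prefactor collapses to
  \<open>2 / pi\<close>.\<close>

lemma repr_eq_series:
  assumes w: "\<And>k. \<bar>w (Suc k) x\<bar> \<le> W k" and s: "summable (\<lambda>k. total n (T k) * W k)"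
  shows "repr f n w x = (2 / pi) * (\<Sum>k. Im (\<Phi> (T k)) * w (Suc k) x)"
proof -
  have T0: "0 \<le> T k" for k using T_pos[of k] by simp
  have W0: "0 \<le> W k" for k using w[of k] abs_ge_zero order_trans by blast
  define P where "P = (\<lambda>k u. psi_star f (T k) (- u) ^ n)"
  define R where "R = (\<lambda>k (y::real). psi f (T k) (of_real y) ^ n)"
  define L where "L = (\<lambda>k (y::real). psi f (T k) (- of_real y - sq (T k)) ^ n)"
  have Pi: "set_integrable lborel {0<..<1} (P k)" for k
    unfolding P_def by (rule psi_star_power_integrable[OF T0])
  have Ri: "set_integrable lborel {0<..} (R k)" for k
    unfolding R_def by (rule gaussian_power_integrable(1)[OF _ n1, of _ 1]) (use psi_right_le[OF T0] in auto)
  have Li: "set_integrable lborel {0<..} (L k)" for k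
    unfolding L_def by (rule gaussian_power_integrable(1)[OF _ n1, of _ 1]) (use psi_left_le[OF T0] in auto)
  define IP where "IP k = (LBINT u:{0<..<1}. P k u)" for k
  define IR where "IR k = (LBINT y:{0<..}. R k y)" for k
  define IL where "IL k = (LBINT y:{0<..}. L k y)" for k
  define g1 where "g1 = (\<lambda>k u. indicator {0<..<1} u *\<^sub>R (term1 f n (Suc k) u * w (Suc k) x))"
  define g2 where "g2 = (\<lambda>k y. indicator {0<..} y *\<^sub>R (term2 f n (Suc k) y * w (Suc k) x))"
  have g1e: "g1 k u = w (Suc k) x * Im (sq (T k) * (indicator {0<..<1} u *\<^sub>R P k u))" for k u
    unfolding g1_def term1_def P_def by (auto simp: indicator_def mult.commute)
  have g2e: "g2 k y = w (Suc k) x * Im (indicator {0<..} y *\<^sub>R R k y + indicator {0<..} y *\<^sub>R L k y)" for k y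
    unfolding g2_def term2_def R_def L_def by (auto simp: indicator_def mult.commute)
  have i1: "integrable lborel (\<lambda>u. sq (T k) * (indicator {0<..<1} u *\<^sub>R P k u))" for k
    using Pi[of k] unfolding set_integrable_def by (rule integrable_mult_right)
  have i2: "integrable lborel (\<lambda>y. indicator {0<..} y *\<^sub>R R k y + indicator {0<..} y *\<^sub>R L k y)" for k
    using Ri[of k] Li[of k] unfolding set_integrable_def by (rule Bochner_Integration.integrable_add)
  have g1i: "integrable lborel (g1 k)" for k
    unfolding g1e by (intro integrable_mult_right integrable_Im i1)
  have g2i: "integrable lborel (g2 k)" for k
    unfolding g2e by (intro integrable_mult_right integrable_Im i2)
  have g1I: "(LBINT u. g1 k u) = w (Suc k) x * Im (sq (T k) * IP k)" for k
    unfolding g1e IP_def set_lebesgue_integral_def integral_mult_right_zero integral_Im[OF i1] ..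
  have g2I: "(LBINT y. g2 k y) = w (Suc k) x * Im (IR k + IL k)" for k
    unfolding g2e integral_mult_right_zero integral_Im[OF i2] IR_def IL_def set_lebesgue_integral_def
    by (subst Bochner_Integration.integral_add) (use Ri Li in \<open>auto simp: set_integrable_def\<close>)
  have Pn: "set_integrable lborel {0<..<1} (\<lambda>u. norm (psi_star f (T k) (- u)) ^ n)" for k
    using set_integrable_norm[OF Pi[of k]] by (simp add: P_def norm_power)
  have Rn: "set_integrable lborel {0<..} (\<lambda>y. norm (psi f (T k) (of_real y)) ^ n)" for k
    using set_integrable_norm[OF Ri[of k]] by (simp add: R_def norm_power)
  have Ln: "set_integrable lborel {0<..} (\<lambda>y. norm (psi f (T k) (- of_real y - sq (T k))) ^ n)" for k
    using set_integrable_norm[OF Li[of k]] by (simp add: L_def norm_power)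
  define B1 where "B1 k = sqrt (T k) * (LBINT u:{0<..<1}. norm (psi_star f (T k) (- u)) ^ n)" for k
  define B2 where "B2 k = (LBINT y:{0<..}. norm (psi f (T k) (of_real y)) ^ n)
     + (LBINT y:{0<..}. norm (psi f (T k) (- of_real y - sq (T k))) ^ n)" for k
  have Bt: "total n (T k) = B1 k + B2 k" for k unfolding total_def B1_def B2_def by simp
  have B1p: "0 \<le> B1 k" for k unfolding B1_def set_lebesgue_integral_def
    by (intro mult_nonneg_nonneg integral_nonneg_AE) (use T0[of k] in auto)
  have B2p: "0 \<le> B2 k" for k unfolding B2_def set_lebesgue_integral_def
    by (intro add_nonneg_nonneg integral_nonneg_AE) auto
  have b1: "(LBINT u. norm (g1 k u)) \<le> B1 k * W k" for k
  proof -
    have "(LBINT u. norm (g1 k u)) \<le> (LBINT u. W k * (sqrt (T k) * (indicator {0<..<1} u *\<^sub>R norm (psi_star f (T k) (- u)) ^ n)))"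
    proof (rule integral_mono[OF integrable_norm[OF g1i]])
      show "integrable lborel (\<lambda>u. W k * (sqrt (T k) * (indicator {0<..<1} u *\<^sub>R norm (psi_star f (T k) (- u)) ^ n)))"
        using Pn[of k] unfolding set_integrable_def by (intro integrable_mult_right)
      fix u
      have "norm (g1 k u) \<le> W k * norm (sq (T k) * (indicator {0<..<1} u *\<^sub>R P k u))"
        unfolding g1e real_norm_def abs_mult using W0[of k]
        by (intro mult_mono w abs_Im_le_cmod) auto
      also have "norm (sq (T k) * (indicator {0<..<1} u *\<^sub>R P k u)) = sqrt (T k) * (indicator {0<..<1} u *\<^sub>R norm (psi_star f (T k) (- u)) ^ n)"
        unfolding norm_mult sq_facts(2)[OF T0] P_def by (simp add: norm_power)
      finally show "norm (g1 k u) \<le> W k * (sqrt (T k) * (indicator {0<..<1} u *\<^sub>R norm (psi_star f (T k) (- u)) ^ n))" .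
    qed
    also have "\<dots> = B1 k * W k" unfolding B1_def set_lebesgue_integral_def integral_mult_right_zero by simp
    finally show ?thesis .
  qed
  have b2: "(LBINT y. norm (g2 k y)) \<le> B2 k * W k" for k
  proof -
    have "(LBINT y. norm (g2 k y)) \<le> (LBINT y. W k * (indicator {0<..} y *\<^sub>R norm (psi f (T k) (of_real y)) ^ n
        + indicator {0<..} y *\<^sub>R norm (psi f (T k) (- of_real y - sq (T k))) ^ n))"
    proof (rule integral_mono[OF integrable_norm[OF g2i]])
      show "integrable lborel (\<lambda>y. W k * (indicator {0<..} y *\<^sub>R norm (psi f (T k) (of_real y)) ^ n
        + indicator {0<..} y *\<^sub>R norm (psi f (T k) (- of_real y - sq (T k))) ^ n))"
        using Rn[of k] Ln[of k] unfolding set_integrable_def by (intro integrable_mult_right Bochner_Integration.integrable_add)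
      fix y :: real
      have "norm (g2 k y) \<le> W k * norm (indicator {0<..} y *\<^sub>R R k y + indicator {0<..} y *\<^sub>R L k y)"
        unfolding g2e real_norm_def abs_mult using W0[of k]
        by (intro mult_mono w abs_Im_le_cmod) auto
      also have "\<dots> \<le> W k * (norm (indicator {0<..} y *\<^sub>R R k y) + norm (indicator {0<..} y *\<^sub>R L k y))"
        using W0[of k] by (intro mult_left_mono norm_triangle_ineq)
      finally show "norm (g2 k y) \<le> W k * (indicator {0<..} y *\<^sub>R norm (psi f (T k) (of_real y)) ^ n
        + indicator {0<..} y *\<^sub>R norm (psi f (T k) (- of_real y - sq (T k))) ^ n)"
        by (simp add: R_def L_def norm_power)
    qed
    also have "\<dots> = B2 k * W k" unfolding B2_def set_lebesgue_integral_def integral_mult_right_zero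
      by (subst Bochner_Integration.integral_add) (use Rn[of k] Ln[of k] in \<open>auto simp: set_integrable_def\<close>)
    finally show ?thesis .
  qed
  have s1: "summable (\<lambda>k. LBINT u. norm (g1 k u))"
  proof (rule summable_comparison_test'[OF s])
    fix k
    have "B1 k * W k \<le> total n (T k) * W k" unfolding Bt using B2p W0 by (intro mult_right_mono) auto
    then show "norm (LBINT u. norm (g1 k u)) \<le> total n (T k) * W k" using b1[of k] by simp
  qed
  have s2: "summable (\<lambda>k. LBINT y. norm (g2 k y))"
  proof (rule summable_comparison_test'[OF s])
    fix k
    have "B2 k * W k \<le> total n (T k) * W k" unfolding Bt using B1p W0 by (intro mult_right_mono) auto
    then show "norm (LBINT y. norm (g2 k y)) \<le> total n (T k) * W k" using b2[of k] by simp
  qed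
  have S1: "(\<lambda>k. LBINT u. g1 k u) sums (LBINT u. \<Sum>k. g1 k u)"
    by (rule sums_integral[OF g1i AE_summable_norm[OF g1i s1] s1])
  have S2: "(\<lambda>k. LBINT y. g2 k y) sums (LBINT y. \<Sum>k. g2 k y)"
    by (rule sums_integral[OF g2i AE_summable_norm[OF g2i s2] s2])
  have e1: "(LBINT u:{0<..<1}. (\<Sum>k. term1 f n (Suc k) u * w (Suc k) x)) = (LBINT u. \<Sum>k. g1 k u)"
    unfolding set_lebesgue_integral_def g1_def
    by (rule Bochner_Integration.integral_cong) (auto simp: indicator_def)
  have e2: "(LBINT y:{0<..}. (\<Sum>k. term2 f n (Suc k) y * w (Suc k) x)) = (LBINT y. \<Sum>k. g2 k y)"
    unfolding set_lebesgue_integral_def g2_def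
    by (rule Bochner_Integration.integral_cong) (auto simp: indicator_def)
  have sq1: "sqrt (real n) * sqrt (pi / real n) = sqrt pi" using n1 by (simp add: real_sqrt_divide)
  have pp: "pi powr (-3/2) * sqrt pi = 1 / pi"
  proof -
    have "pi powr (-3/2) * sqrt pi = pi powr (-3/2) * pi powr (1/2)" by (simp add: powr_half_sqrt)
    also have "\<dots> = pi powr (-1)" by (simp only: powr_add[symmetric]) simp
    finally show ?thesis by (simp add: powr_minus_divide)
  qed
  have kth: "(LBINT u. g1 k u) + (LBINT y. g2 k y) = sqrt (pi / real n) * (Im (\<Phi> (T k)) * w (Suc k) x)" for k
  proof -
    have "(LBINT u. g1 k u) + (LBINT y. g2 k y) = w (Suc k) x * Im (sq (T k) * IP k + IR k + IL k)"
      unfolding g1I g2I by (simp only: plus_complex.simps distrib_left add.assoc)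
    also have "sq (T k) * IP k + IR k + IL k = of_real (sqrt (pi / real n)) * \<Phi> (T k)"
      unfolding IP_def IR_def IL_def P_def R_def L_def by (rule char_repr[OF T0, symmetric])
    also have "Im (of_real (sqrt (pi / real n)) * \<Phi> (T k)) = sqrt (pi / real n) * Im (\<Phi> (T k))"
      by (simp only: Im_complex_of_real Re_complex_of_real times_complex.simps)
    finally show ?thesis by (simp only: mult_ac)
  qed
  have "(\<lambda>k. sqrt (pi / real n) * (Im (\<Phi> (T k)) * w (Suc k) x)) sums ((LBINT u. \<Sum>k. g1 k u) + (LBINT y. \<Sum>k. g2 k y))"
    using sums_add[OF S1 S2] unfolding kth .
  from sums_mult[OF this, of "2 * pi powr (-3/2) * sqrt (real n)"]
  have "(\<lambda>k. 2 * pi powr (-3/2) * sqrt (real n) * (sqrt (pi / real n) * (Im (\<Phi> (T k)) * w (Suc k) x))) sums repr f n w x"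
    unfolding repr_def e1 e2 .
  moreover have "2 * pi powr (-3/2) * sqrt (real n) * (sqrt (pi / real n) * z) = (2 / pi) * z" for z
  proof -
    have "2 * pi powr (-3/2) * sqrt (real n) * (sqrt (pi / real n) * z)
        = 2 * (pi powr (-3/2) * (sqrt (real n) * sqrt (pi / real n))) * z" by (simp only: mult_ac)
    then show ?thesis unfolding sq1 pp by simp
  qed
  ultimately have r: "(\<lambda>k. (2 / pi) * (Im (\<Phi> (T k)) * w (Suc k) x)) sums repr f n w x" by (simp only:)
  \<comment> \<open>Convergence is known for the scaled series; undoing the factor transfers it to
    the bare one, whose sum can then be named.\<close>
  have c: "pi / 2 * ((2 / pi) * z) = z" for z by simp
  from sums_mult[OF r, of "pi / 2"]
  have "(\<lambda>k. Im (\<Phi> (T k)) * w (Suc k) x) sums (pi / 2 * repr f n w x)" by (simp only: c)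
  from sums_unique[OF this, symmetric] show ?thesis by (simp add: field_simps)
qed

lemma Phi_le: "\<bar>Im (\<Phi> (T k))\<bar> \<le> sqrt (real n / pi) * total n (T k)"
  using abs_Im_le_cmod[of "\<Phi> (T k)"] Phi_total_bound[OF less_imp_le[OF T_pos[of k]]] by linarith

lemma cdf_series:
  assumes np: "1/2 < real n * p" and x: "0 \<le> x" "x \<le> qmax n"
  shows "prob {\<omega>\<in>space M. Q \<omega> \<le> x} = (2 / pi) * (\<Sum>k. Im (\<Phi> (T k)) * ((1 - cos (T k * x)) / real (Suc k)))"
    "summable (\<lambda>k. Im (\<Phi> (T k)) * ((1 - cos (T k * x)) / real (Suc k)))"
proof -
  have q: "0 < qmax n" by (rule qmax_pos[OF n2])
  have sm: "summable (\<lambda>k. \<bar>Im (\<Phi> (T k))\<bar> / real (Suc k))"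
  proof (rule summable_comparison_test'[OF summable_mult[OF summable_total_over[OF np], of "sqrt (real n / pi)"]])
    fix k
    show "norm (\<bar>Im (\<Phi> (T k))\<bar> / real (Suc k)) \<le> sqrt (real n / pi) * (total n (T k) * (1 / real (Suc k)))"
      using divide_right_mono[OF Phi_le[of k], of "real (Suc k)"] by simp
  qed
  \<comment> \<open>Rescaling carries the range of \<open>Q\<close> to \<open>(0, pi)\<close> and
    turns the frequencies \<open>T k\<close> into the integers \<open>k + 1\<close>.\<close>
  define Y where "Y = (\<lambda>\<omega>. pi / qmax n * Q \<omega>)"
  define \<xi> where "\<xi> = pi / qmax n * x"
  have Ym: "Y \<in> borel_measurable M" unfolding Y_def by measurable
  have YA: "AE \<omega> in M. 0 < Y \<omega> \<and> Y \<omega> < pi"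
    using AE_Q by eventually_elim (use q in \<open>auto simp: Y_def field_simps\<close>)
  have TY: "real (Suc k) * (pi / qmax n * z) = T k * z" for k z unfolding tk_def by simp
  have \<xi>: "0 \<le> \<xi>" "\<xi> \<le> pi" using x q unfolding \<xi>_def by (auto simp: field_simps)
  have a: "Im (\<Phi> (T k)) = (\<integral>\<omega>. sin (real (Suc k) * Y \<omega>) \<partial>M)" for k
    unfolding Y_def TY by (rule Im_Phi)
  have "prob {\<omega>\<in>space M. Y \<omega> \<le> \<xi>} = (2 / pi) * (\<Sum>k. Im (\<Phi> (T k)) * ((1 - cos (real (Suc k) * \<xi>)) / real (Suc k)))"
    by (rule sine_series_cdf[OF Ym YA \<xi> a sm])
  moreover have "{\<omega>\<in>space M. Y \<omega> \<le> \<xi>} = {\<omega>\<in>space M. Q \<omega> \<le> x}"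
    unfolding Y_def \<xi>_def using q by (auto simp: field_simps)
  ultimately show "prob {\<omega>\<in>space M. Q \<omega> \<le> x} = (2 / pi) * (\<Sum>k. Im (\<Phi> (T k)) * ((1 - cos (T k * x)) / real (Suc k)))"
    unfolding \<xi>_def TY by simp
  show "summable (\<lambda>k. Im (\<Phi> (T k)) * ((1 - cos (T k * x)) / real (Suc k)))"
  proof (rule summable_comparison_test'[OF summable_mult[OF sm, of 2]])
    fix k
    have "\<bar>1 - cos (T k * x)\<bar> \<le> 2" using cos_le_one[of "T k * x"] cos_ge_minus_one[of "T k * x"] by linarith
    then have "\<bar>Im (\<Phi> (T k))\<bar> * (\<bar>1 - cos (T k * x)\<bar> / real (Suc k)) \<le> \<bar>Im (\<Phi> (T k))\<bar> * (2 / real (Suc k))"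
      by (intro mult_left_mono divide_right_mono) auto
    then show "norm (Im (\<Phi> (T k)) * ((1 - cos (T k * x)) / real (Suc k))) \<le> 2 * (\<bar>Im (\<Phi> (T k))\<bar> / real (Suc k))"
      by (simp add: abs_mult mult.commute)
  qed
qed

text \<open>The sine coefficients of the law of \<open>Q\<close> on its range: by
  \<open>Im_Phi\<close>, \<open>2 / q\<close> times the expectation of
  \<open>sin (T k * Q)\<close>.\<close>

definition coeff :: "nat \<Rightarrow> real" where "coeff k = 2 / qmax n * Im (\<Phi> (T k))"

lemma cdf_series_coeff:
  assumes np: "1/2 < real n * p" and x: "0 \<le> x" "x \<le> qmax n"
  shows "prob {\<omega>\<in>space M. Q \<omega> \<le> x}
     = (\<Sum>k. coeff k * sine_int (qmax n) k x)"
    "summable (\<lambda>k. coeff k * sine_int (qmax n) k x)"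
proof -
  have q: "0 < qmax n" by (rule qmax_pos[OF n2])
  have e: "coeff k * sine_int (qmax n) k x
      = (2 / pi) * (Im (\<Phi> (T k)) * ((1 - cos (T k * x)) / real (Suc k)))" for k
  proof -
    have "2 / qmax n * a * (d / (K * pi / qmax n)) = (2 / pi) * (a * (d / K))" if "0 < K" for a d K
      using q that by (simp add: field_simps)
    then show ?thesis unfolding coeff_def tk_def by simp
  qed
  show "summable (\<lambda>k. coeff k * sine_int (qmax n) k x)"
    unfolding e by (intro summable_mult cdf_series(2)[OF assms])
  show "prob {\<omega>\<in>space M. Q \<omega> \<le> x}
     = (\<Sum>k. coeff k * sine_int (qmax n) k x)"
    unfolding e cdf_series(1)[OF assms] by (rule suminf_mult[OF cdf_series(2)[OF assms], symmetric])
qed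

lemma cdf_representation:
  assumes np: "1/2 < real n * p" and x: "0 \<le> x" "x \<le> qmax n"
  shows "prob {\<omega>\<in>space M. Q \<omega> \<le> x} = cdf_repr f n x"
proof -
  have s: "summable (\<lambda>k. total n (T k) * (2 / real (Suc k)))"
    using summable_mult[OF summable_total_over[OF np], of 2] by (simp add: mult_ac)
  have "cdf_repr f n x = (2 / pi) * (\<Sum>k. Im (\<Phi> (T k)) * ((1 - cos (T k * x)) / real (Suc k)))"
    unfolding cdf_repr_def
  proof (rule repr_eq_series[OF _ s])
    fix k
    have "\<bar>1 - cos (T k * x)\<bar> \<le> 2" using cos_le_one[of "T k * x"] cos_ge_minus_one[of "T k * x"] by linarith
    then show "\<bar>(1 - cos (T k * x)) / real (Suc k)\<bar> \<le> 2 / real (Suc k)"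
      unfolding abs_divide abs_of_nat by (intro divide_right_mono) auto
  qed
  then show ?thesis using cdf_series(1)[OF assms] by simp
qed

text \<open>The squares of the coefficients are summable through \<open>total\<close>, so they
  belong to an L2 function; its indefinite integral is the distribution function because both have
  the same integrated sine series.\<close>

lemma square_integrable_density:
  assumes np: "1 < real n * p" "2 < n"
  obtains g where "\<And>x. 0 \<le> g x" "distributed M lborel Q (\<lambda>x. ennreal (g x))"
    "set_integrable lborel {0<..<qmax n} (\<lambda>x. (g x)^2)"
proof -
  have q: "0 < qmax n" by (rule qmax_pos[OF n2])
  define D where "D = 2 / qmax n * sqrt (real n / pi)"
  have "summable (\<lambda>k. (coeff k)^2)"
  proof (rule summable_comparison_test'[OF summable_mult[OF summable_total_square[OF np], of "D^2"]])
    fix k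
    have "\<bar>coeff k\<bar> \<le> D * total n (T k)" unfolding coeff_def D_def abs_mult
      using mult_left_mono[OF Phi_le[of k], of "2 / qmax n"] q by (simp add: mult.assoc)
    then have "\<bar>coeff k\<bar>^2 \<le> (D * total n (T k))^2" by (intro power_mono) auto
    then show "norm ((coeff k)^2) \<le> D^2 * (total n (T k))^2" by (simp add: power_mult_distrib)
  qed
  from sine_series_L2[OF q this] obtain h where hi: "integrable lborel h"
    and h0: "\<And>x. x \<notin> {0<..<qmax n} \<Longrightarrow> h x = 0" and h2: "integrable lborel (\<lambda>x. (h x)^2)"
    and hc: "\<And>\<xi>. 0 \<le> \<xi> \<Longrightarrow> \<xi> \<le> qmax n \<Longrightarrow>
       summable (\<lambda>k. coeff k * sine_int (qmax n) k \<xi>) \<Longrightarrow>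
       (LBINT x:{0..\<xi>}. h x) = (\<Sum>k. coeff k * sine_int (qmax n) k \<xi>)"
    by blast
  have np': "1/2 < real n * p" using np by simp
  have [measurable]: "h \<in> borel_measurable borel" using hi by auto
  show thesis
  proof (rule that)
    show "0 \<le> max 0 (h x)" for x by simp
    show "distributed M lborel Q (\<lambda>x. ennreal (max 0 (h x)))"
      by (rule distributed_from_cdf[OF Q_measurable AE_Q q hi h0])
        (use hc cdf_series_coeff[OF np'] in auto)
    have "integrable lborel (\<lambda>x. (max 0 (h x))^2)"
      by (rule Bochner_Integration.integrable_bound[OF h2]) (auto simp: max_def)
    then show "set_integrable lborel {0<..<qmax n} (\<lambda>x. (max 0 (h x))^2)"
      unfolding set_integrable_def by (intro integrable_mult_indicator) auto
  qed
qed

text \<open>The coefficients are now absolutely summable, so the sine series is continuous and is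
  itself a density; termwise differentiation turns the representation into this series at every
  point.\<close>

lemma density_representation:
  assumes np: "2 < real n * p" "3 < n"
  obtains g where "\<And>x. 0 \<le> g x" "distributed M lborel Q (\<lambda>x. ennreal (g x))"
    "\<And>x. x \<in> {0<..<qmax n} \<Longrightarrow> g x = dens_repr f n x"
proof -
  have q: "0 < qmax n" by (rule qmax_pos[OF n2])
  have np': "1/2 < real n * p" using np by simp
  define D where "D = 2 / qmax n * sqrt (real n / pi)"
  have cs: "summable (\<lambda>k. \<bar>coeff k\<bar>)"
  proof (rule summable_comparison_test'[OF summable_mult[OF summable_total[OF np], of D]])
    fix k
    show "norm \<bar>coeff k\<bar> \<le> D * total n (T k)" unfolding coeff_def D_def
      using mult_left_mono[OF Phi_le[of k], of "2 / qmax n"] q by (simp add: mult.assoc abs_mult)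
  qed
  define h where "h = (\<lambda>x. \<Sum>k. coeff k * sin (real (Suc k) * pi / qmax n * x))"
  have hcont: "continuous_on UNIV h" unfolding h_def by (rule sine_series_continuous(1)[OF q cs])
  have hint: "prob {\<omega>\<in>space M. Q \<omega> \<le> \<xi>} = (LBINT x:{0..\<xi>}. h x)" if "0 \<le> \<xi>" "\<xi> \<le> qmax n" for \<xi>
    unfolding h_def sine_series_continuous(2)[OF q cs that(1)] by (rule cdf_series_coeff(1)[OF np' that])
  have hs: "set_integrable lborel {0..\<xi>} h" for \<xi>
    by (rule borel_integrable_atLeastAtMost'[OF continuous_on_subset[OF hcont]]) auto
  \<comment> \<open>Nonnegativity is needed at every point, since the representation is claimed
    pointwise. It holds because \<open>h\<close> is the derivative of a monotone function.\<close>
  have hnn: "0 \<le> h x" if x: "x \<in> {0<..<qmax n}" for x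
  proof (rule mono_on_imp_deriv_nonneg)
    show "mono_on {0..qmax n} (\<lambda>\<xi>. integral {0..\<xi>} h)"
    proof (rule mono_onI)
      fix a b assume ab: "a \<in> {0..qmax n}" "b \<in> {0..qmax n}" "a \<le> b"
      have "prob {\<omega>\<in>space M. Q \<omega> \<le> a} \<le> prob {\<omega>\<in>space M. Q \<omega> \<le> b}"
        using ab by (intro finite_measure_mono) auto
      then show "integral {0..a} h \<le> integral {0..b} h"
        using hint[of a] hint[of b] ab by (simp add: set_borel_integral_eq_integral(2)[OF hs])
    qed
    have "((\<lambda>\<xi>. integral {0..\<xi>} h) has_vector_derivative h x) (at x within {0..qmax n})"
      using x by (intro integral_has_vector_derivative continuous_on_subset[OF hcont]) auto
    then show "((\<lambda>\<xi>. integral {0..\<xi>} h) has_real_derivative h x) (at x)"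
      using x by (simp add: has_real_derivative_iff_has_vector_derivative at_within_Icc_at)
    show "x \<in> interior {0..qmax n}" using x by simp
  qed
  define g where "g = (\<lambda>x. indicator {0<..<qmax n} x * h x)"
  have gnn: "0 \<le> g x" for x unfolding g_def using hnn by (auto simp: indicator_def)
  have gi: "integrable lborel g"
    using set_integrable_subset[OF hs[of "qmax n"], of "{0<..<qmax n}"]
    by (auto simp: g_def set_integrable_def subset_eq)
  have "distributed M lborel Q (\<lambda>x. ennreal (max 0 (g x)))"
  proof (rule distributed_from_cdf[OF Q_measurable AE_Q q gi])
    show "g x = 0" if "x \<notin> {0<..<qmax n}" for x unfolding g_def using that by simp
    fix \<xi> assume \<xi>: "0 \<le> \<xi>" "\<xi> \<le> qmax n"
    have "(LBINT x:{0..\<xi>}. g x) = (LBINT x:{0..\<xi>}. h x)"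
      unfolding set_lebesgue_integral_def
      by (rule integral_discrete_difference[of "{0, qmax n}"]) (use \<xi> in \<open>auto simp: g_def indicator_def\<close>)
    then show "prob {\<omega>\<in>space M. Q \<omega> \<le> \<xi>} = (LBINT x:{0..\<xi>}. g x)" using hint[OF \<xi>] by simp
  qed
  then have dg: "distributed M lborel Q (\<lambda>x. ennreal (g x))" using gnn by (simp add: max_def)
  have dens: "dens_repr f n x = h x" for x
  proof -
    \<comment> \<open>In the derivative \<open>T k\<close> cancels \<open>k + 1\<close> and leaves
      the constant \<open>pi / q\<close>, so the weights no longer decay and \<open>total\<close>
      itself must be summable.\<close>
    have s: "summable (\<lambda>k. total n (T k) * (pi / qmax n))"
      using summable_total[OF np] by (rule summable_mult2)
    have "dens_repr f n x = (2 / pi) * (\<Sum>k. Im (\<Phi> (T k)) * (T k * sin (T k * x) / real (Suc k)))"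
      unfolding dens_repr_def
    proof (rule repr_eq_series[OF _ s])
      fix k
      have "\<bar>T k * sin (T k * x) / real (Suc k)\<bar> = pi / qmax n * \<bar>sin (T k * x)\<bar>"
        unfolding tk_def using q by (simp add: abs_mult)
      also have "\<dots> \<le> pi / qmax n * 1" using q by (intro mult_left_mono) auto
      finally show "\<bar>T k * sin (T k * x) / real (Suc k)\<bar> \<le> pi / qmax n" by simp
    qed
    also have "\<dots> = h x"
    proof -
      have e: "coeff k * sin (real (Suc k) * pi / qmax n * x) = (2 / pi) * (Im (\<Phi> (T k)) * (T k * sin (T k * x) / real (Suc k)))" for k
      proof -
        have "2 / qmax n * a * d = (2 / pi) * (a * (K * pi / qmax n * d / K))" if "0 < K" for a d K
          using q that by (simp add: field_simps)
        from this[of "real (Suc k)"] show ?thesis unfolding coeff_def tk_def by (simp only: of_nat_0_less_iff zero_less_Suc)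
      qed
      have "summable (\<lambda>k. coeff k * sin (real (Suc k) * pi / qmax n * x))"
        by (rule summable_comparison_test'[OF cs]) (simp add: abs_mult mult_left_le)
      then have "summable (\<lambda>k. Im (\<Phi> (T k)) * (T k * sin (T k * x) / real (Suc k)))"
        unfolding e by (subst (asm) summable_cmult_iff) simp
      from suminf_mult[OF this, of "2 / pi"] show ?thesis unfolding h_def e by (rule sym)
    qed
    finally show ?thesis .
  qed
  show thesis
    by (rule that[OF gnn dg]) (simp add: g_def dens)
qed

end

theorem theorem4:
  fixes M :: "'a measure" and X :: "nat \<Rightarrow> 'a \<Rightarrow> real" and f :: "real \<Rightarrow> real"
    and ps qs :: "real list" and n :: nat
  assumes "prob_space M"
    and "\<forall>p\<in>set ps \<union> set qs. 0 < p \<and> p < 1"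
    and "set ps \<union> set qs \<noteq> {}"
    and "BVC_star ps qs f"
    and "\<forall>x\<in>{0<..<1}. 0 \<le> f x"
    and "prob_space.indep_vars M (\<lambda>_. borel) X {..<n}"
    and "\<forall>i<n. distributed M lborel (X i) (\<lambda>x. ennreal (indicator {0<..<1} x * f x))"
  defines "Q \<equiv> (\<lambda>\<omega>. \<Sum>i<n. (X i \<omega> - (\<Sum>j<n. X j \<omega>) / real n) ^ 2)"
    and "\<delta> \<equiv> min (real n * Min (set ps \<union> set qs)) (real n - 1) / 2"
  shows "(\<delta> > 1/2 \<longrightarrow> (\<exists>g. (\<forall>x. 0 \<le> g x) \<and> distributed M lborel Q (\<lambda>x. ennreal (g x)) \<and>
              set_integrable lborel {0<..<qmax n} (\<lambda>x. (g x) ^ 2)))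
       \<and> (\<delta> > 1/4 \<longrightarrow> (\<forall>x\<in>{0..qmax n}. measure M {\<omega>\<in>space M. Q \<omega> \<le> x} = cdf_repr f n x))
       \<and> (\<delta> > 1 \<longrightarrow> (\<exists>g. (\<forall>x. 0 \<le> g x) \<and> distributed M lborel Q (\<lambda>x. ennreal (g x)) \<and>
              (\<forall>x\<in>{0<..<qmax n}. g x = dens_repr f n x)))"
proof (cases "2 \<le> n")
  case False
  \<comment> \<open>With fewer than two samples \<delta> is not positive, and all three claims are
    vacuous.\<close>
  then have "real n - 1 \<le> 0" by auto
  then have "\<delta> \<le> 0" unfolding \<delta>_def by simp
  then show ?thesis by auto
next
  case True
  define p where "p = Min (set ps \<union> set qs)"
  have fin: "finite (set ps \<union> set qs)" by simp
  have pin: "p \<in> set ps \<union> set qs" unfolding p_def using Min_in[OF fin assms(3)] .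
  interpret M: prob_space M by fact
  have dist0: "distributed M lborel (X 0) (\<lambda>x. ennreal (indicator {0<..<1} x * f x))" using assms(7) True by simp
  have nn: "0 \<le> indicator {0<..<1} x * f x" for x using assms(5) by (auto simp: indicator_def)
  \<comment> \<open>Measurability and total mass one of the truncated density are read off from the
    law of \<open>X 0\<close>.\<close>
  have "(\<lambda>x. enn2real (ennreal (indicator {0<..<1} x * f x))) \<in> borel_measurable lborel"
    using distributed_borel_measurable[OF dist0] by (rule borel_measurable_enn2real)
  then have fm: "(\<lambda>x. indicator {0<..<1} x * f x) \<in> borel_measurable borel" using nn by simp
  have "emeasure (density lborel (\<lambda>x. ennreal (indicator {0<..<1} x * f x))) UNIV = 1"
  proof -
    interpret D: prob_space "distr M lborel (X 0)"
      by (rule M.prob_space_distr[OF distributed_measurable[OF dist0]])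
    show ?thesis using D.emeasure_space_1 unfolding distributed_distr_eq_density[OF dist0] by simp
  qed
  then have one: "(\<integral>\<^sup>+x. ennreal (indicator {0<..<1} x * f x) \<partial>lborel) = ennreal 1"
    by (subst (asm) emeasure_density) (use fm in auto)
  have hb: "has_bochner_integral lborel (\<lambda>x. indicator {0<..<1} x * f x) 1"
    by (rule has_bochner_integral_nn_integral[OF _ _ _ one]) (use fm nn in auto)
  interpret S: iid_sample M f ps qs p X n
  proof unfold_locales
    show "BVC_star ps qs f" by fact
    show "0 < p" "p < 1" using assms(2) pin by auto
    show "p \<le> r \<and> r < 1" if "r \<in> set ps \<union> set qs" for r
      unfolding p_def using assms(2) that Min_le[OF fin that] by auto
    show "M.indep_vars (\<lambda>_. borel) X {..<n}" by fact
    show "2 \<le> n" by fact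
    show "set_integrable lborel {0<..<1} f" "(LBINT x:{0<..<1}. f x) = 1"
      using hb by (auto simp: has_bochner_integral_iff set_integrable_def set_lebesgue_integral_def)
  qed (use assms(5,7) fm in auto)
  have Q: "Q = S.Q" unfolding Q_def S.Q_def[abs_def] S.mean_def by simp
  show ?thesis
  proof (intro conjI impI)
    assume "\<delta> > 1/2"
    then have "1 < real n * p" "2 < n" unfolding \<delta>_def p_def by auto
    from S.square_integrable_density[OF this] show "\<exists>g. (\<forall>x. 0 \<le> g x) \<and> distributed M lborel Q (\<lambda>x. ennreal (g x)) \<and>
        set_integrable lborel {0<..<qmax n} (\<lambda>x. (g x) ^ 2)"
      unfolding Q by metis
  next
    assume "\<delta> > 1/4"
    then have "1/2 < real n * p" unfolding \<delta>_def p_def by auto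
    then show "\<forall>x\<in>{0..qmax n}. measure M {\<omega>\<in>space M. Q \<omega> \<le> x} = cdf_repr f n x"
      unfolding Q using S.cdf_representation by auto
  next
    assume "\<delta> > 1"
    then have "2 < real n * p" "3 < n" unfolding \<delta>_def p_def by auto
    from S.density_representation[OF this] show "\<exists>g. (\<forall>x. 0 \<le> g x) \<and> distributed M lborel Q (\<lambda>x. ennreal (g x)) \<and>
        (\<forall>x\<in>{0<..<qmax n}. g x = dens_repr f n x)"
      unfolding Q by metis
  qed
qed

end
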